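(* For $U\in L^2_{\rm loc}(\mathbb R)$ and $\gamma,\delta\in\mathbb C$ with $|\gamma|=|\delta|=1$ define, in $L^2(\mathbb R)\oplus L^2(\mathbb R)$, $$\mathcal T=\begin{pmatrix}-\frac{d^2}{dx^2}&\gamma\frac{d}{dx}\\ \delta\frac{d}{dx}&U\end{pmatrix},\qquad\operatorname{dom}(\mathcal T)=W^{2,2}(\mathbb R)\oplus\{f\in W^{1,2}(\mathbb R):Uf\in L^2(\mathbb R)\}.$$ The operator matrix $\mathcal T$ is not closed but closable, with $\sigma_{\rm app}(\overline{\mathcal T})$ contained in the set $$\begin{aligned}&\big\{\lambda\in\mathbb C:\operatorname{Re}\lambda<0,\ \operatorname{dist}(\lambda,\operatorname{essran}(U))\le1\big\}\cup[0,\infty)\\&\cup\Big\{\lambda\in\mathbb C:\operatorname{Re}\lambda\ge0,\ \operatorname{Im}\lambda\ne0,\ \operatorname{dist}(\lambda,\operatorname{essran}(U))\le\frac{|\lambda|}{|\operatorname{Im}\lambda|}\Big\}.\end{aligned}$$ This set in particular contains the $1$-neighbourhood of $\operatorname{essran}(U)$.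
   Context: $U$ is complex-valued, $\operatorname{essran}(U)$ is its essential range, $\sigma_{\rm app}$ is the approximate point spectrum, and $\overline{\mathcal T}$ is the closure of $\mathcal T$. *)

theory Defs
  imports "HOL-Analysis.Analysis"
begin

section \<open>The Hilbert space of square-integrable complex functions on the line\<close>

definition square_integrable :: "(real \<Rightarrow> complex) \<Rightarrow> bool" where
  "square_integrable f \<longleftrightarrow>
     f \<in> borel_measurable lebesgue \<and> integrable lebesgue (\<lambda>x. (cmod (f x))\<^sup>2)"

lemma square_integrable_zero: "square_integrable (\<lambda>x. 0)"
  by (simp add: square_integrable_def)

lemma square_integrable_add:
  assumes "square_integrable f" "square_integrable g"
  shows "square_integrable (\<lambda>x. f x + g x)"
proof -
  have m [measurable]: "f \<in> borel_measurable lebesgue" "g \<in> borel_measurable lebesgue"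
    using assms by (auto simp: square_integrable_def)
  have "integrable lebesgue (\<lambda>x. 2 * (cmod (f x))\<^sup>2 + 2 * (cmod (g x))\<^sup>2)"
    using assms by (auto simp: square_integrable_def)
  then have "integrable lebesgue (\<lambda>x. (cmod (f x + g x))\<^sup>2)"
  proof (rule Bochner_Integration.integrable_bound)
    show "AE x in lebesgue. norm ((cmod (f x + g x))\<^sup>2)
            \<le> norm (2 * (cmod (f x))\<^sup>2 + 2 * (cmod (g x))\<^sup>2)"
    proof (rule AE_I2)
      fix x
      have "(cmod (f x + g x))\<^sup>2 \<le> (cmod (f x) + cmod (g x))\<^sup>2"
        by (intro power_mono norm_triangle_ineq) auto
      also have "\<dots> \<le> 2 * (cmod (f x))\<^sup>2 + 2 * (cmod (g x))\<^sup>2"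
        using sum_squares_bound[of "cmod (f x)" "cmod (g x)"] by (simp add: power2_sum)
      finally show "norm ((cmod (f x + g x))\<^sup>2)
            \<le> norm (2 * (cmod (f x))\<^sup>2 + 2 * (cmod (g x))\<^sup>2)" by simp
    qed
  qed simp
  then show ?thesis by (simp add: square_integrable_def)
qed

lemma square_integrable_mult:
  assumes "square_integrable f"
  shows "square_integrable (\<lambda>x. c * f x)"
  using assms by (auto simp: square_integrable_def norm_mult power_mult_distrib)

lemma square_integrable_uminus:
  "square_integrable f \<Longrightarrow> square_integrable (\<lambda>x. - f x)"
  using square_integrable_mult[of f "-1"] by simp

lemma square_integrable_diff:
  "square_integrable f \<Longrightarrow> square_integrable g \<Longrightarrow> square_integrable (\<lambda>x. f x - g x)"
  using square_integrable_add[of f "\<lambda>x. - g x"] square_integrable_uminus[of g] by simp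

lemma square_integrable_scaleR:
  "square_integrable f \<Longrightarrow> square_integrable (\<lambda>x. r *\<^sub>R f x)"
  using square_integrable_mult[of f "of_real r"] by (simp add: scaleR_conv_of_real)

lemma square_integrable_inner:
  assumes "square_integrable f" "square_integrable g"
  shows "integrable lebesgue (\<lambda>x. inner (f x) (g x))"
proof -
  have m [measurable]: "f \<in> borel_measurable lebesgue" "g \<in> borel_measurable lebesgue"
    using assms by (auto simp: square_integrable_def)
  have "integrable lebesgue (\<lambda>x. (cmod (f x))\<^sup>2 + (cmod (g x))\<^sup>2)"
    using assms by (auto simp: square_integrable_def)
  then show ?thesis
  proof (rule Bochner_Integration.integrable_bound)
    show "AE x in lebesgue. norm (inner (f x) (g x)) \<le> norm ((cmod (f x))\<^sup>2 + (cmod (g x))\<^sup>2)"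
    proof (rule AE_I2)
      fix x
      have "norm (inner (f x) (g x)) \<le> cmod (f x) * cmod (g x)"
        using Cauchy_Schwarz_ineq2 by auto
      also have "\<dots> \<le> (cmod (f x))\<^sup>2 + (cmod (g x))\<^sup>2"
      proof -
        have "0 \<le> cmod (f x) * cmod (g x)" by simp
        then show ?thesis
          using sum_squares_bound[of "cmod (f x)" "cmod (g x)"] by linarith
      qed
      finally show "norm (inner (f x) (g x)) \<le> norm ((cmod (f x))\<^sup>2 + (cmod (g x))\<^sup>2)"
        by simp
    qed
  qed simp
qed

definition L2_rel :: "(real \<Rightarrow> complex) \<Rightarrow> (real \<Rightarrow> complex) \<Rightarrow> bool" where
  "L2_rel f g \<longleftrightarrow> square_integrable f \<and> square_integrable g \<and> (AE x in lebesgue. f x = g x)"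

quotient_type L2 = "real \<Rightarrow> complex" / partial: L2_rel
proof (rule part_equivpI)
  show "\<exists>f. L2_rel f f"
    using square_integrable_zero by (auto simp: L2_rel_def)
  show "symp L2_rel"
    by (auto simp: L2_rel_def symp_def)
  show "transp L2_rel"
    unfolding transp_def L2_rel_def
  proof (intro allI impI conjI)
    fix f g h :: "real \<Rightarrow> complex"
    assume a: "square_integrable f \<and> square_integrable g \<and> (AE x in lebesgue. f x = g x)"
      and b: "square_integrable g \<and> square_integrable h \<and> (AE x in lebesgue. g x = h x)"
    then show "square_integrable f" "square_integrable h" by simp_all
    from a b have "AE x in lebesgue. f x = g x" "AE x in lebesgue. g x = h x" by simp_all
    then show "AE x in lebesgue. f x = h x" by eventually_elim simp
  qed
qed

instantiation L2 :: real_inner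
begin

lift_definition zero_L2 :: L2 is "\<lambda>x. 0"
  by (simp add: L2_rel_def square_integrable_zero)

lift_definition plus_L2 :: "L2 \<Rightarrow> L2 \<Rightarrow> L2" is "\<lambda>f g x. f x + g x"
  by (auto simp: L2_rel_def square_integrable_add)

lift_definition minus_L2 :: "L2 \<Rightarrow> L2 \<Rightarrow> L2" is "\<lambda>f g x. f x - g x"
  by (auto simp: L2_rel_def square_integrable_diff)

lift_definition uminus_L2 :: "L2 \<Rightarrow> L2" is "\<lambda>f x. - f x"
  by (auto simp: L2_rel_def square_integrable_uminus)

lift_definition scaleR_L2 :: "real \<Rightarrow> L2 \<Rightarrow> L2" is "\<lambda>r f x. r *\<^sub>R f x"
  by (auto simp: L2_rel_def square_integrable_scaleR)

text \<open>The real inner product of two complex numbers is \<open>inner z w = Re (z * cnj w)\<close>, so this is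
  the real part of the usual inner product and induces the usual norm (see \<open>norm_L2_alt\<close>).\<close>

lift_definition inner_L2 :: "L2 \<Rightarrow> L2 \<Rightarrow> real" is "\<lambda>f g. LINT x|lebesgue. inner (f x) (g x)"
proof -
  fix f f' g g' assume a: "L2_rel f f'" "L2_rel g g'"
  then have m: "f \<in> borel_measurable lebesgue" "f' \<in> borel_measurable lebesgue"
      "g \<in> borel_measurable lebesgue" "g' \<in> borel_measurable lebesgue"
    by (simp_all add: L2_rel_def square_integrable_def)
  from a have "AE x in lebesgue. f x = f' x" "AE x in lebesgue. g x = g' x"
    by (simp_all add: L2_rel_def)
  then have "AE x in lebesgue. inner (f x) (g x) = inner (f' x) (g' x)"
    by eventually_elim simp
  then show "(LINT x|lebesgue. inner (f x) (g x)) = (LINT x|lebesgue. inner (f' x) (g' x))"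
    by (intro integral_cong_AE borel_measurable_inner m)
qed

definition norm_L2 :: "L2 \<Rightarrow> real" where
  "norm_L2 f = sqrt (inner f f)"

definition dist_L2 :: "L2 \<Rightarrow> L2 \<Rightarrow> real" where
  "dist_L2 f g = norm (f - g)"

definition sgn_L2 :: "L2 \<Rightarrow> L2" where
  "sgn_L2 f = scaleR (inverse (norm f)) f"

definition uniformity_L2 :: "(L2 \<times> L2) filter" where
  "uniformity_L2 = (INF e\<in>{0 <..}. principal {(f, g). dist f g < e})"

definition open_L2 :: "L2 set \<Rightarrow> bool" where
  "open_L2 S \<longleftrightarrow> (\<forall>f\<in>S. \<forall>\<^sub>F (f', g) in uniformity. f' = f \<longrightarrow> g \<in> S)"

instance
proof
  fix f g h :: L2 and r s :: real and S :: "L2 set"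
  show "f + g + h = f + (g + h)"
    by transfer (auto simp: L2_rel_def square_integrable_add algebra_simps)
  show "f + g = g + f"
    by transfer (auto simp: L2_rel_def square_integrable_add algebra_simps)
  show "0 + f = f"
    by transfer (auto simp: L2_rel_def)
  show "- f + f = 0"
    by transfer (auto simp: L2_rel_def square_integrable_zero)
  show "f - g = f + - g"
    by transfer (auto simp: L2_rel_def square_integrable_diff)
  show "r *\<^sub>R (f + g) = r *\<^sub>R f + r *\<^sub>R g"
    by transfer (auto simp: L2_rel_def square_integrable_add square_integrable_scaleR
        scaleR_add_right)
  show "(r + s) *\<^sub>R f = r *\<^sub>R f + s *\<^sub>R f"
    by transfer (auto simp: L2_rel_def square_integrable_add square_integrable_scaleR
        scaleR_add_left)
  show "r *\<^sub>R s *\<^sub>R f = (r * s) *\<^sub>R f"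
    by transfer (auto simp: L2_rel_def square_integrable_scaleR)
  show "1 *\<^sub>R f = f"
    by transfer (auto simp: L2_rel_def)
  show "inner f g = inner g f"
    by transfer (simp add: inner_commute)
  show "inner (f + g) h = inner f h + inner g h"
    by transfer (simp add: L2_rel_def inner_add_left square_integrable_inner)
  show "inner (r *\<^sub>R f) g = r * inner f g"
    by transfer simp
  show "0 \<le> inner f f"
    by transfer simp
  show "inner f f = 0 \<longleftrightarrow> f = 0"
  proof (transfer, goal_cases)
    case (1 f)
    then have f: "square_integrable f" by (simp add: L2_rel_def)
    have "(LINT x|lebesgue. inner (f x) (f x)) = 0 \<longleftrightarrow> (AE x in lebesgue. inner (f x) (f x) = 0)"
      by (intro integral_nonneg_eq_0_iff_AE square_integrable_inner f) auto
    then show ?case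
      using f square_integrable_zero by (simp add: L2_rel_def)
  qed
  show "norm f = sqrt (inner f f)" by (rule norm_L2_def)
  show "dist f g = norm (f - g)" by (rule dist_L2_def)
  show "sgn f = scaleR (inverse (norm f)) f" by (rule sgn_L2_def)
  show "uniformity = (INF e\<in>{0 <..}. principal {(f :: L2, g). dist f g < e})"
    by (rule uniformity_L2_def)
  show "open S \<longleftrightarrow> (\<forall>f\<in>S. \<forall>\<^sub>F (f', g) in uniformity. f' = f \<longrightarrow> g \<in> S)"
    by (rule open_L2_def)
qed

end

lemma square_integrable_rep: "square_integrable (rep_L2 f)"
  using Quotient3_rep_reflp[OF Quotient3_L2, of f] by (simp add: L2_rel_def)

lemma abs_rep_L2: "abs_L2 (rep_L2 f) = f"
  by (rule Quotient3_abs_rep[OF Quotient3_L2])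

lemma norm_L2_alt: "norm f = sqrt (LINT x|lebesgue. (cmod (rep_L2 f x))\<^sup>2)"
proof -
  have "inner f f = inner (abs_L2 (rep_L2 f)) (abs_L2 (rep_L2 f))"
    by (simp add: abs_rep_L2)
  also have "\<dots> = (LINT x|lebesgue. (cmod (rep_L2 f x))\<^sup>2)"
    by (subst inner_L2.abs_eq)
      (auto simp: L2_rel_def square_integrable_rep eq_onp_def power2_norm_eq_inner)
  finally show ?thesis by (simp add: norm_L2_def)
qed


section \<open>Complex normed spaces and unbounded operators\<close>

class complex_normed_vector = real_normed_vector +
  fixes scaleC :: "complex \<Rightarrow> 'a \<Rightarrow> 'a"  (infixr "*\<^sub>C" 75)
  assumes scaleC_add_right: "a *\<^sub>C (x + y) = a *\<^sub>C x + a *\<^sub>C y"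
    and scaleC_add_left: "(a + b) *\<^sub>C x = a *\<^sub>C x + b *\<^sub>C x"
    and scaleC_scaleC: "a *\<^sub>C (b *\<^sub>C x) = (a * b) *\<^sub>C x"
    and scaleC_of_real: "complex_of_real r *\<^sub>C x = r *\<^sub>R x"
    and norm_scaleC: "norm (a *\<^sub>C x) = cmod a * norm x"

instantiation L2 :: complex_normed_vector
begin

lift_definition scaleC_L2 :: "complex \<Rightarrow> L2 \<Rightarrow> L2" is "\<lambda>c f x. c * f x"
  by (auto simp: L2_rel_def square_integrable_mult)

instance
proof
  fix a b :: complex and r :: real and f g :: L2
  show "a *\<^sub>C (f + g) = a *\<^sub>C f + a *\<^sub>C g"
    by transfer (auto simp: L2_rel_def square_integrable_add square_integrable_mult
        distrib_left)
  show "(a + b) *\<^sub>C f = a *\<^sub>C f + b *\<^sub>C f"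
    by transfer (auto simp: L2_rel_def square_integrable_add square_integrable_mult
        distrib_right)
  show "a *\<^sub>C (b *\<^sub>C f) = (a * b) *\<^sub>C f"
    by transfer (auto simp: L2_rel_def square_integrable_mult mult.assoc)
  show "complex_of_real r *\<^sub>C f = r *\<^sub>R f"
    by transfer (auto simp: L2_rel_def square_integrable_mult square_integrable_scaleR
        scaleR_conv_of_real)
  have "inner (a *\<^sub>C f) (a *\<^sub>C f) = (cmod a)\<^sup>2 * inner f f"
    by transfer (simp flip: power2_norm_eq_inner add: norm_mult power_mult_distrib)
  then show "norm (a *\<^sub>C f) = cmod a * norm f"
    by (simp add: norm_L2_def real_sqrt_mult)
qed

end

text \<open>The norm of a product type is \<open>norm (x, y) = sqrt ((norm x)\<^sup>2 + (norm y)\<^sup>2)\<close>, so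
  \<open>L2 \<times> L2\<close> is the orthogonal direct sum.\<close>

instantiation prod :: (complex_normed_vector, complex_normed_vector) complex_normed_vector
begin

definition scaleC_prod :: "complex \<Rightarrow> 'a \<times> 'b \<Rightarrow> 'a \<times> 'b" where
  "scaleC_prod a x = (a *\<^sub>C fst x, a *\<^sub>C snd x)"

instance
proof
  fix a b :: complex and r :: real and x y :: "'a \<times> 'b"
  show "a *\<^sub>C (x + y) = a *\<^sub>C x + a *\<^sub>C y"
    by (simp add: scaleC_prod_def scaleC_add_right)
  show "(a + b) *\<^sub>C x = a *\<^sub>C x + b *\<^sub>C x"
    by (simp add: scaleC_prod_def scaleC_add_left)
  show "a *\<^sub>C (b *\<^sub>C x) = (a * b) *\<^sub>C x"
    by (simp add: scaleC_prod_def scaleC_scaleC)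
  show "complex_of_real r *\<^sub>C x = r *\<^sub>R x"
    by (simp add: scaleC_prod_def scaleC_of_real scaleR_prod_def)
  have "(norm (a *\<^sub>C x))\<^sup>2 = (cmod a * norm x)\<^sup>2"
    by (simp add: scaleC_prod_def norm_prod_def norm_scaleC power_mult_distrib distrib_left)
  then show "norm (a *\<^sub>C x) = cmod a * norm x"
    by (simp add: power2_eq_iff_nonneg)
qed

end

text \<open>An operator in a space is represented by its graph.\<close>

type_synonym 'a graph = "('a \<times> 'a) set"

definition graph_of :: "'a set \<Rightarrow> ('a \<Rightarrow> 'a) \<Rightarrow> 'a graph" where
  "graph_of D A = {(x, A x) | x. x \<in> D}"

definition closed_operator :: "'a::complex_normed_vector graph \<Rightarrow> bool" where
  "closed_operator T \<longleftrightarrow> closed T"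

text \<open>The closure of the graph of a linear operator is a linear subspace; the operator is closable
  iff this subspace is again the graph of an operator, which is then its closure.\<close>

definition closable_operator :: "'a::complex_normed_vector graph \<Rightarrow> bool" where
  "closable_operator T \<longleftrightarrow> single_valued (closure T)"

definition operator_closure :: "'a::complex_normed_vector graph \<Rightarrow> 'a graph" where
  "operator_closure T = closure T"

definition approx_point_spectrum :: "'a::complex_normed_vector graph \<Rightarrow> complex set" where
  "approx_point_spectrum T =
     {z. \<exists>x y. (\<forall>n::nat. (x n, y n) \<in> T \<and> norm (x n) = 1)
            \<and> (\<lambda>n. y n - z *\<^sub>C x n) \<longlonglongrightarrow> 0}"


section \<open>Weak derivatives and Sobolev spaces\<close>

definition nth_derivative :: "nat \<Rightarrow> (real \<Rightarrow> complex) \<Rightarrow> real \<Rightarrow> complex" where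
  "nth_derivative k = (\<lambda>\<phi> x. vector_derivative \<phi> (at x)) ^^ k"

definition test_function :: "(real \<Rightarrow> complex) \<Rightarrow> bool" where
  "test_function \<phi> \<longleftrightarrow>
     (\<forall>k x. nth_derivative k \<phi> differentiable (at x)) \<and> compact (closure {x. \<phi> x \<noteq> 0})"

definition has_weak_derivative :: "nat \<Rightarrow> L2 \<Rightarrow> L2 \<Rightarrow> bool" where
  "has_weak_derivative k f g \<longleftrightarrow>
     (\<forall>\<phi>. test_function \<phi> \<longrightarrow>
        (LINT x|lebesgue. rep_L2 f x * nth_derivative k \<phi> x) =
        (-1) ^ k * (LINT x|lebesgue. rep_L2 g x * \<phi> x))"

text \<open>Weak derivatives are unique up to null sets, that is, unique as elements of \<open>L2\<close>, by the
  fundamental lemma of the calculus of variations.\<close>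

definition weak_derivative :: "nat \<Rightarrow> L2 \<Rightarrow> L2" where
  "weak_derivative k f = (THE g. has_weak_derivative k f g)"

text \<open>The space \<open>W\<^bsup>k,2\<^esup>\<close>.\<close>

definition sobolev :: "nat \<Rightarrow> L2 set" where
  "sobolev k = {f. \<forall>j\<le>k. \<exists>g. has_weak_derivative j f g}"


section \<open>The operator matrix\<close>

definition L2_loc :: "(real \<Rightarrow> complex) set" where
  "L2_loc = {U. U \<in> borel_measurable lebesgue \<and>
     (\<forall>K. compact K \<longrightarrow> set_integrable lebesgue K (\<lambda>x. (cmod (U x))\<^sup>2))}"

definition essran :: "(real \<Rightarrow> complex) \<Rightarrow> complex set" where
  "essran U = {z. \<forall>\<epsilon>>0. emeasure lebesgue {x. cmod (U x - z) < \<epsilon>} > 0}"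

text \<open>The following rules out the degenerate case of \<open>infdist\<close>, whose value at the empty set is
  \<open>0\<close>.\<close>

lemma essran_nonempty:
  assumes [measurable]: "U \<in> borel_measurable lebesgue"
  shows "essran U \<noteq> {}"
proof
  assume "essran U = {}"
  then have "\<forall>z. \<exists>\<epsilon>>0. emeasure lebesgue {x. cmod (U x - z) < \<epsilon>} = 0"
    by (auto simp: essran_def)
  then obtain e where e: "e z > 0" "emeasure lebesgue {x. cmod (U x - z) < e z} = 0" for z
    by metis
  obtain F where F: "F \<subseteq> range (\<lambda>z. ball z (e z))" "countable F" "\<Union> F = \<Union> (range (\<lambda>z. ball z (e z)))"
    using Lindelof[of "range (\<lambda>z. ball z (e z))"] by blast
  have cov: "\<Union> F = UNIV"
    unfolding F(3) using e(1) centre_in_ball by blast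
  have "U -` B \<in> null_sets lebesgue" if "B \<in> F" for B
  proof -
    obtain z where z: "B = ball z (e z)" using F(1) \<open>B \<in> F\<close> by blast
    have eq: "U -` B = {x. cmod (U x - z) < e z}"
      by (auto simp: z dist_norm norm_minus_commute)
    have "{x \<in> space lebesgue. cmod (U x - z) < e z} \<in> sets lebesgue"
      by measurable
    then show ?thesis using e(2)[of z] by (auto simp: null_sets_def eq)
  qed
  then have "(\<Union>B\<in>F. U -` B) \<in> null_sets lebesgue"
    using F(2) by (intro null_sets_UN') auto
  moreover have "(\<Union>B\<in>F. U -` B) = UNIV"
    using cov by blast
  ultimately show False
    by (auto simp: null_sets_def)
qed

text \<open>The product of \<open>U\<close> with the chosen representative of \<open>g\<close> does not depend, up to a null set, on
  that choice.\<close>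

definition matrix_dom :: "(real \<Rightarrow> complex) \<Rightarrow> (L2 \<times> L2) set" where
  "matrix_dom U =
     sobolev 2 \<times> {g \<in> sobolev 1. square_integrable (\<lambda>x. U x * rep_L2 g x)}"

definition matrix_map :: "(real \<Rightarrow> complex) \<Rightarrow> complex \<Rightarrow> complex \<Rightarrow> L2 \<times> L2 \<Rightarrow> L2 \<times> L2" where
  "matrix_map U \<gamma> \<delta> = (\<lambda>(f, g).
     (- weak_derivative 2 f + \<gamma> *\<^sub>C weak_derivative 1 g,
      \<delta> *\<^sub>C weak_derivative 1 f + abs_L2 (\<lambda>x. U x * rep_L2 g x)))"

definition operator_matrix :: "(real \<Rightarrow> complex) \<Rightarrow> complex \<Rightarrow> complex \<Rightarrow> (L2 \<times> L2) graph" where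
  "operator_matrix U \<gamma> \<delta> = graph_of (matrix_dom U) (matrix_map U \<gamma> \<delta>)"

end

theory Submission
  imports Defs "HOL-Real_Asymp.Real_Asymp"
begin

text \<open>
  Closability holds because, tested against smooth functions of compact support, the value of the
  operator depends continuously on its argument; local square integrability of \<open>U\<close> enters here.
  The operator is not closed because it only controls \<open>f' - \<gamma> g\<close>, not \<open>g'\<close>: if \<open>g\<close> is a square wave of
  mean zero and \<open>f' = \<gamma> g\<close>, then mollifying \<open>g\<close> gives a convergent sequence in the graph whose limit
  has no weakly differentiable second component.

  For the spectrum let \<open>- f'' + \<gamma> g' - z f = p\<close> and \<open>\<delta> f' + (U - z) g = q\<close> with \<open>p\<close> and \<open>q\<close> small. Pairing
  the first equation with \<open>f\<close> and integrating by parts shows that \<open>\<parallel>f'\<parallel>\<^sup>2 - z \<parallel>f\<parallel>\<^sup>2\<close> is bounded by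
  \<open>\<parallel>g\<parallel> \<parallel>f'\<parallel> + \<parallel>p\<parallel> \<parallel>f\<parallel>\<close>. For \<open>a, b \<ge> 0\<close> one has \<open>a \<le> M \<bar>a - z b\<bar>\<close>, where \<open>M = 1\<close> if \<open>Re z < 0\<close> and
  \<open>M = \<bar>z\<bar> / \<bar>Im z\<bar>\<close> otherwise, so \<open>\<parallel>f'\<parallel> \<le> M \<parallel>g\<parallel>\<close> up to a small error. The second equation gives
  \<open>dist (z, essran U) \<parallel>g\<parallel> \<le> \<parallel>f'\<parallel>\<close> up to a small error, so the distance exceeding \<open>M\<close> forces \<open>g\<close>, \<open>f'\<close> and
  finally \<open>f\<close> to be small.
\<close>

section \<open>Smooth functions\<close>

text \<open>Pairing the first row with f needs integration by parts on the whole line for functions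
  that are only weakly differentiable and square integrable. It rests on three ingredients:
  absolutely continuous representatives (du Bois-Reymond), a product rule obtained from Fubini
  instead of pointwise derivatives, and a stretched cutoff that removes the behaviour at infinity.

  \<open>inner\<close> on \<open>L2\<close> is only the real part of the Hermitian product. Complex
  pairings and moduli are therefore recovered by multiplying one argument by a suitable scalar.

  An element of the closure may have a second component without weak derivative, as the square wave
  shows. The estimates are therefore never made in the closure itself: approximate eigenvectors of
  the closure are first moved to nearby elements of the graph.

  The 1-neighbourhood of the essential range lies in the set because \<bar>Im z\<bar> \<le>
  \<bar>z\<bar> gives M \<ge> 1 off the half-line.\<close>

definition smooth :: "(real \<Rightarrow> complex) \<Rightarrow> bool" where
  "smooth \<phi> \<longleftrightarrow> (\<forall>k x. nth_derivative k \<phi> differentiable (at x))"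

definition deriv1 :: "(real \<Rightarrow> complex) \<Rightarrow> real \<Rightarrow> complex" where
  "deriv1 \<phi> = (\<lambda>x. vector_derivative \<phi> (at x))"

lemma nth_derivative_0 [simp]: "nth_derivative 0 \<phi> = \<phi>"
  by (simp add: nth_derivative_def)

lemma nth_derivative_Suc: "nth_derivative (Suc k) \<phi> = nth_derivative k (deriv1 \<phi>)"
  by (simp add: nth_derivative_def deriv1_def funpow_Suc_right del: funpow.simps)

lemma nth_derivative_1: "nth_derivative 1 \<phi> = deriv1 \<phi>"
  using nth_derivative_Suc[of 0 \<phi>] by simp

lemma nth_derivative_2: "nth_derivative 2 \<phi> = deriv1 (deriv1 \<phi>)"
  using nth_derivative_Suc[of 1 \<phi>] by (simp only: Suc_1 nth_derivative_1)

lemma deriv1_eqI: "(\<And>x. (\<phi> has_vector_derivative \<psi> x) (at x)) \<Longrightarrow> deriv1 \<phi> = \<psi>"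
  by (auto simp: deriv1_def vector_derivative_at)

lemma smooth_deriv1: "smooth \<phi> \<Longrightarrow> smooth (deriv1 \<phi>)"
  unfolding smooth_def by (metis nth_derivative_Suc)

lemma smooth_has_deriv1: "smooth \<phi> \<Longrightarrow> (\<phi> has_vector_derivative deriv1 \<phi> x) (at x)"
  unfolding smooth_def deriv1_def by (metis nth_derivative_0 vector_derivative_works)

text \<open>A class that is stable under differentiation contains all iterated derivatives of its
  members, by induction on the order. Each use only has to exhibit such a class, never a formula for
  the k-th derivative.\<close>

lemma smooth_coinduct:
  assumes "C \<phi>"
    and step: "\<And>\<psi>. C \<psi> \<Longrightarrow> \<exists>\<psi>'. C \<psi>' \<and> (\<forall>x. (\<psi> has_vector_derivative \<psi>' x) (at x))"
  shows "smooth \<phi>"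
proof -
  have "C \<psi> \<Longrightarrow> nth_derivative k \<psi> differentiable (at x)" for k x \<psi>
  proof (induction k arbitrary: \<psi>)
    case 0
    then show ?case
      using step[OF 0] by (auto intro: differentiableI_vector)
  next
    case (Suc k)
    obtain \<psi>' where "C \<psi>'" "\<And>x. (\<psi> has_vector_derivative \<psi>' x) (at x)"
      using step[OF Suc.prems] by blast
    then show ?case
      using Suc.IH[of \<psi>'] deriv1_eqI[of \<psi> \<psi>'] by (simp add: nth_derivative_Suc)
  qed
  then show ?thesis using assms(1) by (auto simp: smooth_def)
qed

lemma smooth_if_deriv_smooth:
  assumes "smooth \<psi>" "\<And>x. (\<phi> has_vector_derivative \<psi> x) (at x)"
  shows "smooth \<phi>"
proof (rule smooth_coinduct[where C = "\<lambda>\<eta>. \<eta> = \<phi> \<or> smooth \<eta>"])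
  fix \<eta> assume "\<eta> = \<phi> \<or> smooth \<eta>"
  then show "\<exists>\<eta>'. (\<eta>' = \<phi> \<or> smooth \<eta>') \<and> (\<forall>x. (\<eta> has_vector_derivative \<eta>' x) (at x))"
  proof
    assume "\<eta> = \<phi>"
    then show ?thesis using assms by (intro exI[of _ \<psi>]) simp
  next
    assume "smooth \<eta>"
    then show ?thesis
      by (intro exI[of _ "deriv1 \<eta>"]) (simp add: smooth_deriv1 smooth_has_deriv1)
  qed
qed simp

text \<open>Products of two smooth functions are not visibly stable under differentiation, since the
  product rule yields sums of products. Closing under both operations gives a class to which the
  coinduction applies.\<close>

inductive ring_closure :: "(real \<Rightarrow> complex) \<Rightarrow> bool" where
  base: "smooth \<phi> \<Longrightarrow> ring_closure \<phi>"
| add: "ring_closure \<phi> \<Longrightarrow> ring_closure \<psi> \<Longrightarrow> ring_closure (\<lambda>x. \<phi> x + \<psi> x)"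
| mult: "ring_closure \<phi> \<Longrightarrow> ring_closure \<psi> \<Longrightarrow> ring_closure (\<lambda>x. \<phi> x * \<psi> x)"

lemma smooth_ring_closure:
  assumes "ring_closure \<phi>" shows "smooth \<phi>"
proof (rule smooth_coinduct[of ring_closure, OF assms])
  fix \<psi> assume "ring_closure \<psi>"
  then show "\<exists>\<psi>'. ring_closure \<psi>' \<and> (\<forall>x. (\<psi> has_vector_derivative \<psi>' x) (at x))"
  proof induction
    case (base \<phi>)
    then show ?case using smooth_deriv1 smooth_has_deriv1 ring_closure.base by blast
  next
    case (add \<phi> \<psi>)
    then obtain \<phi>' \<psi>' where "ring_closure \<phi>'" "ring_closure \<psi>'"
      "\<And>x. (\<phi> has_vector_derivative \<phi>' x) (at x)" "\<And>x. (\<psi> has_vector_derivative \<psi>' x) (at x)"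
      by blast
    then show ?case
      by (intro exI[of _ "\<lambda>x. \<phi>' x + \<psi>' x"])
        (auto intro: ring_closure.intros has_vector_derivative_add)
  next
    case (mult \<phi> \<psi>)
    then obtain \<phi>' \<psi>' where "ring_closure \<phi>'" "ring_closure \<psi>'"
      "\<And>x. (\<phi> has_vector_derivative \<phi>' x) (at x)" "\<And>x. (\<psi> has_vector_derivative \<psi>' x) (at x)"
      by blast
    with mult show ?case
      by (intro exI[of _ "\<lambda>x. \<phi> x * \<psi>' x + \<phi>' x * \<psi> x"])
        (auto intro: ring_closure.intros has_vector_derivative_mult)
  qed
qed

lemma smooth_add: "smooth \<phi> \<Longrightarrow> smooth \<psi> \<Longrightarrow> smooth (\<lambda>x. \<phi> x + \<psi> x)"
  by (rule smooth_ring_closure[OF ring_closure.add[OF ring_closure.base ring_closure.base]])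

lemma smooth_mult: "smooth \<phi> \<Longrightarrow> smooth \<psi> \<Longrightarrow> smooth (\<lambda>x. \<phi> x * \<psi> x)"
  by (rule smooth_ring_closure[OF ring_closure.mult[OF ring_closure.base ring_closure.base]])

lemma smooth_const: "smooth (\<lambda>x. c)"
  by (rule smooth_coinduct[where C = "\<lambda>\<phi>. \<exists>c. \<phi> = (\<lambda>x. c)"])
    (auto intro!: exI[of _ "\<lambda>x. 0"])

lemma smooth_affine:
  assumes "smooth \<phi>" shows "smooth (\<lambda>x. \<phi> (m * x + t))"
\<comment> \<open>The scalar \<open>c\<close> collects the powers of \<open>m\<close> that the chain
  rule produces.\<close>
proof (rule smooth_coinduct[where C = "\<lambda>\<psi>. \<exists>c \<phi>. smooth \<phi> \<and> \<psi> = (\<lambda>x. c * \<phi> (m * x + t))"])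
  show "\<exists>c \<phi>'. smooth \<phi>' \<and> (\<lambda>x. \<phi> (m * x + t)) = (\<lambda>x. c * \<phi>' (m * x + t))"
    by (rule exI[of _ 1], rule exI[of _ \<phi>]) (simp add: assms)
next
  fix \<psi> assume "\<exists>c \<phi>. smooth \<phi> \<and> \<psi> = (\<lambda>x. c * \<phi> (m * x + t))"
  then obtain c \<phi> where \<phi>: "smooth \<phi>" "\<psi> = (\<lambda>x. c * \<phi> (m * x + t))" by blast
  have "(\<psi> has_vector_derivative c * (of_real m * deriv1 \<phi> (m * x + t))) (at x)" for x
    unfolding \<phi>(2)
    by (rule has_vector_derivative_eq_rhs[OF has_vector_derivative_mult_right[OF
          vector_diff_chain_at[unfolded o_def, where f = "\<lambda>x. m * x + t", of m]]])
      (auto intro!: derivative_eq_intros smooth_has_deriv1[OF \<phi>(1)]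
        simp: scaleR_conv_of_real)
  then show "\<exists>\<psi>'. (\<exists>c \<phi>. smooth \<phi> \<and> \<psi>' = (\<lambda>x. c * \<phi> (m * x + t))) \<and>
           (\<forall>x. (\<psi> has_vector_derivative \<psi>' x) (at x))"
    using smooth_deriv1[OF \<phi>(1)] by (metis (no_types, lifting) mult.assoc)
qed

lemma smooth_continuous: "smooth \<phi> \<Longrightarrow> continuous_on S \<phi>"
  by (meson continuous_at_imp_continuous_on has_vector_derivative_continuous smooth_has_deriv1)

lemma smooth_measurable: "smooth \<phi> \<Longrightarrow> \<phi> \<in> borel_measurable borel"
  by (intro borel_measurable_continuous_onI smooth_continuous)

section \<open>Bump and test functions\<close>

text \<open>The classical smooth function that vanishes to infinite order at the origin without
  being zero to the right of it.\<close>

definition bump_half :: "real \<Rightarrow> real" where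
  "bump_half x = (if x > 0 then exp (- 1 / x) else 0)"

text \<open>The exponential beats every power of 1/x. The additional division by x makes the
  expression the difference quotient at 0 of the functions in the next proof.\<close>

lemma poly_exp_decay: "((\<lambda>x. poly p (1 / x) * exp (- 1 / x) / x) \<longlongrightarrow> 0) (at_right (0::real))"
proof -
  have mono: "((\<lambda>x. (1 / x) ^ k * exp (- 1 / x) / x) \<longlongrightarrow> 0) (at_right (0::real))" for k :: nat
    by real_asymp
  have "((\<lambda>x. \<Sum>i\<le>degree p. coeff p i * ((1 / x) ^ i * exp (- 1 / x) / x)) \<longlongrightarrow>
      (\<Sum>i\<le>degree p. coeff p i * 0)) (at_right (0::real))"
    by (intro tendsto_sum tendsto_mult tendsto_const mono)
  then show ?thesis
    by (simp add: poly_altdef sum_distrib_right sum_divide_distrib mult.assoc)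
qed

lemma smooth_bump_half: "smooth (\<lambda>x. of_real (bump_half x))"
\<comment> \<open>The functions p(1/x) exp(-1/x), extended by zero to the left, are stable under
  differentiation.\<close>
proof (rule smooth_coinduct[where C = "\<lambda>\<phi>. \<exists>p. \<phi> =
    (\<lambda>x. of_real (if x > 0 then poly p (1 / x) * exp (- 1 / x) else 0))"])
  show "\<exists>p. (\<lambda>x. complex_of_real (bump_half x)) =
      (\<lambda>x. of_real (if x > 0 then poly p (1 / x) * exp (- 1 / x) else 0))"
    by (rule exI[of _ 1]) (auto simp: bump_half_def fun_eq_iff)
next
  fix \<psi> :: "real \<Rightarrow> complex"
  assume "\<exists>p. \<psi> = (\<lambda>x. of_real (if x > 0 then poly p (1 / x) * exp (- 1 / x) else 0))"
  then obtain p where \<psi>: "\<psi> = (\<lambda>x. of_real (if x > 0 then poly p (1 / x) * exp (- 1 / x) else 0))"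
    by blast
  \<comment> \<open>Differentiating p(1/x) exp(-1/x) gives (p - p')(1/x) exp(-1/x) /
    \<open>x\<^sup>2\<close>, and the factor 1/\<open>x\<^sup>2\<close> is the monomial of degree 2
    evaluated at 1/x.\<close>
  define q where "q = monom 1 2 * (p - pderiv p)"
  let ?g = "\<lambda>p x. if x > 0 then poly p (1 / x) * exp (- 1 / x) else (0::real)"
  have "(?g p has_field_derivative ?g q x) (at x)" for x
  proof (rule linorder_cases[of x 0])
    assume x: "x < 0"
    have "((\<lambda>x. 0::real) has_field_derivative ?g q x) (at x)"
      using x by (auto intro!: derivative_eq_intros)
    then show ?thesis
      by (rule has_field_derivative_transform_within_open[where S = "{..<0}"]) (use x in auto)
  next
    assume x: "x > 0"
    have "((\<lambda>x. poly p (1 / x) * exp (- 1 / x)) has_field_derivative ?g q x) (at x)"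
      using x by (auto intro!: derivative_eq_intros DERIV_chain2[OF poly_DERIV]
          simp: q_def poly_monom field_simps power2_eq_square)
    then show ?thesis
      by (rule has_field_derivative_transform_within_open[where S = "{0<..}"]) (use x in auto)
  next
    assume x: "x = 0"
    have r: "((\<lambda>y. ?g p y / y) \<longlongrightarrow> 0) (at_right 0)"
      by (rule Lim_transform_eventually[OF poly_exp_decay[of p]])
        (auto simp: eventually_at_filter)
    have l: "((\<lambda>y. ?g p y / y) \<longlongrightarrow> 0) (at_left 0)"
      by (rule Lim_transform_eventually[OF tendsto_const])
        (auto simp: eventually_at_filter)
    show ?thesis
      using filterlim_split_at[OF l r] by (simp add: has_field_derivative_iff x)
  qed
  then have "(\<psi> has_vector_derivative of_real (?g q x)) (at x)" for x
    unfolding \<psi>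
    by (intro has_vector_derivative_of_real)
      (simp add: has_real_derivative_iff_has_vector_derivative)
  then show "\<exists>\<psi>'. (\<exists>p. \<psi>' = (\<lambda>x. of_real (if x > 0 then poly p (1 / x) * exp (- 1 / x) else 0))) \<and>
      (\<forall>x. (\<psi> has_vector_derivative \<psi>' x) (at x))"
    by (intro exI[of _ "\<lambda>x. of_real (?g q x)"]) auto
qed

lemma bump_half_nonneg: "0 \<le> bump_half x" and bump_half_le_1: "bump_half x \<le> 1"
  by (auto simp: bump_half_def)

lemma bump_half_scaled: "x > 0 \<Longrightarrow> (\<lambda>n. bump_half (real (Suc n) * x)) \<longlonglongrightarrow> 1"
proof -
  assume x: "x > 0"
  have "(\<lambda>n. exp (- 1 / (real (Suc n) * x))) \<longlonglongrightarrow> 1"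
    using x by real_asymp
  then show ?thesis using x by (simp add: bump_half_def)
qed

text \<open>Scaling by \<open>Suc n\<close> sharpens both flanks without moving the support, so the
  bumps tend to the indicator of the open interval and stay below that of the closed one. The same
  family serves as test functions, as cutoffs and as smooth approximations of step
  functions.\<close>

definition bump :: "real \<Rightarrow> real \<Rightarrow> nat \<Rightarrow> real \<Rightarrow> complex" where
  "bump a b n x = of_real (bump_half (real (Suc n) * (x - a)) * bump_half (real (Suc n) * (b - x)))"

lemma smooth_bump: "smooth (bump a b n)"
proof -
  have "bump a b n = (\<lambda>x. of_real (bump_half (real (Suc n) * x + (- real (Suc n) * a)))
      * of_real (bump_half (- real (Suc n) * x + real (Suc n) * b)))"
    by (auto simp: bump_def algebra_simps fun_eq_iff)
  then show ?thesis
    using smooth_mult[OF smooth_affine[OF smooth_bump_half] smooth_affine[OF smooth_bump_half]]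
    by presburger
qed

lemma bump_outside: "x \<notin> {a<..<b} \<Longrightarrow> bump a b n x = 0"
  by (auto simp: bump_def bump_half_def zero_less_mult_iff)

lemma bump_bound: "cmod (bump a b n x) \<le> indicator {a..b} x"
proof (cases "x \<in> {a<..<b}")
  case True
  have "cmod (bump a b n x) = bump_half (real (Suc n) * (x - a)) * bump_half (real (Suc n) * (b - x))"
    unfolding bump_def norm_of_real by (simp add: bump_half_nonneg)
  also have "\<dots> \<le> 1" by (simp add: mult_le_one bump_half_nonneg bump_half_le_1)
  finally show ?thesis using True by (auto simp: indicator_def)
qed (simp add: bump_outside)

lemma bump_tendsto: "(\<lambda>n. bump a b n x) \<longlonglongrightarrow> indicator {a<..<b} x"
proof (cases "x \<in> {a<..<b}")
  case True
  then have "(\<lambda>n. bump a b n x) \<longlonglongrightarrow> of_real (1 * 1)"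
    unfolding bump_def by (intro tendsto_of_real tendsto_mult bump_half_scaled) auto
  then show ?thesis using True by simp
qed (simp add: bump_outside)

lemma compact_closure_support:
  fixes \<phi> :: "real \<Rightarrow> complex"
  assumes "\<And>x. x \<notin> {a..b} \<Longrightarrow> \<phi> x = 0"
  shows "compact (closure {x. \<phi> x \<noteq> 0})"
proof -
  have "{x. \<phi> x \<noteq> 0} \<subseteq> {a..b}" using assms by blast
  then show ?thesis unfolding compact_closure by (rule bounded_subset[OF bounded_closed_interval])
qed

lemma test_functionI:
  assumes "smooth \<phi>" "\<And>x. x \<notin> {a..b} \<Longrightarrow> \<phi> x = 0"
  shows "test_function \<phi>"
  using assms compact_closure_support[of a b \<phi>] by (auto simp: test_function_def smooth_def)

lemma test_function_smooth: "test_function \<phi> \<Longrightarrow> smooth \<phi>"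
  by (auto simp: test_function_def smooth_def)

lemma deriv1_outside:
  assumes "smooth \<phi>" "\<And>x. x \<notin> {a..b} \<Longrightarrow> \<phi> x = 0" "x \<notin> {a..b}"
  shows "deriv1 \<phi> x = 0"
proof -
  have "((\<lambda>x. 0::complex) has_vector_derivative 0) (at x)" by simp
  then have "(\<phi> has_vector_derivative 0) (at x)"
    by (rule has_vector_derivative_transform_within_open[where S = "- {a..b}"])
      (use assms in auto)
  then show ?thesis by (simp add: deriv1_def vector_derivative_at)
qed

lemma test_function_support:
  assumes "test_function \<phi>"
  obtains r where "r > 0" "\<And>x. x \<notin> {-r..r} \<Longrightarrow> \<phi> x = 0" "\<And>x. x \<notin> {-r..r} \<Longrightarrow> deriv1 \<phi> x = 0"
proof -
  have "bounded {x. \<phi> x \<noteq> 0}"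
    using assms by (auto simp: test_function_def)
  then obtain r where r: "r > 0" "\<And>x. \<phi> x \<noteq> 0 \<Longrightarrow> norm x \<le> r"
    by (auto simp: bounded_pos)
  then have out: "\<And>x. x \<notin> {-r..r} \<Longrightarrow> \<phi> x = 0" by (force simp: abs_le_iff)
  then show thesis
    using that[OF r(1) out] deriv1_outside[OF test_function_smooth[OF assms], of "-r" r] by blast
qed

lemma test_function_deriv1:
  assumes "test_function \<phi>" shows "test_function (deriv1 \<phi>)"
proof -
  obtain r where r: "r > 0" "\<And>x. x \<notin> {-r..r} \<Longrightarrow> \<phi> x = 0" "\<And>x. x \<notin> {-r..r} \<Longrightarrow> deriv1 \<phi> x = 0"
    by (rule test_function_support[OF assms]) (rule that)
  show ?thesis
    by (rule test_functionI[OF smooth_deriv1[OF test_function_smooth[OF assms]] r(3)])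
qed

lemma test_function_bounded:
  assumes "test_function \<phi>"
  obtains r B where "r > 0" "B > 0" "\<And>x. cmod (\<phi> x) \<le> B * indicator {-r..r} x"
proof -
  obtain r where r: "r > 0" "\<And>x. x \<notin> {-r..r} \<Longrightarrow> \<phi> x = 0"
      "\<And>x. x \<notin> {-r..r} \<Longrightarrow> deriv1 \<phi> x = 0"
    by (rule test_function_support[OF assms]) (rule that)
  have "compact (\<phi> ` {-r..r})"
    by (intro compact_continuous_image smooth_continuous test_function_smooth assms compact_Icc)
  then have "bounded (\<phi> ` {-r..r})" by (rule compact_imp_bounded)
  then obtain B where B: "B > 0" "\<And>x. x \<in> {-r..r} \<Longrightarrow> cmod (\<phi> x) \<le> B"
    unfolding bounded_pos by blast
  have "cmod (\<phi> x) \<le> B * indicator {-r..r} x" for x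
    using B(2)[of x] r(2)[of x] by (cases "x \<in> {-r..r}") auto
  then show thesis using that r(1) B(1) by blast
qed

lemma test_function_bump: "test_function (bump a b n)"
  by (rule test_functionI[of _ a b]) (auto simp: smooth_bump bump_outside)

lemma test_function_mult:
  assumes "test_function \<phi>" shows "test_function (\<lambda>x. c * \<phi> x)"
proof -
  obtain r where r: "r > 0" "\<And>x. x \<notin> {-r..r} \<Longrightarrow> \<phi> x = 0" "\<And>x. x \<notin> {-r..r} \<Longrightarrow> deriv1 \<phi> x = 0"
    by (rule test_function_support[OF assms]) (rule that)
  show ?thesis
    by (rule test_functionI[of _ "-r" r])
      (simp_all add: r(2) smooth_mult smooth_const test_function_smooth assms del: atLeastAtMost_iff)
qed

lemma test_function_add:
  assumes "test_function \<phi>" "test_function \<psi>"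
  shows "test_function (\<lambda>x. \<phi> x + \<psi> x)"
proof -
  obtain r where r: "r > 0" "\<And>x. x \<notin> {-r..r} \<Longrightarrow> \<phi> x = 0"
      "\<And>x. x \<notin> {-r..r} \<Longrightarrow> deriv1 \<phi> x = 0"
    by (rule test_function_support[OF assms(1)]) (rule that)
  obtain s where s: "s > 0" "\<And>x. x \<notin> {-s..s} \<Longrightarrow> \<psi> x = 0"
      "\<And>x. x \<notin> {-s..s} \<Longrightarrow> deriv1 \<psi> x = 0"
    by (rule test_function_support[OF assms(2)]) (rule that)
  show ?thesis
  proof (rule test_functionI[of _ "- max r s" "max r s"])
    show "smooth (\<lambda>x. \<phi> x + \<psi> x)"
      by (intro smooth_add test_function_smooth assms)
    fix x assume "x \<notin> {- max r s..max r s}"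
    then have "x \<notin> {-r..r}" "x \<notin> {-s..s}" by auto
    then show "\<phi> x + \<psi> x = 0" using r(2) s(2) by simp
  qed
qed

lemma test_function_diff:
  assumes "test_function \<phi>" "test_function \<psi>"
  shows "test_function (\<lambda>x. \<phi> x - \<psi> x)"
  using test_function_add[OF assms(1) test_function_mult[OF assms(2), of "-1"]] by simp

lemma test_function_measurable:
  "test_function \<phi> \<Longrightarrow> \<phi> \<in> borel_measurable lebesgue"
  using smooth_measurable[OF test_function_smooth] by (simp add: measurable_completion)

lemma test_function_integrable:
  assumes "test_function \<phi>" shows "integrable lebesgue \<phi>"
proof -
  obtain r B where r: "r > 0" "B > 0" "\<And>x. cmod (\<phi> x) \<le> B * indicator {-r..r} x"
    by (rule test_function_bounded[OF assms]) (rule that)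
  have "integrable lebesgue (\<lambda>x. B * indicat_real {-r..r} x)"
    by (intro integrable_mult_right integrable_real_indicator)
      (auto simp: emeasure_lborel_Icc_eq)
  then show ?thesis
    by (rule Bochner_Integration.integrable_bound)
      (use r in \<open>auto simp: test_function_measurable assms\<close>)
qed

text \<open>An antiderivative is constant on either side of the support, and the two constants
  differ by the integral. Mean zero is thus what allows both to be made zero. The interval is
  carried along because the waves below need one support for all \<open>n\<close>.\<close>

lemma test_function_antiderivative:
  assumes "test_function \<phi>" "(LINT x|lebesgue. \<phi> x) = 0"
    and supp: "\<And>x. x \<notin> {a..b} \<Longrightarrow> \<phi> x = 0"
  obtains \<psi> where "test_function \<psi>" "deriv1 \<psi> = \<phi>" "\<And>x. x \<notin> {a..b} \<Longrightarrow> \<psi> x = 0"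
proof (cases "a \<le> b")
  case False
  then have "\<phi> = (\<lambda>x. 0)" using supp by auto
  then show thesis
    using that[of "\<lambda>x. 0"] by (simp add: test_functionI[OF smooth_const] deriv1_def)
next
  case True
  have cont: "isCont \<phi> x" for x
    using smooth_continuous[OF test_function_smooth[OF assms(1)], of UNIV]
    by (simp add: continuous_on_eq_continuous_at)
  obtain F where F: "\<And>x. (F has_vector_derivative \<phi> x) (at x)"
    using einterval_antiderivative[of "-\<infinity>" \<infinity> \<phi>] cont by auto
  have FTC: "(\<phi> has_integral (F y - F x)) {x..y}" if "x \<le> y" for x y
    by (rule fundamental_theorem_of_calculus) (simp_all add: F that has_vector_derivative_at_within)
  have right: "F y = F b" if "y \<ge> b" for y
  proof -
    have "(\<phi> has_integral 0) {b..y}"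
      by (rule has_integral_spike_finite[of "{b}" _ _ "\<lambda>x. 0"]) (use supp in auto)
    from has_integral_unique[OF FTC[OF that] this] show ?thesis by simp
  qed
  have left: "F y = F a" if "y \<le> a" for y
  proof -
    have "(\<phi> has_integral 0) {y..a}"
      by (rule has_integral_spike_finite[of "{a}" _ _ "\<lambda>x. 0"]) (use supp in auto)
    from has_integral_unique[OF FTC[OF that] this] show ?thesis by simp
  qed
  have "(\<phi> has_integral (F b - F a)) UNIV"
    by (rule has_integral_on_superset[OF FTC[OF True]]) (use supp in auto)
  moreover have "(\<phi> has_integral 0) UNIV"
    using has_integral_integral_lebesgue[OF test_function_integrable[OF assms(1)]] assms(2) by simp
  ultimately have "F b - F a = 0" by (rule has_integral_unique)
  then have ab: "F b = F a" by simp
  define \<psi> where "\<psi> x = F x - F a" for x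
  have d: "(\<psi> has_vector_derivative \<phi> x) (at x)" for x
    unfolding \<psi>_def using F[of x] by (auto intro!: derivative_eq_intros)
  have out: "\<psi> x = 0" if "x \<notin> {a..b}" for x
    using that left[of x] right[of x] ab unfolding \<psi>_def by fastforce
  have "test_function \<psi>"
    by (rule test_functionI[OF smooth_if_deriv_smooth[OF test_function_smooth[OF assms(1)] d] out])
  then show thesis
    using deriv1_eqI[OF d] out by (rule that)
qed

section \<open>The fundamental lemma of the calculus of variations\<close>

text \<open>The space of locally integrable functions. Constants and antiderivatives, which in
  general are not square integrable on the line, can be paired with test functions here.\<close>

definition loc_integrable :: "(real \<Rightarrow> complex) \<Rightarrow> bool" where
  "loc_integrable w \<longleftrightarrow> (\<forall>a b. set_integrable lebesgue {a..b} w)"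

lemma loc_integrableD: "loc_integrable w \<Longrightarrow> set_integrable lebesgue {a..b} w"
  by (simp add: loc_integrable_def)

lemma loc_integrable_measurable:
  assumes "loc_integrable w" shows "w \<in> borel_measurable lebesgue"
proof (rule borel_measurable_LIMSEQ_metric)
  show "(\<lambda>x. indicator {-real n..real n} x *\<^sub>R w x) \<in> borel_measurable lebesgue" for n
    using loc_integrableD[OF assms] by (auto simp: set_integrable_def)
  fix x :: real
  obtain N where N: "\<bar>x\<bar> \<le> real N" using real_arch_simple by blast
  have "\<forall>\<^sub>F n in sequentially. indicator {-real n..real n} x *\<^sub>R w x = w x"
    using eventually_ge_at_top[of N]
  proof eventually_elim
    case (elim n)
    then have "x \<in> {-real n..real n}" using N by (auto simp: abs_le_iff)
    then show ?case by simp
  qed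
  then show "(\<lambda>n. indicator {-real n..real n} x *\<^sub>R w x) \<longlonglongrightarrow> w x"
    by (rule tendsto_eventually)
qed

lemma integrable_imp_loc_integrable: "integrable lebesgue w \<Longrightarrow> loc_integrable w"
  by (auto simp: loc_integrable_def set_integrable_def intro!: integrable_mult_indicator)

lemma loc_integrable_const: "loc_integrable (\<lambda>x. c)"
  unfolding loc_integrable_def set_integrable_def
  by (intro allI integrable_scaleR_left integrable_real_indicator)
    (auto simp: emeasure_lborel_Icc_eq)

lemma loc_integrable_add: "loc_integrable v \<Longrightarrow> loc_integrable w \<Longrightarrow> loc_integrable (\<lambda>x. v x + w x)"
  by (simp add: loc_integrable_def set_integral_add)

lemma loc_integrable_diff: "loc_integrable v \<Longrightarrow> loc_integrable w \<Longrightarrow> loc_integrable (\<lambda>x. v x - w x)"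
  by (simp add: loc_integrable_def set_integral_diff)

lemma loc_integrable_bounded_mult:
  assumes "loc_integrable w" and [measurable]: "\<phi> \<in> borel_measurable lebesgue"
    and bd: "\<And>x. cmod (\<phi> x) \<le> B * indicator {a..b} x"
  shows "integrable lebesgue (\<lambda>x. w x * \<phi> x)"
proof -
  have [measurable]: "w \<in> borel_measurable lebesgue" using assms(1) by (rule loc_integrable_measurable)
  have "integrable lebesgue (\<lambda>x. B * norm (indicator {a..b} x *\<^sub>R w x))"
    using loc_integrableD[OF assms(1)] unfolding set_integrable_def
    by (intro integrable_mult_right integrable_norm)
  then show ?thesis
  proof (rule Bochner_Integration.integrable_bound)
    show "AE x in lebesgue. norm (w x * \<phi> x) \<le> norm (B * norm (indicator {a..b} x *\<^sub>R w x))"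
    proof (rule AE_I2)
      fix x
      have "norm (w x * \<phi> x) \<le> cmod (w x) * (B * indicator {a..b} x)"
        using bd by (simp add: norm_mult mult_left_mono)
      then show "norm (w x * \<phi> x) \<le> norm (B * norm (indicator {a..b} x *\<^sub>R w x))"
        using abs_ge_self[of "B * cmod (w x)"]
        by (cases "x \<in> {a..b}") (auto simp: abs_mult mult.commute)
    qed
  qed measurable
qed

lemma loc_integrable_test_function:
  assumes "loc_integrable w" "test_function \<phi>"
  shows "integrable lebesgue (\<lambda>x. w x * \<phi> x)"
proof -
  obtain r B where r: "r > 0" "B > 0" "\<And>x. cmod (\<phi> x) \<le> B * indicator {-r..r} x"
    by (rule test_function_bounded[OF assms(2)]) (rule that)
  show ?thesis
    by (rule loc_integrable_bounded_mult[OF assms(1) test_function_measurable[OF assms(2)] r(3)])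
qed

lemma bump_measurable: "bump a b n \<in> borel_measurable lebesgue"
  by (rule test_function_measurable[OF test_function_bump])

lemma integral_bump_tendsto:
  assumes "loc_integrable w"
  shows "(\<lambda>n. LINT x|lebesgue. w x * bump a b n x) \<longlonglongrightarrow> (LINT x:{a<..<b}|lebesgue. w x)"
  unfolding set_lebesgue_integral_def
proof (rule integral_dominated_convergence)
  show "(\<lambda>x. indicator {a<..<b} x *\<^sub>R w x) \<in> borel_measurable lebesgue"
    by (intro borel_measurable_scaleR borel_measurable_indicator loc_integrable_measurable assms) simp
  show "(\<lambda>x. w x * bump a b n x) \<in> borel_measurable lebesgue" for n
    by (intro borel_measurable_times loc_integrable_measurable assms bump_measurable)
  show "integrable lebesgue (\<lambda>x. norm (indicator {a..b} x *\<^sub>R w x))"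
    using loc_integrableD[OF assms] unfolding set_integrable_def by (rule integrable_norm)
  show "AE x in lebesgue. (\<lambda>n. w x * bump a b n x) \<longlonglongrightarrow> indicator {a<..<b} x *\<^sub>R w x"
  proof (rule AE_I2)
    fix x
    have "(\<lambda>n. w x * bump a b n x) \<longlonglongrightarrow> w x * indicator {a<..<b} x"
      by (intro tendsto_mult tendsto_const bump_tendsto)
    also have "w x * indicator {a<..<b} x = indicator {a<..<b} x *\<^sub>R w x"
      by (auto simp: indicator_def)
    finally show "(\<lambda>n. w x * bump a b n x) \<longlonglongrightarrow> indicator {a<..<b} x *\<^sub>R w x" .
  qed
  show "AE x in lebesgue. norm (w x * bump a b n x) \<le> norm (indicator {a..b} x *\<^sub>R w x)" for n
  proof (rule AE_I2)
    fix x
    have "norm (w x * bump a b n x) \<le> cmod (w x) * indicator {a..b} x"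
      using bump_bound by (simp add: norm_mult mult_left_mono)
    then show "norm (w x * bump a b n x) \<le> norm (indicator {a..b} x *\<^sub>R w x)"
      by (auto simp: indicator_def split: if_splits)
  qed
qed

text \<open>Sigma-finiteness serves two purposes: the criterion that a function with vanishing
  integrals over all measurable sets is null, and Fubini on the plane.\<close>

interpretation lebesgue: sigma_finite_measure "lebesgue :: real measure"
proof
  show "\<exists>A. countable A \<and> A \<subseteq> sets lebesgue \<and> \<Union>A = space (lebesgue :: real measure)
      \<and> (\<forall>a\<in>A. emeasure lebesgue a \<noteq> \<infinity>)"
  proof (intro exI[of _ "range (\<lambda>n::nat. {-real n..real n})"] conjI ballI)
    have "\<exists>n. x \<in> {-real n..real n}" for x :: real
      using real_arch_simple[of "\<bar>x\<bar>"] by (auto simp: abs_le_iff intro: minus_le_iff[THEN iffD1])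
    then show "\<Union> (range (\<lambda>n::nat. {-real n..real n})) = space lebesgue" by auto
  qed (auto simp: emeasure_lborel_Icc_eq)
qed

text \<open>Open intervals form an intersection-stable generator of the Borel sets, and the sets
  over which \<open>v\<close> integrates to zero are closed under complements and countable disjoint
  unions. Lebesgue sets differ from Borel sets by null sets only.\<close>

lemma AE_zero_if_interval_integrals_zero:
  fixes v :: "real \<Rightarrow> complex"
  assumes v: "integrable lebesgue v"
    and zero: "\<And>a b. (LINT x:{a<..<b}|lebesgue. v x) = 0"
  shows "AE x in lebesgue. v x = 0"
proof -
  have int: "set_integrable lebesgue A v" if "A \<in> sets lebesgue" for A
    using integrable_mult_indicator[OF that v] by (simp add: set_integrable_def)
  \<comment> \<open>The complement step of the induction needs the integral over the whole
    line.\<close>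
  have tot: "(LINT x|lebesgue. v x) = 0"
  proof -
    have "(\<lambda>n. LINT x:{-real n<..<real n}|lebesgue. v x) \<longlonglongrightarrow> (LINT x:(\<Union>n. {-real n<..<real n})|lebesgue. v x)"
      by (rule set_integral_cont_up) (auto intro!: int simp: incseq_def)
    moreover have "(\<Union>n. {-real n<..<real n}) = (UNIV :: real set)"
    proof -
      have "\<exists>n. x \<in> {-real n<..<real n}" for x :: real
        using reals_Archimedean2[of "\<bar>x\<bar>"] by (auto simp: abs_less_iff minus_less_iff)
      then show ?thesis by blast
    qed
    ultimately have "(\<lambda>n::nat. 0) \<longlonglongrightarrow> (LINT x:UNIV|lebesgue. v x)" by (simp only: zero)
    then have "(LINT x:UNIV|lebesgue. v x) = 0" by (metis LIMSEQ_unique tendsto_const)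
    then show ?thesis by (simp add: set_lebesgue_integral_def)
  qed
  define G where "G = range (\<lambda>(a, b). {a<..<b::real})"
  have sets_G: "sigma_sets UNIV G = sets borel"
    by (simp add: G_def borel_eq_box box_real sets_measure_of)
  have Int: "Int_stable G"
  proof (rule Int_stableI)
    fix A B assume "A \<in> G" "B \<in> G"
    then obtain a b c d where "A = {a<..<b}" "B = {c<..<d}" by (auto simp: G_def)
    then have "A \<inter> B = {max a c<..<min b d}" by auto
    then show "A \<inter> B \<in> G" unfolding G_def by blast
  qed
  have sigma: "(LINT x:A|lebesgue. v x) = 0" if "A \<in> sigma_sets UNIV G" for A
    using Int subset_UNIV[of G, folded Pow_UNIV] that
  proof (induction rule: sigma_sets_induct_disjoint)
    fix A show "A \<in> G \<Longrightarrow> (LINT x:A|lebesgue. v x) = 0" using zero by (auto simp: G_def)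
  next
    show "(LINT x:{}|lebesgue. v x) = 0" by (simp add: set_lebesgue_integral_def)
  next
    fix A assume A: "A \<in> sigma_sets UNIV G" "(LINT x:A|lebesgue. v x) = 0"
    have [measurable]: "A \<in> sets lebesgue"
      using A(1) by (simp add: sets_G sets_completionI_sets)
    have "(LINT x:A|lebesgue. v x) + (LINT x:UNIV - A|lebesgue. v x) = (LINT x:A \<union> (UNIV - A)|lebesgue. v x)"
      by (rule set_integral_Un[symmetric]) (auto intro!: int)
    also have "A \<union> (UNIV - A) = UNIV" by blast
    finally show "(LINT x:UNIV - A|lebesgue. v x) = 0"
      using tot A(2) by (simp add: set_lebesgue_integral_def)
  next
    fix A :: "nat \<Rightarrow> real set"
    assume A: "disjoint_family A" "range A \<subseteq> sigma_sets UNIV G" "\<And>i. (LINT x:A i|lebesgue. v x) = 0"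
    have [measurable]: "A i \<in> sets lebesgue" for i
      using A(2) by (simp add: sets_G sets_completionI_sets image_subset_iff)
    have "(LINT x:(\<Union>i. A i)|lebesgue. v x) = (\<Sum>i. LINT x:A i|lebesgue. v x)"
      by (rule lebesgue_integral_countable_add) (use A(1) in \<open>auto intro!: int simp: disjoint_family_on_def\<close>)
    then show "(LINT x:(\<Union>i. A i)|lebesgue. v x) = 0" using A(3) by simp
  qed
  have borel: "(LINT x:A|lebesgue. v x) = 0" if "A \<in> sets borel" for A
    using sigma[of A] that by (simp add: sets_G)
  show ?thesis
  proof (rule lebesgue.density_zero[OF v])
    fix A :: "real set" assume A: "A \<in> sets lebesgue"
    then obtain S N N' where "A = S \<union> N" "N \<subseteq> N'" "N' \<in> null_sets lborel" "S \<in> sets lborel"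
      by (rule sets_completionE)
    then have "(LINT x:A|lebesgue. v x) = (LINT x:S|lebesgue. v x)"
      by (intro set_integral_null_delta v A)
        (auto intro: null_sets_completion_subset[OF _ null_sets_completionI])
    then show "(LINT x:A|lebesgue. v x) = 0" using borel \<open>S \<in> sets lborel\<close> by simp
  qed
qed

text \<open>Bumps converge to indicators of open intervals, so vanishing pairings force vanishing
  interval integrals. Truncation to (-n, n) supplies the global integrability that the preceding
  lemma asks for.\<close>

lemma fundamental_lemma:
  assumes w: "loc_integrable w"
    and zero: "\<And>\<phi>. test_function \<phi> \<Longrightarrow> (LINT x|lebesgue. w x * \<phi> x) = 0"
  shows "AE x in lebesgue. w x = 0"
proof -
  have iv: "(LINT x:{a<..<b}|lebesgue. w x) = 0" for a b
    using integral_bump_tendsto[OF w, of a b] zero[OF test_function_bump]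
    by (simp add: LIMSEQ_const_iff)
  have "AE x in lebesgue. indicator {-real n<..<real n} x *\<^sub>R w x = 0" for n
  proof (rule AE_zero_if_interval_integrals_zero)
    have "set_integrable lebesgue {-real n<..<real n} w"
      by (rule set_integrable_subset[OF loc_integrableD[OF w, of "-real n" "real n"]]) auto
    then show "integrable lebesgue (\<lambda>x. indicator {-real n<..<real n} x *\<^sub>R w x)"
      by (simp add: set_integrable_def)
    fix a b
    have "(LINT x:{a<..<b}|lebesgue. indicator {-real n<..<real n} x *\<^sub>R w x)
        = (LINT x:{max a (-real n)<..<min b (real n)}|lebesgue. w x)"
      unfolding set_lebesgue_integral_def
      by (intro Bochner_Integration.integral_cong) (auto simp: indicator_def)
    then show "(LINT x:{a<..<b}|lebesgue. indicator {-real n<..<real n} x *\<^sub>R w x) = 0"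
      by (simp add: iv)
  qed
  then have "AE x in lebesgue. \<forall>n::nat. indicator {-real n<..<real n} x *\<^sub>R w x = 0"
    by (simp only: AE_all_countable) simp
  then show ?thesis
  proof eventually_elim
    case (elim x)
    obtain n :: nat where "\<bar>x\<bar> < real n" using reals_Archimedean2 by blast
    then have "x \<in> {-real n<..<real n}" by (auto simp: abs_less_iff)
    then show ?case using elim[rule_format, of n] by simp
  qed
qed

interpretation lebesgue_pair: pair_sigma_finite "lebesgue :: real measure" "lebesgue :: real measure" ..

section \<open>Absolutely continuous functions\<close>

text \<open>Fubini for p(x) q(y), with the plane cut along the diagonal. This is integration by
  parts for primitives of integrable functions, free of any pointwise differentiability.\<close>

lemma product_integral_triangles:
  fixes p q :: "real \<Rightarrow> complex"
  assumes p: "integrable lebesgue p" and q: "integrable lebesgue q"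
  shows "integrable lebesgue (\<lambda>x. p x * (LINT y:{..x}|lebesgue. q y))"
    and "(LINT x|lebesgue. p x) * (LINT x|lebesgue. q x) =
      (LINT x|lebesgue. p x * (LINT y:{..x}|lebesgue. q y)) +
      (LINT x|lebesgue. (LINT y:{..x}|lebesgue. p y) * q x)"
proof -
  have [measurable]: "p \<in> borel_measurable lebesgue" "q \<in> borel_measurable lebesgue"
    using p q by auto
  let ?M = "lebesgue \<Otimes>\<^sub>M (lebesgue :: real measure)"
  let ?F = "\<lambda>x y. p x * q y"
  have F: "integrable ?M (case_prod ?F)"
  proof (rule lebesgue_pair.Fubini_integrable)
    show "case_prod ?F \<in> borel_measurable ?M" by measurable
    show "integrable lebesgue (\<lambda>x. LINT y|lebesgue. norm (case_prod ?F (x, y)))"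
      using p by (simp add: norm_mult)
    show "AE x in lebesgue. integrable lebesgue (\<lambda>y. case_prod ?F (x, y))"
      using q by simp
  qed
  have [measurable]: "(\<lambda>z. fst z) \<in> measurable ?M (borel :: real measure)"
      "(\<lambda>z. snd z) \<in> measurable ?M (borel :: real measure)"
    by (rule measurable_compose[OF measurable_fst], rule measurable_completion, simp)
      (rule measurable_compose[OF measurable_snd], rule measurable_completion, simp)
  have T: "{z. snd z \<le> fst z} \<in> sets ?M" "{z. \<not> snd z \<le> fst z} \<in> sets ?M"
  proof -
    have "{z \<in> space ?M. snd z \<le> fst z} \<in> sets ?M" "{z \<in> space ?M. \<not> snd z \<le> fst z} \<in> sets ?M"
      by measurable
    then show "{z. snd z \<le> fst z} \<in> sets ?M" "{z. \<not> snd z \<le> fst z} \<in> sets ?M"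
      by (simp_all add: space_pair_measure)
  qed
  let ?A = "\<lambda>x y. indicator {z. snd z \<le> fst z} (x, y) *\<^sub>R ?F x y"
  let ?B = "\<lambda>x y. indicator {z. \<not> snd z \<le> fst z} (x, y) *\<^sub>R ?F x y"
  have A: "integrable ?M (case_prod ?A)"
    using integrable_mult_indicator[OF T(1) F] by (simp add: case_prod_unfold)
  have B: "integrable ?M (case_prod ?B)"
    using integrable_mult_indicator[OF T(2) F] by (simp add: case_prod_unfold)
  have A_inner: "(LINT y|lebesgue. ?A x y) = p x * (LINT y:{..x}|lebesgue. q y)" for x
  proof -
    have "(LINT y|lebesgue. ?A x y) = (LINT y|lebesgue. p x * (indicator {..x} y *\<^sub>R q y))"
      by (intro Bochner_Integration.integral_cong) (auto simp: indicator_def)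
    then show ?thesis by (simp only: integral_mult_right_zero set_lebesgue_integral_def)
  qed
  have B_inner: "(LINT x|lebesgue. ?B x y) = (LINT x:{..y}|lebesgue. p x) * q y" for y
  proof -
    have "(LINT x|lebesgue. ?B x y) = (LINT x|lebesgue. (indicator {..<y} x *\<^sub>R p x) * q y)"
      by (intro Bochner_Integration.integral_cong) (auto simp: indicator_def)
    also have "\<dots> = (LINT x:{..<y}|lebesgue. p x) * q y"
      unfolding set_lebesgue_integral_def by (rule integral_mult_left_zero)
    \<comment> \<open>The diagonal belongs to the other triangle, so the half-line is open here; a
      single point makes up the difference.\<close>
    also have "(LINT x:{..<y}|lebesgue. p x) = (LINT x:{..y}|lebesgue. p x)"
    proof (rule set_integral_null_delta[OF p])
      have "({..<y} - {..y}) \<union> ({..y} - {..<y}) = {y}" by auto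
      then show "({..<y} - {..y}) \<union> ({..y} - {..<y}) \<in> null_sets lebesgue" by simp
    qed auto
    finally show ?thesis .
  qed
  show "integrable lebesgue (\<lambda>x. p x * (LINT y:{..x}|lebesgue. q y))"
    using lebesgue_pair.integrable_fst[OF A] by (simp only: A_inner)
  have "(LINT x|lebesgue. p x) * (LINT x|lebesgue. q x) = (LINT x|lebesgue. LINT y|lebesgue. ?F x y)"
    by simp
  also have "\<dots> = (LINT z|?M. case_prod ?F z)"
    by (rule lebesgue_pair.integral_fst[OF F])
  also have "\<dots> = (LINT z|?M. case_prod ?A z + case_prod ?B z)"
    by (intro Bochner_Integration.integral_cong) (auto simp: indicator_def)
  also have "\<dots> = (LINT z|?M. case_prod ?A z) + (LINT z|?M. case_prod ?B z)"
    by (rule Bochner_Integration.integral_add[OF A B])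
  also have "(LINT z|?M. case_prod ?A z) = (LINT x|lebesgue. LINT y|lebesgue. ?A x y)"
    by (rule lebesgue_pair.integral_fst[OF A, symmetric])
  also have "(LINT z|?M. case_prod ?B z) = (LINT y|lebesgue. LINT x|lebesgue. ?B x y)"
    by (rule lebesgue_pair.integral_snd[OF B, symmetric])
  finally show "(LINT x|lebesgue. p x) * (LINT x|lebesgue. q x) =
      (LINT x|lebesgue. p x * (LINT y:{..x}|lebesgue. q y)) +
      (LINT x|lebesgue. (LINT y:{..x}|lebesgue. p y) * q x)"
    by (simp only: A_inner B_inner)
qed

text \<open>Local absolute continuity, encoded as being a primitive of a locally integrable density.
  The density matters only up to null sets, which suits representatives of \<open>L2\<close>
  classes.\<close>

definition abs_cont_deriv :: "(real \<Rightarrow> complex) \<Rightarrow> (real \<Rightarrow> complex) \<Rightarrow> bool" where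
  "abs_cont_deriv u p \<longleftrightarrow> loc_integrable p \<and>
     (\<forall>a b. a \<le> b \<longrightarrow> u b - u a = (LINT x:{a..b}|lebesgue. p x))"

lemma abs_cont_derivD:
  assumes "abs_cont_deriv u p"
  shows "loc_integrable p" "a \<le> b \<Longrightarrow> (LINT x:{a..b}|lebesgue. p x) = u b - u a"
  using assms by (simp_all add: abs_cont_deriv_def)

lemma set_integral_Icc_truncated:
  fixes p :: "real \<Rightarrow> complex"
  assumes "x \<in> {a..b}"
  shows "(LINT y:{..x}|lebesgue. indicator {a..b} y *\<^sub>R p y) = (LINT y:{a..x}|lebesgue. p y)"
  unfolding set_lebesgue_integral_def
  by (intro Bochner_Integration.integral_cong) (use assms in \<open>auto simp: indicator_def\<close>)

text \<open>On [a, b] the increment of \<open>v\<close> is the primitive of the truncated density,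
  so integrability of the product is a by-product of Fubini and no boundedness of \<open>v\<close>
  has to be established.\<close>

lemma abs_cont_deriv_mult_increment:
  assumes "abs_cont_deriv v q" "loc_integrable p" "a \<le> b"
  shows "set_integrable lebesgue {a..b} (\<lambda>x. p x * (v x - v a))"
proof -
  have "integrable lebesgue (\<lambda>x. (indicator {a..b} x *\<^sub>R p x)
      * (LINT y:{..x}|lebesgue. indicator {a..b} y *\<^sub>R q y))"
    using loc_integrableD[OF assms(2)] loc_integrableD[OF abs_cont_derivD(1)[OF assms(1)]]
    unfolding set_integrable_def by (rule product_integral_triangles(1))
  also have "(\<lambda>x. (indicator {a..b} x *\<^sub>R p x) * (LINT y:{..x}|lebesgue. indicator {a..b} y *\<^sub>R q y))
      = (\<lambda>x. indicator {a..b} x *\<^sub>R (p x * (v x - v a)))"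
  proof
    fix x show "(indicator {a..b} x *\<^sub>R p x) * (LINT y:{..x}|lebesgue. indicator {a..b} y *\<^sub>R q y)
      = indicator {a..b} x *\<^sub>R (p x * (v x - v a))"
      using abs_cont_derivD(2)[OF assms(1), of a x]
      by (cases "x \<in> {a..b}") (simp_all only: set_integral_Icc_truncated, simp_all)
  qed
  finally show ?thesis by (simp add: set_integrable_def)
qed

lemma loc_integrableI_le: "(\<And>a b. a \<le> b \<Longrightarrow> set_integrable lebesgue {a..b} w) \<Longrightarrow> loc_integrable w"
  unfolding loc_integrable_def
proof (intro allI)
  fix a b :: real
  assume "\<And>a b. a \<le> b \<Longrightarrow> set_integrable lebesgue {a..b} w"
  then show "set_integrable lebesgue {a..b} w"
    by (cases "a \<le> b") (auto simp: set_integrable_def)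
qed

lemma loc_integrable_mult_const: "loc_integrable p \<Longrightarrow> loc_integrable (\<lambda>x. p x * c)"
  by (simp add: loc_integrable_def)

lemma abs_cont_deriv_mult_loc_integrable:
  assumes "abs_cont_deriv v q" "loc_integrable p"
  shows "loc_integrable (\<lambda>x. p x * v x)"
proof (rule loc_integrableI_le)
  fix a b :: real assume "a \<le> b"
  have "set_integrable lebesgue {a..b} (\<lambda>x. p x * (v x - v a) + p x * v a)"
    by (intro set_integral_add abs_cont_deriv_mult_increment[OF assms \<open>a \<le> b\<close>]
        loc_integrableD loc_integrable_mult_const assms)
  then show "set_integrable lebesgue {a..b} (\<lambda>x. p x * v x)"
    by (simp add: algebra_simps)
qed

lemma abs_cont_deriv_loc_integrable: "abs_cont_deriv v q \<Longrightarrow> loc_integrable v"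
  using abs_cont_deriv_mult_loc_integrable[OF _ loc_integrable_const[of 1]] by simp

text \<open>For the densities truncated to [a, b] the triangle identity expresses (u b - u a)(v b -
  v a) as the sum of the integrals of p (v - v a) and q (u - u a). Moving the constants u a and v a
  to the other side leaves the product rule.\<close>

lemma abs_cont_deriv_mult:
  assumes u: "abs_cont_deriv u p" and v: "abs_cont_deriv v q"
  shows "abs_cont_deriv (\<lambda>x. u x * v x) (\<lambda>x. p x * v x + q x * u x)"
proof -
  note p = abs_cont_derivD(1)[OF u] and q = abs_cont_derivD(1)[OF v]
  have int: "loc_integrable (\<lambda>x. p x * v x)" "loc_integrable (\<lambda>x. q x * u x)"
    by (intro abs_cont_deriv_mult_loc_integrable[OF v p] abs_cont_deriv_mult_loc_integrable[OF u q])+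
  have "u b * v b - u a * v a = (LINT x:{a..b}|lebesgue. p x * v x + q x * u x)" if "a \<le> b" for a b
  proof -
    let ?p = "\<lambda>x. indicator {a..b} x *\<^sub>R p x" and ?q = "\<lambda>x. indicator {a..b} x *\<^sub>R q x"
    have pq: "integrable lebesgue ?p" "integrable lebesgue ?q"
      using loc_integrableD[OF p] loc_integrableD[OF q] by (simp_all add: set_integrable_def)
    have inner: "(LINT y:{..x}|lebesgue. ?p y) = u x - u a" "(LINT y:{..x}|lebesgue. ?q y) = v x - v a"
      if "x \<in> {a..b}" for x
      using that abs_cont_derivD(2)[OF u, of a x] abs_cont_derivD(2)[OF v, of a x]
      by (simp_all only: set_integral_Icc_truncated, simp_all)
    have conv:
        "?p x * (LINT y:{..x}|lebesgue. ?q y) = indicator {a..b} x *\<^sub>R (p x * v x - p x * v a)"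
        "(LINT y:{..x}|lebesgue. ?p y) * ?q x = indicator {a..b} x *\<^sub>R (q x * u x - q x * u a)" for x
      by (atomize (full), cases "x \<in> {a..b}")
        (simp_all only: inner indicator_simps scaleR_one scaleR_zero_left mult_zero_left mult_zero_right, simp_all add: algebra_simps)
    have "(u b - u a) * (v b - v a) = (LINT x|lebesgue. ?p x) * (LINT x|lebesgue. ?q x)"
      using abs_cont_derivD(2)[OF u that] abs_cont_derivD(2)[OF v that]
      by (simp add: set_lebesgue_integral_def)
    also have "\<dots> = (LINT x|lebesgue. ?p x * (LINT y:{..x}|lebesgue. ?q y))
        + (LINT x|lebesgue. (LINT y:{..x}|lebesgue. ?p y) * ?q x)"
      by (rule product_integral_triangles(2)[OF pq])
    also have "(LINT x|lebesgue. ?p x * (LINT y:{..x}|lebesgue. ?q y))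
        = (LINT x:{a..b}|lebesgue. p x * v x - p x * v a)"
      unfolding set_lebesgue_integral_def[where f = "\<lambda>x. p x * v x - p x * v a"]
      by (simp only: conv)
    also have "\<dots> = (LINT x:{a..b}|lebesgue. p x * v x) - (u b - u a) * v a"
      using abs_cont_derivD(2)[OF u that]
      by (subst set_integral_diff) (auto intro!: loc_integrableD int loc_integrable_mult_const p)
    also have "(LINT x|lebesgue. (LINT y:{..x}|lebesgue. ?p y) * ?q x)
        = (LINT x:{a..b}|lebesgue. q x * u x - q x * u a)"
      unfolding set_lebesgue_integral_def[where f = "\<lambda>x. q x * u x - q x * u a"]
      by (simp only: conv)
    also have "\<dots> = (LINT x:{a..b}|lebesgue. q x * u x) - (v b - v a) * u a"
      using abs_cont_derivD(2)[OF v that]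
      by (subst set_integral_diff) (auto intro!: loc_integrableD int loc_integrable_mult_const q)
    finally have "u b * v b - u a * v a
        = (LINT x:{a..b}|lebesgue. p x * v x) + (LINT x:{a..b}|lebesgue. q x * u x)"
      by (simp add: algebra_simps)
    also have "\<dots> = (LINT x:{a..b}|lebesgue. p x * v x + q x * u x)"
      by (rule set_integral_add(2)[symmetric]) (intro loc_integrableD int)+
    finally show ?thesis .
  qed
  then show ?thesis using loc_integrable_add[OF int] by (simp add: abs_cont_deriv_def)
qed

lemma abs_cont_deriv_test_function:
  assumes "test_function \<phi>" shows "abs_cont_deriv \<phi> (deriv1 \<phi>)"
  unfolding abs_cont_deriv_def
proof (intro conjI allI impI)
  show l: "loc_integrable (deriv1 \<phi>)"
    by (intro integrable_imp_loc_integrable test_function_integrable test_function_deriv1 assms)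
  fix a b :: real assume "a \<le> b"
  have "(deriv1 \<phi> has_integral (\<phi> b - \<phi> a)) {a..b}"
    by (rule fundamental_theorem_of_calculus[OF \<open>a \<le> b\<close>])
      (rule has_vector_derivative_at_within[OF smooth_has_deriv1[OF test_function_smooth[OF assms]]])
  then show "\<phi> b - \<phi> a = (LINT x:{a..b}|lebesgue. deriv1 \<phi> x)"
    using set_lebesgue_integral_eq_integral(2)[OF loc_integrableD[OF l, of a b]]
    by (simp add: integral_unique)
qed

lemma abs_cont_deriv_by_parts:
  assumes u: "abs_cont_deriv u p" and \<phi>: "test_function \<phi>"
  shows "(LINT x|lebesgue. u x * deriv1 \<phi> x) = - (LINT x|lebesgue. p x * \<phi> x)"
proof -
  obtain r where r: "r > 0" "\<And>x. x \<notin> {-r..r} \<Longrightarrow> \<phi> x = 0" "\<And>x. x \<notin> {-r..r} \<Longrightarrow> deriv1 \<phi> x = 0"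
    by (rule test_function_support[OF \<phi>]) (rule that)
  \<comment> \<open>The interval exceeds [-r, r] by one on each side because \<open>r(2)\<close>
    gives zeros of \<phi> only strictly outside [-r, r].\<close>
  have "(LINT x:{-r-1..r+1}|lebesgue. p x * \<phi> x + deriv1 \<phi> x * u x) = u (r+1) * \<phi> (r+1) - u (-r-1) * \<phi> (-r-1)"
    by (rule abs_cont_derivD(2)[OF abs_cont_deriv_mult[OF u abs_cont_deriv_test_function[OF \<phi>]]])
      (use r(1) in simp)
  also have "\<dots> = 0" using r(1,2) by simp
  also have "(LINT x:{-r-1..r+1}|lebesgue. p x * \<phi> x + deriv1 \<phi> x * u x)
      = (LINT x|lebesgue. p x * \<phi> x + u x * deriv1 \<phi> x)"
    unfolding set_lebesgue_integral_def
  proof (intro Bochner_Integration.integral_cong refl)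
    fix x show "indicator {-r-1..r+1} x *\<^sub>R (p x * \<phi> x + deriv1 \<phi> x * u x) = p x * \<phi> x + u x * deriv1 \<phi> x"
      using r(2,3)[of x] by (cases "x \<in> {-r..r}") (auto simp: indicator_def)
  qed
  also have "\<dots> = (LINT x|lebesgue. p x * \<phi> x) + (LINT x|lebesgue. u x * deriv1 \<phi> x)"
    by (intro Bochner_Integration.integral_add loc_integrable_test_function test_function_deriv1 \<phi>
        abs_cont_derivD(1)[OF u] abs_cont_deriv_loc_integrable[OF u])
  finally show ?thesis by (metis add.commute eq_neg_iff_add_eq_0)
qed

lemma abs_cont_deriv_exists:
  assumes p: "loc_integrable p"
  shows "\<exists>u. abs_cont_deriv u p"
proof -
  \<comment> \<open>The oriented integral of \<open>p\<close> from 0 to \<open>x\<close>; additivity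
    over adjacent intervals then settles each position of 0 relative to [a, b].\<close>
  define u where "u x = (if 0 \<le> x then LINT y:{0..x}|lebesgue. p y else - (LINT y:{x..0}|lebesgue. p y))" for x
  have comb: "(LINT x:{a..c}|lebesgue. p x) = (LINT x:{a..b}|lebesgue. p x) + (LINT x:{b..c}|lebesgue. p x)"
    if "a \<le> b" "b \<le> c" for a b c
  proof -
    have "(LINT x:{a..c}|lebesgue. p x) = (LINT x:{a..b} \<union> {b<..c}|lebesgue. p x)"
      using that by (simp add: ivl_disj_un)
    also have "\<dots> = (LINT x:{a..b}|lebesgue. p x) + (LINT x:{b<..c}|lebesgue. p x)"
      by (rule set_integral_Un)
        (auto intro: loc_integrableD[OF p] set_integrable_subset[OF loc_integrableD[OF p, of b c]])
    also have "(LINT x:{b<..c}|lebesgue. p x) = (LINT x:{b..c}|lebesgue. p x)"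
    proof (rule set_integral_cong_set)
      have "AE x in lebesgue. x \<notin> {b}" by (rule AE_not_in) simp
      then show "AE x in lebesgue. (x \<in> {b..c}) = (x \<in> {b<..c})" by eventually_elim auto
    qed (use loc_integrable_measurable[OF p] in \<open>auto simp: set_borel_measurable_def intro!: borel_measurable_scaleR borel_measurable_indicator\<close>)
    finally show ?thesis .
  qed
  have "u b - u a = (LINT x:{a..b}|lebesgue. p x)" if "a \<le> b" for a b
  proof -
    consider "0 \<le> a" | "a < 0" "0 \<le> b" | "b < 0" by linarith
    then show ?thesis
    proof cases
      case 1 then show ?thesis using comb[of 0 a b] that by (simp add: u_def)
    next
      case 2 then show ?thesis using comb[of a 0 b] that by (simp add: u_def)
    next
      case 3 then show ?thesis using comb[of a b 0] that by (simp add: u_def)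
    qed
  qed
  then show ?thesis using p by (auto simp: abs_cont_deriv_def)
qed

text \<open>Subtracting a primitive of \<open>p\<close> leaves a function that annihilates all
  derivatives of test functions. Since every test function of mean zero is such a derivative, that
  function is almost everywhere a constant, which can be added to the primitive.\<close>

lemma du_bois_reymond:
  assumes w: "loc_integrable w" and p: "loc_integrable p"
    and weak: "\<And>\<phi>. test_function \<phi> \<Longrightarrow>
      (LINT x|lebesgue. w x * deriv1 \<phi> x) = - (LINT x|lebesgue. p x * \<phi> x)"
  obtains u where "abs_cont_deriv u p" "AE x in lebesgue. w x = u x"
proof -
  obtain v where v: "abs_cont_deriv v p" using abs_cont_deriv_exists[OF p] by blast
  define z where "z x = w x - v x" for x
  have z: "loc_integrable z"
    unfolding z_def by (intro loc_integrable_diff w abs_cont_deriv_loc_integrable[OF v])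
  have z0: "(LINT x|lebesgue. z x * deriv1 \<phi> x) = 0" if "test_function \<phi>" for \<phi>
  proof -
    have "(LINT x|lebesgue. z x * deriv1 \<phi> x)
        = (LINT x|lebesgue. w x * deriv1 \<phi> x - v x * deriv1 \<phi> x)"
      by (simp add: z_def left_diff_distrib)
    also have "\<dots> = (LINT x|lebesgue. w x * deriv1 \<phi> x) - (LINT x|lebesgue. v x * deriv1 \<phi> x)"
      by (intro Bochner_Integration.integral_diff loc_integrable_test_function test_function_deriv1
          that w abs_cont_deriv_loc_integrable[OF v])
    finally show ?thesis using weak[OF that] abs_cont_deriv_by_parts[OF v that] by simp
  qed
  \<comment> \<open>The integrals of the bumps on (0, 1) tend to 1, so some bump has nonzero
    integral and can be used to normalise means.\<close>
  have "(\<lambda>n. LINT x|lebesgue. 1 * bump 0 1 n x) \<longlonglongrightarrow> (LINT x:{0<..<1::real}|lebesgue. 1)"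
    by (rule integral_bump_tendsto[OF loc_integrable_const])
  also have "(LINT x:{0<..<1::real}|lebesgue. 1::complex) = 1"
    by (simp add: set_lebesgue_integral_def)
  finally have "\<forall>\<^sub>F n in sequentially. (LINT x|lebesgue. 1 * bump 0 1 n x) \<noteq> 0"
    by (rule tendsto_imp_eventually_ne) simp
  then obtain n where n: "(LINT x|lebesgue. bump 0 1 n x) \<noteq> 0"
    by (auto dest: eventually_happens)
  define \<rho> where "\<rho> = bump 0 1 n"
  \<comment> \<open>If \<open>z\<close> is constant, its value must be its \<rho>-weighted
    mean.\<close>
  define c where "c = (LINT x|lebesgue. z x * \<rho> x) / (LINT x|lebesgue. \<rho> x)"
  have \<rho>: "test_function \<rho>" "(LINT x|lebesgue. \<rho> x) \<noteq> 0"
    using n by (simp_all add: \<rho>_def test_function_bump)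
  have "AE x in lebesgue. z x - c = 0"
  proof (rule fundamental_lemma)
    show "loc_integrable (\<lambda>x. z x - c)" by (intro loc_integrable_diff z loc_integrable_const)
    fix \<psi> assume \<psi>: "test_function \<psi>"
    \<comment> \<open>Chosen so that \<psi> - t \<rho> has mean zero and hence is the derivative of
      a test function.\<close>
    define t where "t = (LINT x|lebesgue. \<psi> x) / (LINT x|lebesgue. \<rho> x)"
    let ?\<eta> = "\<lambda>x. \<psi> x - t * \<rho> x"
    have \<eta>: "test_function ?\<eta>"
      by (intro test_function_diff \<psi> test_function_mult \<rho>)
    have "(LINT x|lebesgue. ?\<eta> x) = (LINT x|lebesgue. \<psi> x) - t * (LINT x|lebesgue. \<rho> x)"
      by (subst Bochner_Integration.integral_diff)
        (auto intro!: test_function_integrable \<psi> integrable_mult_right \<rho>)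
    also have "\<dots> = 0" using \<rho>(2) by (simp add: t_def)
    finally have \<eta>0: "(LINT x|lebesgue. ?\<eta> x) = 0" .
    obtain r where r: "r > 0" "\<And>x. x \<notin> {-r..r} \<Longrightarrow> ?\<eta> x = 0" "\<And>x. x \<notin> {-r..r} \<Longrightarrow> deriv1 ?\<eta> x = 0"
      by (rule test_function_support[OF \<eta>]) (rule that)
    obtain \<theta> where \<theta>: "test_function \<theta>" "deriv1 \<theta> = ?\<eta>"
      using test_function_antiderivative[OF \<eta> \<eta>0 r(2)] by metis
    note int = loc_integrable_test_function[OF z \<psi>] loc_integrable_test_function[OF z \<rho>(1)]
    have "0 = (LINT x|lebesgue. z x * ?\<eta> x)" using z0[OF \<theta>(1)] \<theta>(2) by simp
    also have "\<dots> = (LINT x|lebesgue. z x * \<psi> x - t * (z x * \<rho> x))"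
      by (intro Bochner_Integration.integral_cong) (auto simp: algebra_simps)
    also have "\<dots> = (LINT x|lebesgue. z x * \<psi> x) - t * (LINT x|lebesgue. z x * \<rho> x)"
      using int by simp
    also have "t * (LINT x|lebesgue. z x * \<rho> x) = c * (LINT x|lebesgue. \<psi> x)"
      by (simp add: t_def c_def)
    finally have "(LINT x|lebesgue. z x * \<psi> x) = c * (LINT x|lebesgue. \<psi> x)" by simp
    then show "(LINT x|lebesgue. (z x - c) * \<psi> x) = 0"
      using int(1) test_function_integrable[OF \<psi>] by (simp add: left_diff_distrib)
  qed
  then have "AE x in lebesgue. w x = v x + c" by eventually_elim (simp add: z_def algebra_simps)
  moreover have "abs_cont_deriv (\<lambda>x. v x + c) p" using v by (simp add: abs_cont_deriv_def)
  ultimately show thesis using that by blast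
qed

text \<open>A smooth cutoff stretched to infinity removes the boundary terms.\<close>

lemma integral_derivative_eq_0:
  assumes u: "abs_cont_deriv u p" and int: "integrable lebesgue u" "integrable lebesgue p"
  shows "(LINT x|lebesgue. p x) = 0"
proof -
  define \<kappa> where "\<kappa> = bump (-1) 1 0"
  have \<kappa>: "test_function \<kappa>" by (simp add: \<kappa>_def test_function_bump)
  have \<kappa>0: "\<kappa> 0 \<noteq> 0" by (simp add: \<kappa>_def bump_def bump_half_def)
  obtain r B where B: "r > 0" "B > 0" "\<And>x. cmod (\<kappa> x) \<le> B * indicator {-r..r} x"
    by (rule test_function_bounded[OF \<kappa>]) (rule that)
  obtain r' B' where B': "r' > 0" "B' > 0" "\<And>x. cmod (deriv1 \<kappa> x) \<le> B' * indicator {-r'..r'} x"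
    by (rule test_function_bounded[OF test_function_deriv1[OF \<kappa>]]) (rule that)
  have le: "cmod (\<kappa> x) \<le> B" "cmod (deriv1 \<kappa> x) \<le> B'" for x
    using B(2) B(3)[of x] B'(2) B'(3)[of x] by (auto simp: of_bool_def indicator_def split: if_splits)
  \<comment> \<open>Stretching by \<open>Suc n\<close> multiplies the derivative of the cutoff by
    1/(n+1), so the term in which it meets \<open>u\<close> is at most B'/(n+1) times the integral
    of \<bar>u\<bar>.\<close>
  define \<kappa>n where "\<kappa>n n x = \<kappa> (inverse (real (Suc n)) * x)" for n x
  have d: "deriv1 (\<kappa>n n) = (\<lambda>x. inverse (real (Suc n)) *\<^sub>R deriv1 \<kappa> (inverse (real (Suc n)) * x))" for n
    unfolding \<kappa>n_def
    by (rule deriv1_eqI, rule vector_diff_chain_at[unfolded o_def, where f = "\<lambda>x. inverse (real (Suc n)) * x"])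
      (auto intro!: derivative_eq_intros smooth_has_deriv1 test_function_smooth \<kappa>
        simp: has_real_derivative_iff_has_vector_derivative[symmetric] simp del: of_nat_Suc)
  have tn: "test_function (\<kappa>n n)" for n
  proof (rule test_functionI)
    show "smooth (\<kappa>n n)"
      using smooth_affine[OF test_function_smooth[OF \<kappa>], of "inverse (real (Suc n))" 0]
      by (simp add: \<kappa>n_def[abs_def] del: of_nat_Suc)
    fix x assume x: "x \<notin> {- real (Suc n)..real (Suc n)}"
    have "inverse (real (Suc n)) * x \<notin> {-1<..<1}"
      using x by (auto simp: field_simps simp del: of_nat_Suc)
    then show "\<kappa>n n x = 0" unfolding \<kappa>n_def \<kappa>_def by (rule bump_outside)
  qed
  have m: "\<kappa>n n \<in> borel_measurable lebesgue" "deriv1 (\<kappa>n n) \<in> borel_measurable lebesgue" for n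
    by (intro test_function_measurable test_function_deriv1 tn)+
  \<comment> \<open>The stretched cutoffs tend pointwise to the constant \<kappa> 0, which is
    exp(-2) and not 1; being nonzero, it can be cancelled at the end.\<close>
  have "(\<lambda>n. LINT x|lebesgue. p x * \<kappa>n n x) \<longlonglongrightarrow> (LINT x|lebesgue. p x * \<kappa> 0)"
  proof (rule integral_dominated_convergence)
    show "integrable lebesgue (\<lambda>x. B * norm (p x))" using int(2) by simp
    show "AE x in lebesgue. (\<lambda>n. p x * \<kappa>n n x) \<longlonglongrightarrow> p x * \<kappa> 0"
    proof (rule AE_I2, rule tendsto_mult[OF tendsto_const])
      fix x
      have "(\<lambda>n. inverse (real (Suc n)) * x) \<longlonglongrightarrow> 0" by real_asymp
      moreover have "isCont \<kappa> 0"
        using smooth_continuous[OF test_function_smooth[OF \<kappa>], of UNIV]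
        by (simp add: continuous_on_eq_continuous_at)
      ultimately show "(\<lambda>n. \<kappa>n n x) \<longlonglongrightarrow> \<kappa> 0"
        unfolding \<kappa>n_def by (rule isCont_tendsto_compose[rotated])
    qed
    show "AE x in lebesgue. norm (p x * \<kappa>n n x) \<le> B * norm (p x)" for n
      unfolding \<kappa>n_def norm_mult mult.commute[of B]
      by (rule AE_I2) (rule mult_left_mono[OF le(1) norm_ge_zero])
  qed (use int m in \<open>auto intro!: borel_measurable_times\<close>)
  moreover have "(\<lambda>n. LINT x|lebesgue. p x * \<kappa>n n x) \<longlonglongrightarrow> 0"
  proof (rule Lim_null_comparison)
    show "\<forall>\<^sub>F n in sequentially. norm (LINT x|lebesgue. p x * \<kappa>n n x)
        \<le> inverse (real (Suc n)) * (B' * (LINT x|lebesgue. norm (u x)))"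
    proof (rule always_eventually, rule allI)
      fix n
      have "norm (LINT x|lebesgue. p x * \<kappa>n n x) = norm (LINT x|lebesgue. u x * deriv1 (\<kappa>n n) x)"
        using abs_cont_deriv_by_parts[OF u tn] by simp
      also have "\<dots> \<le> (LINT x|lebesgue. inverse (real (Suc n)) * B' * norm (u x))"
      proof (rule Bochner_Integration.integral_norm_bound_integral)
        show "integrable lebesgue (\<lambda>x. u x * deriv1 (\<kappa>n n) x)"
          by (intro loc_integrable_test_function integrable_imp_loc_integrable int test_function_deriv1 tn)
        show "integrable lebesgue (\<lambda>x. inverse (real (Suc n)) * B' * norm (u x))" using int by simp
        fix x
        have "norm (u x * deriv1 (\<kappa>n n) x)
            = inverse (real (Suc n)) * (cmod (deriv1 \<kappa> (inverse (real (Suc n)) * x)) * norm (u x))"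
          by (simp add: d norm_mult)
        also have "\<dots> \<le> inverse (real (Suc n)) * (B' * norm (u x))"
          by (intro mult_left_mono mult_right_mono le) auto
        finally show "norm (u x * deriv1 (\<kappa>n n) x) \<le> inverse (real (Suc n)) * B' * norm (u x)"
          by (simp only: mult.assoc)
      qed
      also have "\<dots> = inverse (real (Suc n)) * (B' * (LINT x|lebesgue. norm (u x)))" by simp
      finally show "norm (LINT x|lebesgue. p x * \<kappa>n n x)
        \<le> inverse (real (Suc n)) * (B' * (LINT x|lebesgue. norm (u x)))" .
    qed
    show "(\<lambda>n. inverse (real (Suc n)) * (B' * (LINT x|lebesgue. norm (u x)))) \<longlonglongrightarrow> 0"
      by (rule tendsto_mult_left_zero[OF LIMSEQ_inverse_real_of_nat])
  qed
  ultimately have "(LINT x|lebesgue. p x * \<kappa> 0) = 0" by (rule LIMSEQ_unique)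
  then show ?thesis using \<kappa>0 by simp
qed

section \<open>Weak derivatives in \<open>L2\<close>\<close>

lemma L2_rel_refl: "square_integrable F \<Longrightarrow> L2_rel F F"
  by (simp add: L2_rel_def)

lemma rep_abs_L2:
  assumes "square_integrable F"
  shows "AE x in lebesgue. rep_L2 (abs_L2 F) x = F x"
proof -
  have "L2_rel (rep_L2 (abs_L2 F)) F"
    using Quotient3_rel[OF Quotient3_L2, of "rep_L2 (abs_L2 F)" F]
    by (simp add: L2_rel_refl square_integrable_rep abs_rep_L2 assms)
  then show ?thesis by (simp add: L2_rel_def)
qed

lemma abs_L2_eqI:
  assumes "square_integrable F" "square_integrable G" "AE x in lebesgue. F x = G x"
  shows "abs_L2 F = abs_L2 G"
  using Quotient3_rel_abs[OF Quotient3_L2, of F G] assms by (simp add: L2_rel_def)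

lemma L2_eqI: "AE x in lebesgue. rep_L2 f x = rep_L2 g x \<Longrightarrow> f = g"
  using abs_L2_eqI[OF square_integrable_rep square_integrable_rep, of f g] by (simp add: abs_rep_L2)

lemma rep_plus_L2: "AE x in lebesgue. rep_L2 (f + g) x = rep_L2 f x + rep_L2 g x"
  using plus_L2.abs_eq[OF L2_rel_refl[OF square_integrable_rep] L2_rel_refl[OF square_integrable_rep], of f g]
    rep_abs_L2[OF square_integrable_add[OF square_integrable_rep[of f] square_integrable_rep[of g]]]
  by (simp add: abs_rep_L2)

lemma rep_minus_L2: "AE x in lebesgue. rep_L2 (f - g) x = rep_L2 f x - rep_L2 g x"
  using minus_L2.abs_eq[OF L2_rel_refl[OF square_integrable_rep] L2_rel_refl[OF square_integrable_rep], of f g]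
    rep_abs_L2[OF square_integrable_diff[OF square_integrable_rep[of f] square_integrable_rep[of g]]]
  by (simp add: abs_rep_L2)

lemma rep_scaleC_L2: "AE x in lebesgue. rep_L2 (c *\<^sub>C f) x = c * rep_L2 f x"
  using scaleC_L2.abs_eq[OF L2_rel_refl[OF square_integrable_rep], of c f]
    rep_abs_L2[OF square_integrable_mult[OF square_integrable_rep[of f], of c]]
  by (simp add: abs_rep_L2)

lemma inner_L2_rep: "inner f g = (LINT x|lebesgue. inner (rep_L2 f x) (rep_L2 g x))"
  using inner_L2.abs_eq[OF L2_rel_refl[OF square_integrable_rep] L2_rel_refl[OF square_integrable_rep], of f g]
  by (simp add: abs_rep_L2)

lemma rep_L2_measurable: "rep_L2 f \<in> borel_measurable lebesgue"
  using square_integrable_rep[of f] by (simp add: square_integrable_def)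

lemma scaleC_diff_right:
  fixes x y :: "'a::complex_normed_vector"
  shows "c *\<^sub>C (x - y) = c *\<^sub>C x - c *\<^sub>C y"
  using scaleC_add_right[of c "x - y" y] by (simp add: eq_diff_eq)

lemma scaleC_zero_right [simp]: "c *\<^sub>C (0::'a::complex_normed_vector) = 0"
  using scaleC_diff_right[of c "0::'a" 0] by simp

lemma scaleC_minus_right:
  fixes x :: "'a::complex_normed_vector"
  shows "c *\<^sub>C (- x) = - (c *\<^sub>C x)"
  using scaleC_diff_right[of c 0 x] by simp

lemma tendsto_scaleC:
  fixes f :: "nat \<Rightarrow> 'a::complex_normed_vector"
  assumes "f \<longlonglongrightarrow> l" shows "(\<lambda>n. c *\<^sub>C f n) \<longlonglongrightarrow> c *\<^sub>C l"
proof -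
  have "(\<lambda>n. cmod c * norm (f n - l)) \<longlonglongrightarrow> 0"
    using tendsto_mult_right_zero[OF tendsto_norm_zero[OF LIM_zero[OF assms]]] .
  then have "(\<lambda>n. c *\<^sub>C f n - c *\<^sub>C l) \<longlonglongrightarrow> 0"
    unfolding norm_scaleC[symmetric] scaleC_diff_right by (rule tendsto_norm_zero_cancel)
  then show ?thesis by (rule LIM_zero_cancel)
qed

lemma square_integrable_cnj: "square_integrable f \<Longrightarrow> square_integrable (\<lambda>x. cnj (f x))"
  unfolding square_integrable_def complex_mod_cnj
  by (auto intro: borel_measurable_continuous_on[OF continuous_on_cnj[OF continuous_on_id]])

lemma square_integrable_product:
  assumes "square_integrable f" "square_integrable g"
  shows "integrable lebesgue (\<lambda>x. f x * g x)"
proof -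
  have m [measurable]: "f \<in> borel_measurable lebesgue" "g \<in> borel_measurable lebesgue"
    using assms by (auto simp: square_integrable_def)
  have "integrable lebesgue (\<lambda>x. (cmod (f x))\<^sup>2 + (cmod (g x))\<^sup>2)"
    using assms by (auto simp: square_integrable_def)
  then show ?thesis
  proof (rule Bochner_Integration.integrable_bound)
    show "AE x in lebesgue. norm (f x * g x) \<le> norm ((cmod (f x))\<^sup>2 + (cmod (g x))\<^sup>2)"
    proof (rule AE_I2)
      fix x
      have "0 \<le> cmod (f x) * cmod (g x)" by simp
      then have "cmod (f x) * cmod (g x) \<le> (cmod (f x))\<^sup>2 + (cmod (g x))\<^sup>2"
        using sum_squares_bound[of "cmod (f x)" "cmod (g x)"] by linarith
      then show "norm (f x * g x) \<le> norm ((cmod (f x))\<^sup>2 + (cmod (g x))\<^sup>2)"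
        by (simp add: norm_mult)
    qed
  qed (intro borel_measurable_times m)
qed

lemma square_integrable_bounded_support:
  assumes m: "f \<in> borel_measurable lebesgue"
    and bd: "\<And>x. cmod (f x) \<le> B * indicator {a..b} x"
  shows "square_integrable f"
proof -
  have "integrable lebesgue (\<lambda>x. B\<^sup>2 * indicat_real {a..b} x)"
    by (intro integrable_mult_right integrable_real_indicator) (auto simp: emeasure_lborel_Icc_eq)
  then have "integrable lebesgue (\<lambda>x. (cmod (f x))\<^sup>2)"
  proof (rule Bochner_Integration.integrable_bound)
    show "AE x in lebesgue. norm ((cmod (f x))\<^sup>2) \<le> norm (B\<^sup>2 * indicat_real {a..b} x)"
    proof (rule AE_I2)
      fix x
      have "(cmod (f x))\<^sup>2 \<le> (B * indicator {a..b} x)\<^sup>2"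
        by (rule power_mono[OF bd]) simp
      also have "\<dots> = B\<^sup>2 * indicator {a..b} x" by (auto simp: indicator_def)
      finally show "norm ((cmod (f x))\<^sup>2) \<le> norm (B\<^sup>2 * indicat_real {a..b} x)" by simp
    qed
  qed (use m in measurable)
  then show ?thesis using m by (simp add: square_integrable_def)
qed

lemma square_integrable_test_function:
  assumes "test_function \<phi>" shows "square_integrable \<phi>"
proof -
  obtain r B where r: "r > 0" "B > 0" "\<And>x. cmod (\<phi> x) \<le> B * indicator {-r..r} x"
    by (rule test_function_bounded[OF assms]) (rule that)
  show ?thesis
    by (rule square_integrable_bounded_support[OF test_function_measurable[OF assms] r(3)])
qed

lemma square_integrable_loc_integrable:
  assumes "square_integrable f" shows "loc_integrable f"
  unfolding loc_integrable_def
proof (intro allI)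
  fix a b
  have "square_integrable (indicator {a..b})"
    by (rule square_integrable_bounded_support[where B = 1 and a = a and b = b])
      (auto simp: indicator_def intro!: borel_measurable_indicator)
  from square_integrable_product[OF this assms]
  show "set_integrable lebesgue {a..b} f"
    by (simp add: set_integrable_def indicator_scaleR_eq_if indicator_times_eq_if)
qed

lemma integral_rep_L2_cong:
  assumes "AE x in lebesgue. rep_L2 f x = F x" "F \<in> borel_measurable lebesgue" "h \<in> borel_measurable lebesgue"
  shows "(LINT x|lebesgue. rep_L2 f x * h x) = (LINT x|lebesgue. F x * h x)"
  by (rule integral_cong_AE)
    (use assms in \<open>auto intro!: borel_measurable_times rep_L2_measurable\<close>)

text \<open>The real inner product with the conjugate of h is the real part of the bilinear pairing,
  and replacing h by -i h yields the imaginary part. Continuity of the pairing in \<open>f\<close>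
  thereby reduces to continuity of \<open>inner\<close>.\<close>

lemma pairing_conv_inner:
  assumes h: "square_integrable h"
  shows "(LINT x|lebesgue. rep_L2 f x * h x) =
    Complex (inner f (abs_L2 (\<lambda>x. cnj (h x)))) (inner f (abs_L2 (\<lambda>x. cnj (- \<i> * h x))))"
proof -
  have *: "inner f (abs_L2 (\<lambda>x. cnj (k x))) = Re (LINT x|lebesgue. rep_L2 f x * k x)"
    if k: "square_integrable k" for k
  proof -
    have m: "k \<in> borel_measurable lebesgue" using k by (simp add: square_integrable_def)
    have "inner f (abs_L2 (\<lambda>x. cnj (k x))) = (LINT x|lebesgue. inner (rep_L2 f x) (rep_L2 (abs_L2 (\<lambda>x. cnj (k x))) x))"
      by (rule inner_L2_rep)
    also have "\<dots> = (LINT x|lebesgue. Re (rep_L2 f x * k x))"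
    proof (rule integral_cong_AE)
      show "AE x in lebesgue. inner (rep_L2 f x) (rep_L2 (abs_L2 (\<lambda>x. cnj (k x))) x) = Re (rep_L2 f x * k x)"
        using rep_abs_L2[OF square_integrable_cnj[OF k]]
        by eventually_elim (simp add: inner_complex_def)
    next
      show "(\<lambda>x. inner (rep_L2 f x) (rep_L2 (abs_L2 (\<lambda>x. cnj (k x))) x)) \<in> borel_measurable lebesgue"
        by (intro borel_measurable_inner rep_L2_measurable)
      show "(\<lambda>x. Re (rep_L2 f x * k x)) \<in> borel_measurable lebesgue"
        by (intro measurable_compose[OF _ borel_measurable_Re] borel_measurable_times rep_L2_measurable m)
    qed
    also have "\<dots> = Re (LINT x|lebesgue. rep_L2 f x * k x)"
      by (rule integral_Re[OF square_integrable_product[OF square_integrable_rep k]])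
    finally show ?thesis .
  qed
  have "(LINT x|lebesgue. rep_L2 f x * (- \<i> * h x)) = (LINT x|lebesgue. - \<i> * (rep_L2 f x * h x))"
    by (simp add: algebra_simps)
  also have "\<dots> = - \<i> * (LINT x|lebesgue. rep_L2 f x * h x)"
    by (rule integral_mult_right_zero)
  finally have "Re (LINT x|lebesgue. rep_L2 f x * (- \<i> * h x)) = Im (LINT x|lebesgue. rep_L2 f x * h x)"
    by simp
  then show ?thesis
    using *[OF h] *[OF square_integrable_mult[OF h, of "- \<i>"]] by (simp add: complex_eq_iff)
qed

lemma tendsto_pairing:
  assumes "square_integrable h" "f \<longlonglongrightarrow> l"
  shows "(\<lambda>n. LINT x|lebesgue. rep_L2 (f n) x * h x) \<longlonglongrightarrow> (LINT x|lebesgue. rep_L2 l x * h x)"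
  unfolding pairing_conv_inner[OF assms(1)]
  by (intro tendsto_Complex tendsto_inner tendsto_const assms(2))

lemma L2_eq_if_pairing_eq:
  assumes "\<And>\<phi>. test_function \<phi> \<Longrightarrow> (LINT x|lebesgue. rep_L2 f x * \<phi> x) = (LINT x|lebesgue. rep_L2 g x * \<phi> x)"
  shows "f = g"
proof -
  have "AE x in lebesgue. rep_L2 f x - rep_L2 g x = 0"
  proof (rule fundamental_lemma)
    show "loc_integrable (\<lambda>x. rep_L2 f x - rep_L2 g x)"
      by (intro loc_integrable_diff square_integrable_loc_integrable square_integrable_rep)
    fix \<phi> assume "test_function \<phi>"
    then show "(LINT x|lebesgue. (rep_L2 f x - rep_L2 g x) * \<phi> x) = 0"
      using assms square_integrable_product[OF square_integrable_rep square_integrable_test_function]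
      by (simp add: left_diff_distrib)
  qed
  then show ?thesis by (intro L2_eqI) (auto elim: eventually_mono)
qed

lemma pairing_add:
  assumes "square_integrable h"
  shows "(LINT x|lebesgue. rep_L2 (f + g) x * h x) =
    (LINT x|lebesgue. rep_L2 f x * h x) + (LINT x|lebesgue. rep_L2 g x * h x)"
proof -
  have m: "h \<in> borel_measurable lebesgue" using assms by (simp add: square_integrable_def)
  have "(LINT x|lebesgue. rep_L2 (f + g) x * h x) = (LINT x|lebesgue. (rep_L2 f x + rep_L2 g x) * h x)"
    by (intro integral_rep_L2_cong rep_plus_L2 borel_measurable_add rep_L2_measurable m)
  then show ?thesis
    using square_integrable_product[OF square_integrable_rep assms] by (simp add: distrib_right)
qed

lemma pairing_scaleC:
  assumes "h \<in> borel_measurable lebesgue"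
  shows "(LINT x|lebesgue. rep_L2 (c *\<^sub>C f) x * h x) = c * (LINT x|lebesgue. rep_L2 f x * h x)"
  by (subst integral_rep_L2_cong[OF rep_scaleC_L2])
    (auto intro!: assms borel_measurable_times rep_L2_measurable simp: mult.assoc)

lemma uminus_conv_scaleC: "- f = (-1) *\<^sub>C (f :: 'a::complex_normed_vector)"
  using scaleC_of_real[of "-1" f] by simp

lemma pairing_uminus:
  assumes "h \<in> borel_measurable lebesgue"
  shows "(LINT x|lebesgue. rep_L2 (- f) x * h x) = - (LINT x|lebesgue. rep_L2 f x * h x)"
  unfolding uminus_conv_scaleC pairing_scaleC[OF assms] by simp

section \<open>Calculus of weak derivatives\<close>

lemma has_weak_derivative_unique:
  assumes "has_weak_derivative k f g" "has_weak_derivative k f g'"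
  shows "g = g'"
proof (rule L2_eq_if_pairing_eq)
  fix \<phi> assume "test_function \<phi>"
  note this[THEN assms(1)[unfolded has_weak_derivative_def, rule_format]]
    this[THEN assms(2)[unfolded has_weak_derivative_def, rule_format]]
  then have "(-1) ^ k * (LINT x|lebesgue. rep_L2 g x * \<phi> x) = (-1) ^ k * (LINT x|lebesgue. rep_L2 g' x * \<phi> x)"
    by (rule trans[OF sym])
  then show "(LINT x|lebesgue. rep_L2 g x * \<phi> x) = (LINT x|lebesgue. rep_L2 g' x * \<phi> x)"
    by simp
qed

lemma weak_derivative_eqI: "has_weak_derivative k f g \<Longrightarrow> weak_derivative k f = g"
  unfolding weak_derivative_def using has_weak_derivative_unique by blast

lemma has_weak_derivative_sobolev:
  assumes "f \<in> sobolev k" "j \<le> k"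
  shows "has_weak_derivative j f (weak_derivative j f)"
proof -
  obtain g where "has_weak_derivative j f g" using assms by (auto simp: sobolev_def)
  then show ?thesis using weak_derivative_eqI by metis
qed

lemma has_weak_derivative_0: "has_weak_derivative 0 f f"
  by (simp add: has_weak_derivative_def)

lemma has_weak_derivative_1:
  "has_weak_derivative 1 f g \<longleftrightarrow> (\<forall>\<phi>. test_function \<phi> \<longrightarrow>
     (LINT x|lebesgue. rep_L2 f x * deriv1 \<phi> x) = - (LINT x|lebesgue. rep_L2 g x * \<phi> x))"
  unfolding has_weak_derivative_def nth_derivative_1 by simp

lemma has_weak_derivative_2:
  "has_weak_derivative 2 f g \<longleftrightarrow> (\<forall>\<phi>. test_function \<phi> \<longrightarrow>
     (LINT x|lebesgue. rep_L2 f x * deriv1 (deriv1 \<phi>) x) = (LINT x|lebesgue. rep_L2 g x * \<phi> x))"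
  unfolding has_weak_derivative_def nth_derivative_2 by simp

text \<open>A second weak derivative is defined by testing directly against second derivatives.
  Because \<phi>' is again a test function, it is also the weak derivative of the first one, so
  by-parts arguments of order one apply to it.\<close>

lemma has_weak_derivative_2_split:
  assumes "has_weak_derivative 1 f f1" "has_weak_derivative 2 f f2"
  shows "has_weak_derivative 1 f1 f2"
  unfolding has_weak_derivative_1
proof (intro allI impI)
  fix \<phi> assume \<phi>: "test_function \<phi>"
  show "(LINT x|lebesgue. rep_L2 f1 x * deriv1 \<phi> x) = - (LINT x|lebesgue. rep_L2 f2 x * \<phi> x)"
    using assms(1)[unfolded has_weak_derivative_1, rule_format, OF test_function_deriv1[OF \<phi>]]
      assms(2)[unfolded has_weak_derivative_2, rule_format, OF \<phi>] by simp
qed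

lemma has_weak_derivative_2_compose:
  assumes "has_weak_derivative 1 f f1" "has_weak_derivative 1 f1 f2"
  shows "has_weak_derivative 2 f f2"
  unfolding has_weak_derivative_2
proof (intro allI impI)
  fix \<phi> assume \<phi>: "test_function \<phi>"
  show "(LINT x|lebesgue. rep_L2 f x * deriv1 (deriv1 \<phi>) x) = (LINT x|lebesgue. rep_L2 f2 x * \<phi> x)"
    using assms(1)[unfolded has_weak_derivative_1, rule_format, OF test_function_deriv1[OF \<phi>]]
      assms(2)[unfolded has_weak_derivative_1, rule_format, OF \<phi>] by simp
qed

lemma has_weak_derivative_scaleC:
  assumes "has_weak_derivative 1 f g"
  shows "has_weak_derivative 1 (c *\<^sub>C f) (c *\<^sub>C g)"
  unfolding has_weak_derivative_1
proof (intro allI impI)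
  fix \<phi> :: "real \<Rightarrow> complex" assume \<phi>: "test_function \<phi>"
  have "(LINT x|lebesgue. rep_L2 f x * deriv1 \<phi> x) = - (LINT x|lebesgue. rep_L2 g x * \<phi> x)"
    using assms \<phi> unfolding has_weak_derivative_1 by blast
  then show "(LINT x|lebesgue. rep_L2 (c *\<^sub>C f) x * deriv1 \<phi> x) = - (LINT x|lebesgue. rep_L2 (c *\<^sub>C g) x * \<phi> x)"
    by (simp add: pairing_scaleC test_function_measurable test_function_deriv1 \<phi>)
qed

lemma has_weak_derivative_test_function:
  assumes \<psi>: "test_function \<psi>"
  shows "has_weak_derivative 1 (abs_L2 \<psi>) (abs_L2 (deriv1 \<psi>))"
  unfolding has_weak_derivative_1
proof (intro allI impI)
  fix \<phi> :: "real \<Rightarrow> complex" assume \<phi>: "test_function \<phi>"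
  have "(LINT x|lebesgue. rep_L2 (abs_L2 \<psi>) x * deriv1 \<phi> x) = (LINT x|lebesgue. \<psi> x * deriv1 \<phi> x)"
    by (intro integral_rep_L2_cong rep_abs_L2 square_integrable_test_function \<psi>
        test_function_measurable test_function_deriv1 \<phi>)
  also have "\<dots> = - (LINT x|lebesgue. deriv1 \<psi> x * \<phi> x)"
    by (rule abs_cont_deriv_by_parts[OF abs_cont_deriv_test_function[OF \<psi>] \<phi>])
  also have "(LINT x|lebesgue. deriv1 \<psi> x * \<phi> x) = (LINT x|lebesgue. rep_L2 (abs_L2 (deriv1 \<psi>)) x * \<phi> x)"
    by (intro integral_rep_L2_cong[symmetric] rep_abs_L2 square_integrable_test_function
        test_function_measurable test_function_deriv1 \<psi> \<phi>)
  finally show "(LINT x|lebesgue. rep_L2 (abs_L2 \<psi>) x * deriv1 \<phi> x)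
    = - (LINT x|lebesgue. rep_L2 (abs_L2 (deriv1 \<psi>)) x * \<phi> x)" .
qed

lemma abs_cont_deriv_cnj:
  assumes "abs_cont_deriv u p"
  shows "abs_cont_deriv (\<lambda>x. cnj (u x)) (\<lambda>x. cnj (p x))"
  unfolding abs_cont_deriv_def
proof (intro conjI allI impI)
  note p = abs_cont_derivD(1)[OF assms]
  have conv: "indicator {a..b} x *\<^sub>R cnj (p x) = cnj (indicator {a..b} x *\<^sub>R p x)" for a b x :: real
    by simp
  show "loc_integrable (\<lambda>x. cnj (p x))"
    using p unfolding loc_integrable_def set_integrable_def conv complex_integrable_cnj .
  fix a b :: real assume "a \<le> b"
  then have "cnj (u b - u a) = cnj (LINT x:{a..b}|lebesgue. p x)"
    using abs_cont_derivD(2)[OF assms] by simp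
  then show "cnj (u b) - cnj (u a) = (LINT x:{a..b}|lebesgue. cnj (p x))"
    unfolding set_lebesgue_integral_def conv Bochner_Integration.integral_cnj by simp
qed

lemma abs_cont_deriv_representative:
  assumes "has_weak_derivative 1 f g"
  obtains u where "abs_cont_deriv u (rep_L2 g)" "AE x in lebesgue. rep_L2 f x = u x"
proof (rule du_bois_reymond)
  show "loc_integrable (rep_L2 f)" "loc_integrable (rep_L2 g)"
    by (intro square_integrable_loc_integrable square_integrable_rep)+
  show "(LINT x|lebesgue. rep_L2 f x * deriv1 \<phi> x) = - (LINT x|lebesgue. rep_L2 g x * \<phi> x)"
    if "test_function \<phi>" for \<phi>
    using assms that unfolding has_weak_derivative_1 by blast
qed (rule that)

text \<open>For absolutely continuous representatives the product f cnj(g) has the density f' cnj(g)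
  + f cnj(g'). Both are integrable as sums of products of square-integrable functions, so the
  density has integral zero; its real part is the claim.\<close>

lemma inner_weak_derivative_by_parts:
  assumes "has_weak_derivative 1 f f'" "has_weak_derivative 1 g g'"
  shows "inner f' g = - inner f g'"
proof -
  obtain u where u: "abs_cont_deriv u (rep_L2 f')" "AE x in lebesgue. rep_L2 f x = u x"
    by (rule abs_cont_deriv_representative[OF assms(1)])
  obtain v where v: "abs_cont_deriv v (rep_L2 g')" "AE x in lebesgue. rep_L2 g x = v x"
    by (rule abs_cont_deriv_representative[OF assms(2)])
  let ?G = "\<lambda>x. u x * cnj (v x)"
  let ?g = "\<lambda>x. rep_L2 f' x * cnj (v x) + cnj (rep_L2 g' x) * u x"
  let ?H = "\<lambda>x. rep_L2 f x * cnj (rep_L2 g x)"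
  let ?h1 = "\<lambda>x. rep_L2 f' x * cnj (rep_L2 g x)" and ?h2 = "\<lambda>x. rep_L2 f x * cnj (rep_L2 g' x)"
  have ac: "abs_cont_deriv ?G ?g"
    by (rule abs_cont_deriv_mult[OF u(1) abs_cont_deriv_cnj[OF v(1)]])
  have meas: "?G \<in> borel_measurable lebesgue" "?g \<in> borel_measurable lebesgue"
    using abs_cont_derivD(1)[OF ac] abs_cont_deriv_loc_integrable[OF ac]
    by (auto intro: loc_integrable_measurable)
  have int: "integrable lebesgue ?H" "integrable lebesgue ?h1" "integrable lebesgue ?h2"
    by (intro square_integrable_product square_integrable_cnj square_integrable_rep)+
  have eqG: "AE x in lebesgue. ?H x = ?G x" using u(2) v(2) by eventually_elim simp
  have eqg: "AE x in lebesgue. ?h1 x + ?h2 x = ?g x" using u(2) v(2) by eventually_elim simp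
  have "integrable lebesgue ?G"
    using int(1) integrable_cong_AE[OF _ meas(1) eqG] by auto
  moreover have "integrable lebesgue ?g"
    using Bochner_Integration.integrable_add[OF int(2,3)] integrable_cong_AE[OF _ meas(2) eqg] by auto
  ultimately have "(LINT x|lebesgue. ?g x) = 0"
    by (rule integral_derivative_eq_0[OF ac])
  then have "0 = (LINT x|lebesgue. ?h1 x + ?h2 x)"
    using integral_cong_AE[OF _ meas(2) eqg] int(2,3) by auto
  also have "\<dots> = (LINT x|lebesgue. ?h1 x) + (LINT x|lebesgue. ?h2 x)"
    by (rule Bochner_Integration.integral_add[OF int(2,3)])
  finally have "0 = Re (LINT x|lebesgue. ?h1 x) + Re (LINT x|lebesgue. ?h2 x)"
    by (metis plus_complex.simps(1) zero_complex.simps(1))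
  also have "Re (LINT x|lebesgue. ?h1 x) = inner f' g"
    by (subst integral_Re[OF int(2), symmetric]) (simp add: inner_L2_rep inner_complex_def)
  also have "Re (LINT x|lebesgue. ?h2 x) = inner f g'"
    by (subst integral_Re[OF int(3), symmetric]) (simp add: inner_L2_rep inner_complex_def)
  finally show ?thesis by simp
qed

section \<open>The approximate point spectrum\<close>

lemma norm_L2_le_AE:
  assumes "d \<ge> 0" "AE x in lebesgue. d * cmod (rep_L2 f x) \<le> cmod (rep_L2 g x)"
  shows "d * norm f \<le> norm g"
proof -
  have "(d * norm f)\<^sup>2 = (LINT x|lebesgue. (d * cmod (rep_L2 f x))\<^sup>2)"
    by (simp add: norm_L2_alt power_mult_distrib)
  also have "\<dots> \<le> (LINT x|lebesgue. (cmod (rep_L2 g x))\<^sup>2)"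
  proof (rule integral_mono_AE)
    show "AE x in lebesgue. (d * cmod (rep_L2 f x))\<^sup>2 \<le> (cmod (rep_L2 g x))\<^sup>2"
      using assms(2) by eventually_elim (intro power_mono, use \<open>d \<ge> 0\<close> in auto)
  qed (use square_integrable_rep[of f] square_integrable_rep[of g] in
      \<open>auto simp: square_integrable_def power_mult_distrib\<close>)
  also have "\<dots> = (norm g)\<^sup>2" by (simp add: norm_L2_alt)
  finally show ?thesis by (rule power2_le_imp_le) simp
qed

lemma norm_fst_snd_le: "norm (fst p) \<le> norm p" "norm (snd p) \<le> norm p"
  by (cases p; simp add: norm_fst_le norm_snd_le)+

text \<open>Every point of the open ball around \<open>z\<close> whose radius is the distance has a
  neighbourhood with null preimage. Lindelof reduces these neighbourhoods to countably many, so the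
  preimage of the entire ball is null.\<close>

lemma essran_AE_infdist:
  assumes [measurable]: "U \<in> borel_measurable lebesgue"
  shows "AE x in lebesgue. infdist z (essran U) \<le> cmod (U x - z)"
proof -
  let ?d = "infdist z (essran U)"
  have "\<exists>\<epsilon>>0. emeasure lebesgue {x. cmod (U x - w) < \<epsilon>} = 0" if "w \<in> ball z ?d" for w
  proof -
    have "w \<notin> essran U" using that infdist_le[of w "essran U" z] by auto
    then show ?thesis by (auto simp: essran_def)
  qed
  then obtain e where e: "\<And>w. w \<in> ball z ?d \<Longrightarrow> e w > 0"
      "\<And>w. w \<in> ball z ?d \<Longrightarrow> emeasure lebesgue {x. cmod (U x - w) < e w} = 0"
    by metis
  obtain F where F: "F \<subseteq> (\<lambda>w. ball w (e w)) ` ball z ?d" "countable F"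
      "\<Union> F = \<Union> ((\<lambda>w. ball w (e w)) ` ball z ?d)"
    using Lindelof[of "(\<lambda>w. ball w (e w)) ` ball z ?d"] by blast
  have "U -` B \<in> null_sets lebesgue" if "B \<in> F" for B
  proof -
    obtain w where w: "B = ball w (e w)" "w \<in> ball z ?d" using F(1) \<open>B \<in> F\<close> by blast
    have eq: "U -` B = {x. cmod (U x - w) < e w}"
      by (auto simp: w dist_norm norm_minus_commute)
    have "{x \<in> space lebesgue. cmod (U x - w) < e w} \<in> sets lebesgue"
      by measurable
    then show ?thesis using e(2)[OF w(2)] by (auto simp: null_sets_def eq)
  qed
  then have "(\<Union>B\<in>F. U -` B) \<in> null_sets lebesgue"
    using F(2) by (intro null_sets_UN') auto
  then have "AE x in lebesgue. x \<notin> (\<Union>B\<in>F. U -` B)" by (rule AE_not_in)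
  then show ?thesis
  proof eventually_elim
    case (elim x)
    then have "U x \<notin> \<Union> F" by auto
    then have "U x \<notin> ball z ?d" unfolding F(3) using e(1) by fastforce
    then show ?case by (simp add: dist_norm norm_minus_commute)
  qed
qed

lemma multiplication_lower_bound:
  assumes U: "U \<in> borel_measurable lebesgue" and sq: "square_integrable (\<lambda>x. U x * rep_L2 g x)"
  shows "infdist z (essran U) * norm g \<le> norm (abs_L2 (\<lambda>x. U x * rep_L2 g x) - z *\<^sub>C g)"
proof (rule norm_L2_le_AE[OF infdist_nonneg])
  show "AE x in lebesgue. infdist z (essran U) * cmod (rep_L2 g x)
      \<le> cmod (rep_L2 (abs_L2 (\<lambda>x. U x * rep_L2 g x) - z *\<^sub>C g) x)"
    using rep_minus_L2[of "abs_L2 (\<lambda>x. U x * rep_L2 g x)" "z *\<^sub>C g"] rep_abs_L2[OF sq]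
      rep_scaleC_L2[of z g] essran_AE_infdist[OF U, of z]
  proof eventually_elim
    case (elim x)
    have "infdist z (essran U) * cmod (rep_L2 g x) \<le> cmod (U x - z) * cmod (rep_L2 g x)"
      by (rule mult_right_mono[OF elim(4)]) simp
    also have "\<dots> = cmod (rep_L2 (abs_L2 (\<lambda>x. U x * rep_L2 g x) - z *\<^sub>C g) x)"
      unfolding elim(1-3) by (simp add: left_diff_distrib flip: norm_mult)
    finally show ?case .
  qed
qed

lemma inner_scaleC_self: "inner (c *\<^sub>C f) (f :: L2) = Re c * (norm f)\<^sup>2"
proof -
  have "inner (c *\<^sub>C f) f = (LINT x|lebesgue. inner (rep_L2 (c *\<^sub>C f) x) (rep_L2 f x))"
    by (rule inner_L2_rep)
  also have "\<dots> = (LINT x|lebesgue. Re c * (cmod (rep_L2 f x))\<^sup>2)"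
  proof (rule integral_cong_AE)
    show "AE x in lebesgue. inner (rep_L2 (c *\<^sub>C f) x) (rep_L2 f x) = Re c * (cmod (rep_L2 f x))\<^sup>2"
      using rep_scaleC_L2[of c f]
    proof eventually_elim
      case (elim x)
      show ?case unfolding elim
        by (simp add: inner_complex_def cmod_power2) (simp add: algebra_simps power2_eq_square)
    qed
    show "(\<lambda>x. inner (rep_L2 (c *\<^sub>C f) x) (rep_L2 f x)) \<in> borel_measurable lebesgue"
      by (intro borel_measurable_inner rep_L2_measurable)
    show "(\<lambda>x. Re c * (cmod (rep_L2 f x))\<^sup>2) \<in> borel_measurable lebesgue"
      by (intro borel_measurable_times borel_measurable_const borel_measurable_power
          measurable_compose[OF _ borel_measurable_norm] rep_L2_measurable)
  qed
  also have "\<dots> = Re c * (norm f)\<^sup>2" by (simp add: norm_L2_alt)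
  finally show ?thesis .
qed

text \<open>Test the first component of the resolvent equation with \<open>f\<close> itself, rotated by the phase of
  the resulting number.\<close>

lemma energy_estimate:
  assumes f1: "has_weak_derivative 1 f f1" and f2: "has_weak_derivative 2 f f2"
    and g1: "has_weak_derivative 1 g g1" and \<gamma>: "cmod \<gamma> = 1"
  shows "cmod (of_real ((norm f1)\<^sup>2) - z * of_real ((norm f)\<^sup>2))
    \<le> norm g * norm f1 + norm (- f2 + \<gamma> *\<^sub>C g1 - z *\<^sub>C f) * norm f"
proof -
  let ?p = "- f2 + \<gamma> *\<^sub>C g1 - z *\<^sub>C f"
  define w where "w = complex_of_real ((norm f1)\<^sup>2) - z * of_real ((norm f)\<^sup>2)"
  \<comment> \<open>Without the rotation \<open>inner\<close> would only see the real part of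
    \<open>w\<close>, whereas its modulus is to be bounded.\<close>
  obtain \<omega> where \<omega>: "cmod \<omega> = 1" "\<omega> * w = of_real (cmod w)"
  proof (cases "w = 0")
    case True
    then show thesis using that[of 1] by simp
  next
    case False
    then show thesis
      using that[of "cnj w / of_real (cmod w)"] complex_norm_square[of w]
      by (simp add: norm_divide power2_eq_square field_simps)
  qed
  have "has_weak_derivative 1 (\<omega> *\<^sub>C f1) (\<omega> *\<^sub>C f2)"
    by (rule has_weak_derivative_scaleC[OF has_weak_derivative_2_split[OF f1 f2]])
  from inner_weak_derivative_by_parts[OF this f1]
  have 1: "inner (\<omega> *\<^sub>C f2) f = - (Re \<omega> * (norm f1)\<^sup>2)" by (simp only: inner_scaleC_self)
  have 2: "inner ((\<omega> * \<gamma>) *\<^sub>C g1) f = - inner ((\<omega> * \<gamma>) *\<^sub>C g) f1"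
    by (rule inner_weak_derivative_by_parts[OF has_weak_derivative_scaleC[OF g1] f1])
  have "inner (\<omega> *\<^sub>C ?p) f = - inner (\<omega> *\<^sub>C f2) f + inner ((\<omega> * \<gamma>) *\<^sub>C g1) f - inner ((\<omega> * z) *\<^sub>C f) f"
    by (simp add: scaleC_diff_right scaleC_add_right scaleC_minus_right scaleC_scaleC
        inner_add_left inner_diff_left)
  also have "\<dots> = Re (\<omega> * w) - inner ((\<omega> * \<gamma>) *\<^sub>C g) f1"
    unfolding 1 2 inner_scaleC_self w_def by (simp add: algebra_simps)
  finally have "cmod w = inner ((\<omega> * \<gamma>) *\<^sub>C g) f1 + inner (\<omega> *\<^sub>C ?p) f"
    by (simp add: \<omega>(2))
  also have "\<dots> \<le> norm ((\<omega> * \<gamma>) *\<^sub>C g) * norm f1 + norm (\<omega> *\<^sub>C ?p) * norm f"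
    by (intro add_mono norm_cauchy_schwarz)
  also have "\<dots> = norm g * norm f1 + norm ?p * norm f"
    by (simp add: norm_scaleC \<omega>(1) norm_mult \<gamma>)
  finally show ?thesis by (simp add: w_def)
qed

text \<open>The number \<open>ray_factor z\<close> is the supremum of \<open>t / cmod (t - z)\<close> over \<open>t \<ge> 0\<close>, for \<open>z\<close> off the
  half-line \<open>t \<ge> 0\<close>: it is the norm of \<open>- d\<^sup>2/dx\<^sup>2\<close> times its resolvent at \<open>z\<close>.\<close>

definition ray_factor :: "complex \<Rightarrow> real" where
  "ray_factor z = (if Re z < 0 then 1 else cmod z / \<bar>Im z\<bar>)"

lemma Im_nonzero_off_ray:
  assumes "Re z \<ge> 0" "z \<notin> complex_of_real ` {0..}" shows "Im z \<noteq> 0"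
proof
  assume "Im z = 0"
  then have "z = complex_of_real (Re z)" by (simp add: complex_eq_iff)
  then show False using assms by (metis atLeast_iff imageI)
qed

lemma ray_factor_pos:
  assumes "z \<notin> complex_of_real ` {0..}" shows "ray_factor z > 0"
proof (cases "Re z < 0")
  case False
  have "Im z \<noteq> 0" using Im_nonzero_off_ray False assms by simp
  moreover from this have "z \<noteq> 0" by auto
  ultimately show ?thesis using False by (simp add: ray_factor_def)
qed (simp add: ray_factor_def)

text \<open>In the left half-plane the real part of a - z b is already at least a. Otherwise
  multiply by the conjugate of z: z b becomes real, so the imaginary part is -a Im z, and the
  modulus grows by the factor \<bar>z\<bar>.\<close>

lemma ray_factor_bound:
  assumes "z \<notin> complex_of_real ` {0..}" "a \<ge> 0" "b \<ge> 0"
  shows "a \<le> ray_factor z * cmod (of_real a - z * of_real b)"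
proof (cases "Re z < 0")
  case True
  then have "b * Re z \<le> 0" using assms(3) by (simp add: mult_nonneg_nonpos)
  then have "a \<le> Re (of_real a - z * of_real b)" by (simp add: mult.commute)
  also have "\<dots> \<le> cmod (of_real a - z * of_real b)" by (rule complex_Re_le_cmod)
  finally show ?thesis using True by (simp add: ray_factor_def)
next
  case False
  then have im: "\<bar>Im z\<bar> > 0" using Im_nonzero_off_ray assms(1) by simp
  have "a * \<bar>Im z\<bar> = \<bar>Im (cnj z * (of_real a - z * of_real b))\<bar>"
    using assms(2) by (simp add: algebra_simps abs_mult)
  also have "\<dots> \<le> cmod z * cmod (of_real a - z * of_real b)"
    using abs_Im_le_cmod[of "cnj z * (of_real a - z * of_real b)"] by (simp add: norm_mult)
  finally show ?thesis using False im by (simp add: ray_factor_def field_simps)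
qed

text \<open>The companion of the preceding bound that controls b in place of a. It recovers the norm
  of f once f' and g are known to be small, and for that any positive constant will do.\<close>

lemma ray_gap:
  assumes "z \<notin> complex_of_real ` {0..}"
  obtains c where "c > 0" "\<And>a b. a \<ge> 0 \<Longrightarrow> b \<ge> 0 \<Longrightarrow> c * b \<le> cmod (of_real a - z * of_real b)"
proof (cases "Re z < 0")
  case True
  show thesis
  proof (rule that[of "- Re z"])
    fix a b :: real assume "a \<ge> 0" "b \<ge> 0"
    then have "- Re z * b \<le> Re (of_real a - z * of_real b)" by simp
    also have "\<dots> \<le> cmod (of_real a - z * of_real b)" by (rule complex_Re_le_cmod)
    finally show "- Re z * b \<le> cmod (of_real a - z * of_real b)" .
  qed (use True in simp)
next
  case False
  then have im: "\<bar>Im z\<bar> > 0" using Im_nonzero_off_ray assms(1) by simp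
  show thesis
  proof (rule that[OF im])
    fix a b :: real assume "b \<ge> 0"
    then have "\<bar>Im z\<bar> * b = \<bar>Im (of_real a - z * of_real b)\<bar>" by (simp add: abs_mult)
    also have "\<dots> \<le> cmod (of_real a - z * of_real b)" by (rule abs_Im_le_cmod)
    finally show "\<bar>Im z\<bar> * b \<le> cmod (of_real a - z * of_real b)" .
  qed
qed

section \<open>The operator matrix in distributional form, and closability\<close>

lemma operator_matrixE:
  assumes "(x, y) \<in> operator_matrix U \<gamma> \<delta>"
  obtains f g f1 f2 g1 where "x = (f, g)"
    "has_weak_derivative 1 f f1" "has_weak_derivative 2 f f2" "has_weak_derivative 1 g g1"
    "square_integrable (\<lambda>x. U x * rep_L2 g x)"
    "y = (- f2 + \<gamma> *\<^sub>C g1, \<delta> *\<^sub>C f1 + abs_L2 (\<lambda>x. U x * rep_L2 g x))"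
proof -
  obtain f g where fg: "x = (f, g)" "f \<in> sobolev 2" "g \<in> sobolev 1"
      "square_integrable (\<lambda>x. U x * rep_L2 g x)" "y = matrix_map U \<gamma> \<delta> (f, g)"
    using assms by (auto simp: operator_matrix_def graph_of_def matrix_dom_def)
  have "has_weak_derivative 1 f (weak_derivative 1 f)" "has_weak_derivative 2 f (weak_derivative 2 f)"
      "has_weak_derivative 1 g (weak_derivative 1 g)"
    using fg(2,3) by (auto intro!: has_weak_derivative_sobolev)
  then show thesis by (rule that[OF fg(1) _ _ _ fg(4)]) (simp add: fg(5) matrix_map_def)
qed

lemma operator_matrixI:
  assumes "has_weak_derivative 1 f f1" "has_weak_derivative 2 f f2" "has_weak_derivative 1 g g1"
    and "square_integrable (\<lambda>x. U x * rep_L2 g x)"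
  shows "((f, g), (- f2 + \<gamma> *\<^sub>C g1, \<delta> *\<^sub>C f1 + abs_L2 (\<lambda>x. U x * rep_L2 g x))) \<in> operator_matrix U \<gamma> \<delta>"
proof -
  have "f \<in> sobolev 2" unfolding sobolev_def
  proof (intro CollectI allI impI)
    fix j :: nat assume "j \<le> 2"
    then consider "j = 0" | "j = 1" | "j = 2" by linarith
    then show "\<exists>g. has_weak_derivative j f g"
      using assms(1,2) has_weak_derivative_0 by cases auto
  qed
  moreover have "g \<in> sobolev 1" unfolding sobolev_def
  proof (intro CollectI allI impI)
    fix j :: nat assume "j \<le> 1"
    then consider "j = 0" | "j = 1" by linarith
    then show "\<exists>h. has_weak_derivative j g h"
      using assms(3) has_weak_derivative_0 by cases auto
  qed
  ultimately have "(f, g) \<in> matrix_dom U" using assms(4) by (simp add: matrix_dom_def)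
  moreover have "matrix_map U \<gamma> \<delta> (f, g) = (- f2 + \<gamma> *\<^sub>C g1, \<delta> *\<^sub>C f1 + abs_L2 (\<lambda>x. U x * rep_L2 g x))"
    using assms(1-3)[THEN weak_derivative_eqI] by (simp add: matrix_map_def)
  ultimately show ?thesis unfolding operator_matrix_def graph_of_def by (metis (mono_tags, lifting) CollectI)
qed

lemma L2_locD:
  assumes "U \<in> L2_loc"
  shows "U \<in> borel_measurable lebesgue" "set_integrable lebesgue {a..b} (\<lambda>x. (cmod (U x))\<^sup>2)"
  using assms by (auto simp: L2_loc_def)

text \<open>On [a, b] the product is dominated by B \<bar>U\<bar>. This makes U \<phi> a legitimate
  partner in the pairings used for closability, and it supplies the majorant for the products with
  \<open>U\<close> when closedness is refuted.\<close>

lemma square_integrable_L2_loc_mult: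
  assumes U: "U \<in> L2_loc" and m: "h \<in> borel_measurable lebesgue"
    and bd: "\<And>x. cmod (h x) \<le> B * indicator {a..b} x"
  shows "square_integrable (\<lambda>x. U x * h x)"
proof -
  have mUh: "(\<lambda>x. U x * h x) \<in> borel_measurable lebesgue"
    by (intro borel_measurable_times L2_locD(1)[OF U] m)
  have "integrable lebesgue (\<lambda>x. B\<^sup>2 * (indicator {a..b} x *\<^sub>R (cmod (U x))\<^sup>2))"
    using L2_locD(2)[OF U] unfolding set_integrable_def by (rule integrable_mult_right)
  then have "integrable lebesgue (\<lambda>x. (cmod (U x * h x))\<^sup>2)"
  proof (rule Bochner_Integration.integrable_bound)
    show "AE x in lebesgue. norm ((cmod (U x * h x))\<^sup>2) \<le> norm (B\<^sup>2 * (indicator {a..b} x *\<^sub>R (cmod (U x))\<^sup>2))"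
    proof (rule AE_I2)
      fix x
      have "(cmod (h x))\<^sup>2 \<le> (B * indicator {a..b} x)\<^sup>2"
        by (rule power_mono[OF bd]) simp
      also have "\<dots> = B\<^sup>2 * indicator {a..b} x" by (auto simp: indicator_def)
      finally have "(cmod (U x))\<^sup>2 * (cmod (h x))\<^sup>2 \<le> (cmod (U x))\<^sup>2 * (B\<^sup>2 * indicator {a..b} x)"
        by (rule mult_left_mono) simp
      then show "norm ((cmod (U x * h x))\<^sup>2) \<le> norm (B\<^sup>2 * (indicator {a..b} x *\<^sub>R (cmod (U x))\<^sup>2))"
        by (simp add: norm_mult power_mult_distrib mult_ac)
    qed
    show "(\<lambda>x. (cmod (U x * h x))\<^sup>2) \<in> borel_measurable lebesgue"
      by (intro borel_measurable_power measurable_compose[OF _ borel_measurable_norm] mUh)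
  qed
  then show ?thesis using mUh by (simp add: square_integrable_def)
qed

lemma square_integrable_L2_loc_test_function:
  assumes "U \<in> L2_loc" "test_function \<phi>"
  shows "square_integrable (\<lambda>x. U x * \<phi> x)"
proof -
  obtain r B where r: "r > 0" "B > 0" "\<And>x. cmod (\<phi> x) \<le> B * indicator {-r..r} x"
    by (rule test_function_bounded[OF assms(2)]) (rule that)
  show ?thesis
    by (rule square_integrable_L2_loc_mult[OF assms(1) test_function_measurable[OF assms(2)] r(3)])
qed

text \<open>In the sense of distributions the value of the operator is a continuous function of its
  argument, so it also determines the closure.\<close>

lemma operator_matrix_pairing:
  assumes U: "U \<in> L2_loc" and xy: "(x, y) \<in> operator_matrix U \<gamma> \<delta>" and \<phi>: "test_function \<phi>"
  shows "(LINT t|lebesgue. rep_L2 (fst y) t * \<phi> t) =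
      - (LINT t|lebesgue. rep_L2 (fst x) t * deriv1 (deriv1 \<phi>) t)
      - \<gamma> * (LINT t|lebesgue. rep_L2 (snd x) t * deriv1 \<phi> t)"
    and "(LINT t|lebesgue. rep_L2 (snd y) t * \<phi> t) =
      - \<delta> * (LINT t|lebesgue. rep_L2 (fst x) t * deriv1 \<phi> t)
      + (LINT t|lebesgue. rep_L2 (snd x) t * (U t * \<phi> t))"
proof -
  obtain f g f1 f2 g1 where *: "x = (f, g)"
    "has_weak_derivative 1 f f1" "has_weak_derivative 2 f f2" "has_weak_derivative 1 g g1"
    "square_integrable (\<lambda>x. U x * rep_L2 g x)"
    "y = (- f2 + \<gamma> *\<^sub>C g1, \<delta> *\<^sub>C f1 + abs_L2 (\<lambda>x. U x * rep_L2 g x))"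
    by (rule operator_matrixE[OF xy]) (rule that)
  note sq = square_integrable_test_function[OF \<phi>] and m = test_function_measurable[OF \<phi>]
  note d = *(2)[unfolded has_weak_derivative_1, rule_format, OF \<phi>]
    *(3)[unfolded has_weak_derivative_2, rule_format, OF \<phi>]
    *(4)[unfolded has_weak_derivative_1, rule_format, OF \<phi>]
  show "(LINT t|lebesgue. rep_L2 (fst y) t * \<phi> t) =
      - (LINT t|lebesgue. rep_L2 (fst x) t * deriv1 (deriv1 \<phi>) t)
      - \<gamma> * (LINT t|lebesgue. rep_L2 (snd x) t * deriv1 \<phi> t)"
    unfolding *(1,6) fst_conv snd_conv pairing_add[OF sq] pairing_uminus[OF m] pairing_scaleC[OF m] d
    by simp
  have "(LINT t|lebesgue. rep_L2 (abs_L2 (\<lambda>x. U x * rep_L2 g x)) t * \<phi> t)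
      = (LINT t|lebesgue. U t * rep_L2 g t * \<phi> t)"
    by (intro integral_rep_L2_cong rep_abs_L2 *(5) m borel_measurable_times L2_locD(1)[OF U] rep_L2_measurable)
  also have "\<dots> = (LINT t|lebesgue. rep_L2 g t * (U t * \<phi> t))"
    by (simp add: mult_ac)
  finally show "(LINT t|lebesgue. rep_L2 (snd y) t * \<phi> t) =
      - \<delta> * (LINT t|lebesgue. rep_L2 (fst x) t * deriv1 \<phi> t)
      + (LINT t|lebesgue. rep_L2 (snd x) t * (U t * \<phi> t))"
    unfolding *(1,6) fst_conv snd_conv pairing_add[OF sq] pairing_scaleC[OF m] d by simp
qed

text \<open>The weak identities survive limits, and their right-hand sides see only the argument.
  Two values over the same argument therefore have equal pairings with all test functions, which
  separate \<open>L2\<close>.\<close>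

lemma closable_operator_matrix:
  assumes U: "U \<in> L2_loc"
  shows "closable_operator (operator_matrix U \<gamma> \<delta>)"
  unfolding closable_operator_def
proof (rule single_valuedI)
  let ?F = "\<lambda>\<phi> x. - (LINT t|lebesgue. rep_L2 (fst x) t * deriv1 (deriv1 \<phi>) t)
      - \<gamma> * (LINT t|lebesgue. rep_L2 (snd x) t * deriv1 \<phi> t)"
  let ?G = "\<lambda>\<phi> x. - \<delta> * (LINT t|lebesgue. rep_L2 (fst x) t * deriv1 \<phi> t)
      + (LINT t|lebesgue. rep_L2 (snd x) t * (U t * \<phi> t))"
  have closure: "(LINT t|lebesgue. rep_L2 (fst y) t * \<phi> t) = ?F \<phi> x \<and>
      (LINT t|lebesgue. rep_L2 (snd y) t * \<phi> t) = ?G \<phi> x"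
    if xy: "(x, y) \<in> closure (operator_matrix U \<gamma> \<delta>)" and \<phi>: "test_function \<phi>" for x y \<phi>
  proof -
    obtain s where s: "\<And>n. s n \<in> operator_matrix U \<gamma> \<delta>" "s \<longlonglongrightarrow> (x, y)"
      using xy by (auto simp: closure_sequential)
    define xs where "xs n = fst (s n)" for n
    define ys where "ys n = snd (s n)" for n
    have lim: "xs \<longlonglongrightarrow> x" "ys \<longlonglongrightarrow> y"
      using tendsto_fst[OF s(2)] tendsto_snd[OF s(2)] by (simp_all add: xs_def[abs_def] ys_def[abs_def])
    note lims = tendsto_fst[OF lim(1)] tendsto_snd[OF lim(1)] tendsto_fst[OF lim(2)] tendsto_snd[OF lim(2)]
    have T: "(xs n, ys n) \<in> operator_matrix U \<gamma> \<delta>" for n using s(1)[of n] by (simp add: xs_def ys_def)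
    note sq = square_integrable_test_function[OF \<phi>]
      square_integrable_test_function[OF test_function_deriv1[OF \<phi>]]
      square_integrable_test_function[OF test_function_deriv1[OF test_function_deriv1[OF \<phi>]]]
      square_integrable_L2_loc_test_function[OF U \<phi>]
    have "(\<lambda>n. ?F \<phi> (xs n)) \<longlonglongrightarrow> ?F \<phi> x" "(\<lambda>n. ?G \<phi> (xs n)) \<longlonglongrightarrow> ?G \<phi> x"
      by (intro tendsto_intros tendsto_pairing sq lims)+
    moreover have "(\<lambda>n. ?F \<phi> (xs n)) \<longlonglongrightarrow> (LINT t|lebesgue. rep_L2 (fst y) t * \<phi> t)"
      using tendsto_pairing[OF sq(1) lims(3)] unfolding operator_matrix_pairing(1)[OF U T \<phi>] .
    moreover have "(\<lambda>n. ?G \<phi> (xs n)) \<longlonglongrightarrow> (LINT t|lebesgue. rep_L2 (snd y) t * \<phi> t)"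
      using tendsto_pairing[OF sq(1) lims(4)] unfolding operator_matrix_pairing(2)[OF U T \<phi>] .
    ultimately show ?thesis by (blast intro: LIMSEQ_unique)
  qed
  fix x y z assume "(x, y) \<in> closure (operator_matrix U \<gamma> \<delta>)" "(x, z) \<in> closure (operator_matrix U \<gamma> \<delta>)"
  note c = closure[OF this(1)] closure[OF this(2)]
  have "fst y = fst z" by (rule L2_eq_if_pairing_eq) (simp only: c)
  moreover have "snd y = snd z" by (rule L2_eq_if_pairing_eq) (simp only: c)
  ultimately show "y = z" by (rule prod_eqI)
qed

section \<open>Approximate eigenvectors away from the exceptional set\<close>

lemma nonneg_null_comparison:
  fixes a b :: "nat \<Rightarrow> real"
  assumes "\<And>n. 0 \<le> a n" "\<forall>\<^sub>F n in sequentially. a n \<le> b n" "b \<longlonglongrightarrow> 0"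
  shows "a \<longlonglongrightarrow> 0"
  by (rule Lim_null_comparison[OF _ assms(3)]) (use assms(1,2) in simp)

text \<open>With s the norm of f', the second row gives d G \<le> e + s and the first gives
  \<open>s\<^sup>2\<close> \<le> M (G s + e F). Eliminating G leaves (1/M - 1/d)
  \<open>s\<^sup>2\<close> bounded by terms containing the residual e. The norm bound 2 leaves room
  for perturbing unit vectors of the closure into the graph.\<close>

lemma approximate_eigenvectors_tend_to_0:
  assumes U: "U \<in> L2_loc" and \<gamma>: "cmod \<gamma> = 1" and \<delta>: "cmod \<delta> = 1"
    and z: "z \<notin> complex_of_real ` {0..}" and far: "ray_factor z < infdist z (essran U)"
    and T: "\<And>n. (x n, y n) \<in> operator_matrix U \<gamma> \<delta>"
    and bd: "\<And>n. norm (x n) \<le> 2" and lim: "(\<lambda>n. y n - z *\<^sub>C x n) \<longlonglongrightarrow> 0"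
  shows "x \<longlonglongrightarrow> 0"
proof -
  define d where "d = infdist z (essran U)"
  define M where "M = ray_factor z"
  \<comment> \<open>The coefficient of \<open>s\<^sup>2\<close> that survives the elimination of G;
    it is positive exactly because d > M.\<close>
  define \<kappa> where "\<kappa> = 1 / M - 1 / d"
  have M: "M > 0" unfolding M_def by (rule ray_factor_pos[OF z])
  then have d: "d > M" "d > 0" using far by (simp_all add: d_def M_def)
  have \<kappa>: "\<kappa> > 0" using M d by (simp add: \<kappa>_def field_simps)
  obtain c where c: "c > 0" "\<And>a b. a \<ge> 0 \<Longrightarrow> b \<ge> 0 \<Longrightarrow> c * b \<le> cmod (of_real a - z * of_real b)"
    by (rule ray_gap[OF z]) (rule that)
  define e where "e n = norm (y n - z *\<^sub>C x n)" for n
  define F where "F n = norm (fst (x n))" for n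
  define G where "G n = norm (snd (x n))" for n
  have e0: "e \<longlonglongrightarrow> 0" unfolding e_def using tendsto_norm_zero[OF lim] by simp
  have FG: "F n \<le> 2" "G n \<le> 2" "F n \<ge> 0" "G n \<ge> 0" "e n \<ge> 0" for n
    using bd[of n] norm_fst_snd_le[of "x n"]
    by (auto simp: F_def G_def e_def intro: order_trans)
  \<comment> \<open>The witness is the norm of f'. The three bounds come from the second row, from
    the energy estimate with \<open>ray_factor_bound\<close>, and from the energy estimate with the
    gap constant \<open>c\<close>.\<close>
  have "\<exists>s\<ge>0. d * G n \<le> e n + s \<and> s\<^sup>2 \<le> M * (G n * s + e n * F n) \<and> c * (F n)\<^sup>2 \<le> G n * s + e n * F n" for n
  proof -
    obtain f g f1 f2 g1 where *: "x n = (f, g)"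
      "has_weak_derivative 1 f f1" "has_weak_derivative 2 f f2" "has_weak_derivative 1 g g1"
      "square_integrable (\<lambda>x. U x * rep_L2 g x)"
      "y n = (- f2 + \<gamma> *\<^sub>C g1, \<delta> *\<^sub>C f1 + abs_L2 (\<lambda>x. U x * rep_L2 g x))"
      by (rule operator_matrixE[OF T[of n]]) (rule that)
    let ?p = "- f2 + \<gamma> *\<^sub>C g1 - z *\<^sub>C f"
    let ?q = "\<delta> *\<^sub>C f1 + abs_L2 (\<lambda>x. U x * rep_L2 g x) - z *\<^sub>C g"
    have pq: "norm ?p \<le> e n" "norm ?q \<le> e n"
      using norm_fst_snd_le[of "y n - z *\<^sub>C x n"]
      by (simp_all add: e_def *(1,6) scaleC_prod_def)
    have FGn: "F n = norm f" "G n = norm g" by (simp_all add: F_def G_def *(1))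
    have "d * G n \<le> norm (abs_L2 (\<lambda>x. U x * rep_L2 g x) - z *\<^sub>C g)"
      unfolding d_def FGn by (rule multiplication_lower_bound[OF L2_locD(1)[OF U] *(5)])
    also have "abs_L2 (\<lambda>x. U x * rep_L2 g x) - z *\<^sub>C g = ?q - \<delta> *\<^sub>C f1" by simp
    also have "norm \<dots> \<le> norm ?q + norm (\<delta> *\<^sub>C f1)" by (rule norm_triangle_ineq4)
    also have "\<dots> \<le> e n + norm f1" using pq(2) by (simp add: norm_scaleC \<delta>)
    finally have 1: "d * G n \<le> e n + norm f1" .
    let ?w = "cmod (of_real ((norm f1)\<^sup>2) - z * of_real ((norm f)\<^sup>2))"
    have "?w \<le> norm g * norm f1 + norm ?p * norm f"
      by (rule energy_estimate[OF *(2-4) \<gamma>])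
    also have "\<dots> \<le> G n * norm f1 + e n * F n"
      using pq(1) by (simp add: FGn mult_right_mono)
    finally have w: "?w \<le> G n * norm f1 + e n * F n" .
    have "(norm f1)\<^sup>2 \<le> M * ?w" unfolding M_def by (rule ray_factor_bound[OF z]) auto
    also have "\<dots> \<le> M * (G n * norm f1 + e n * F n)" using w M by (intro mult_left_mono) auto
    finally have 2: "(norm f1)\<^sup>2 \<le> M * (G n * norm f1 + e n * F n)" .
    have "c * (F n)\<^sup>2 \<le> ?w" unfolding FGn by (rule c(2)) auto
    then show ?thesis using 1 2 w by (intro exI[of _ "norm f1"]) auto
  qed
  then obtain s where s: "\<And>n. s n \<ge> 0" "\<And>n. d * G n \<le> e n + s n"
      "\<And>n. (s n)\<^sup>2 \<le> M * (G n * s n + e n * F n)" "\<And>n. c * (F n)\<^sup>2 \<le> G n * s n + e n * F n"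
    by metis
  have s_bd: "\<kappa> * (s n)\<^sup>2 \<le> e n * s n / d + 2 * e n" for n
  proof -
    have "G n \<le> (e n + s n) / d" using s(2)[of n] d(2) by (simp add: field_simps)
    then have "G n * s n \<le> (e n + s n) / d * s n" by (rule mult_right_mono[OF _ s(1)])
    moreover have "e n * F n \<le> e n * 2" using FG by (intro mult_left_mono) auto
    moreover have "(s n)\<^sup>2 / M \<le> G n * s n + e n * F n" using s(3)[of n] M by (simp add: field_simps)
    ultimately have "(s n)\<^sup>2 / M \<le> (e n + s n) / d * s n + e n * 2" by linarith
    then show ?thesis by (simp add: \<kappa>_def algebra_simps power2_eq_square add_divide_distrib diff_divide_distrib)
  qed
  have "\<forall>\<^sub>F n in sequentially. (s n)\<^sup>2 \<le> (2 / \<kappa>) * (e n / d + 2 * e n)"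
  proof -
    \<comment> \<open>Once e/d \<le> \<kappa>/2, half of \<kappa> \<open>s\<^sup>2\<close> absorbs
      the term e s/d, because s \<le> 1 + \<open>s\<^sup>2\<close>. No prior bound on the norm of f'
      is required.\<close>
    have "\<forall>\<^sub>F n in sequentially. e n < d * \<kappa> / 2"
      using order_tendstoD(2)[OF e0, of "d * \<kappa> / 2"] d \<kappa> by simp
    then show ?thesis
    proof eventually_elim
      case (elim n)
      then have "e n / d \<le> \<kappa> / 2" using d by (simp add: field_simps)
      have "s n \<le> 1 + (s n)\<^sup>2" using sum_squares_bound[of "s n" 1] s(1)[of n] by simp
      then have "e n / d * s n \<le> e n / d * (1 + (s n)\<^sup>2)" using FG(5) d by (intro mult_left_mono) auto
      also have "\<dots> \<le> e n / d + \<kappa> / 2 * (s n)\<^sup>2"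
        using mult_right_mono[OF \<open>e n / d \<le> \<kappa> / 2\<close>, of "(s n)\<^sup>2"] by (simp add: distrib_left)
      finally have "e n * s n / d \<le> e n / d + \<kappa> / 2 * (s n)\<^sup>2" by simp
      then have "\<kappa> / 2 * (s n)\<^sup>2 \<le> e n / d + 2 * e n" using s_bd[of n] by linarith
      then show ?case using \<kappa> by (simp add: field_simps)
    qed
  qed
  moreover have "(\<lambda>n. (2 / \<kappa>) * (e n / d + 2 * e n)) \<longlonglongrightarrow> (2 / \<kappa>) * (0 / d + 2 * 0)"
    by (intro tendsto_intros e0) (use d in auto)
  ultimately have "(\<lambda>n. (s n)\<^sup>2) \<longlonglongrightarrow> 0"
    by (intro nonneg_null_comparison[where a = "\<lambda>n. (s n)\<^sup>2"]) simp_all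
  then have s0: "s \<longlonglongrightarrow> 0" by (simp add: power_tendsto_0_iff)
  \<comment> \<open>With s under control, the second row sends G to zero, and only then does the gap
    estimate send F to zero.\<close>
  have "(\<lambda>n. (e n + s n) / d) \<longlonglongrightarrow> (0 + 0) / d" by (intro tendsto_intros e0 s0) (use d in auto)
  moreover have "G n \<le> (e n + s n) / d" for n using s(2)[of n] d by (simp add: field_simps)
  ultimately have G0: "G \<longlonglongrightarrow> 0"
    using FG(4) by (intro nonneg_null_comparison[of G]) simp_all
  have "(\<lambda>n. (1 / c) * (G n * s n + e n * 2)) \<longlonglongrightarrow> (1 / c) * (0 * 0 + 0 * 2)"
    by (intro tendsto_intros e0 s0 G0)
  then have lim0: "(\<lambda>n. (1 / c) * (G n * s n + e n * 2)) \<longlonglongrightarrow> 0" by simp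
  have F_bd: "(F n)\<^sup>2 \<le> (1 / c) * (G n * s n + e n * 2)" for n
  proof -
    have "e n * F n \<le> e n * 2" using FG by (intro mult_left_mono) auto
    then have "c * (F n)\<^sup>2 \<le> G n * s n + e n * 2" using s(4)[of n] by linarith
    then show ?thesis using c(1) by (simp add: field_simps)
  qed
  have "(\<lambda>n. (F n)\<^sup>2) \<longlonglongrightarrow> 0"
    by (rule nonneg_null_comparison[OF zero_le_power2 always_eventually[OF allI[OF F_bd]] lim0])
  then have F0: "F \<longlonglongrightarrow> 0" by (simp add: power_tendsto_0_iff)
  have "(\<lambda>n. (fst (x n), snd (x n))) \<longlonglongrightarrow> (0, 0)"
    by (rule tendsto_Pair[OF F0[unfolded F_def[abs_def], THEN tendsto_norm_zero_cancel]
          G0[unfolded G_def[abs_def], THEN tendsto_norm_zero_cancel]])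
  then show ?thesis by (simp add: zero_prod_def)
qed

text \<open>Each unit vector of the closure is replaced by an element of the graph within 1/(n+1),
  in argument and value together. The residual still tends to zero, so the replacements tend to
  zero, and with them the original vectors, contradicting their norm 1.\<close>

lemma approx_point_spectrum_closure:
  assumes U: "U \<in> L2_loc" and \<gamma>: "cmod \<gamma> = 1" and \<delta>: "cmod \<delta> = 1"
    and z: "z \<in> approx_point_spectrum (operator_closure (operator_matrix U \<gamma> \<delta>))"
    and ray: "z \<notin> complex_of_real ` {0..}"
  shows "infdist z (essran U) \<le> ray_factor z"
proof (rule ccontr)
  assume far: "\<not> infdist z (essran U) \<le> ray_factor z"
  obtain x y where xy: "\<And>n. (x n, y n) \<in> closure (operator_matrix U \<gamma> \<delta>)" "\<And>n. norm (x n) = 1"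
      "(\<lambda>n. y n - z *\<^sub>C x n) \<longlonglongrightarrow> 0"
    using z by (auto simp: approx_point_spectrum_def operator_closure_def)
  have "\<exists>p\<in>operator_matrix U \<gamma> \<delta>. dist p (x n, y n) < inverse (real (Suc n))" for n
    using xy(1)[of n] by (simp add: closure_approachable del: of_nat_Suc)
  then obtain p where p: "\<And>n. p n \<in> operator_matrix U \<gamma> \<delta>"
      "\<And>n. dist (p n) (x n, y n) < inverse (real (Suc n))"
    by metis
  define x' where "x' n = fst (p n)" for n
  define y' where "y' n = snd (p n)" for n
  have dx: "norm (x' n - x n) \<le> inverse (real (Suc n))" and dy: "norm (y' n - y n) \<le> inverse (real (Suc n))" for n
    using p(2)[of n] dist_fst_le[of "p n" "(x n, y n)"] dist_snd_le[of "p n" "(x n, y n)"]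
    by (simp_all add: x'_def y'_def dist_norm)
  have dx0: "(\<lambda>n. x' n - x n) \<longlonglongrightarrow> 0"
    by (rule Lim_null_comparison[OF always_eventually LIMSEQ_inverse_real_of_nat]) (use dx in simp)
  have dy0: "(\<lambda>n. y' n - y n) \<longlonglongrightarrow> 0"
    by (rule Lim_null_comparison[OF always_eventually LIMSEQ_inverse_real_of_nat]) (use dy in simp)
  have "x' \<longlonglongrightarrow> 0"
  proof (rule approximate_eigenvectors_tend_to_0[OF U \<gamma> \<delta> ray])
    show "ray_factor z < infdist z (essran U)" using far by simp
    show "(x' n, y' n) \<in> operator_matrix U \<gamma> \<delta>" for n using p(1) by (simp add: x'_def y'_def)
    show "norm (x' n) \<le> 2" for n
    proof -
      have "inverse (real (Suc n)) \<le> 1" by (simp add: inverse_le_1_iff)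
      then show ?thesis
        using norm_triangle_ineq[of "x' n - x n" "x n"] dx[of n] xy(2)[of n] by simp
    qed
    have "(\<lambda>n. (y n - z *\<^sub>C x n) + (y' n - y n) - z *\<^sub>C (x' n - x n)) \<longlonglongrightarrow> 0 + 0 - z *\<^sub>C 0"
      by (intro tendsto_diff tendsto_add tendsto_scaleC xy(3) dx0 dy0)
    then show "(\<lambda>n. y' n - z *\<^sub>C x' n) \<longlonglongrightarrow> 0" by (simp add: scaleC_diff_right)
  qed
  from tendsto_diff[OF this dx0] have "x \<longlonglongrightarrow> 0" by simp
  from tendsto_norm[OF this] show False by (simp add: xy(2) LIMSEQ_const_iff)
qed

section \<open>Failure of closedness\<close>

text \<open>Dominated convergence in \<open>L2\<close>: the common majorant also bounds the limit,
  so the squared difference is at most 4 \<open>(cmod (w x))\<^sup>2\<close>.\<close>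

lemma tendsto_abs_L2:
  assumes w: "square_integrable w"
    and m: "\<And>n. h n \<in> borel_measurable lebesgue" "l \<in> borel_measurable lebesgue"
    and bd: "\<And>n x. cmod (h n x) \<le> cmod (w x)"
    and lim: "\<And>x. (\<lambda>n. h n x) \<longlonglongrightarrow> l x"
  shows "square_integrable l" "(\<lambda>n. abs_L2 (h n)) \<longlonglongrightarrow> abs_L2 l"
proof -
  have iw: "integrable lebesgue (\<lambda>x. (cmod (w x))\<^sup>2)" using w by (simp add: square_integrable_def)
  have sq: "square_integrable k"
    if "k \<in> borel_measurable lebesgue" "\<And>x. cmod (k x) \<le> cmod (w x)" for k
    unfolding square_integrable_def
  proof (intro conjI that Bochner_Integration.integrable_bound[OF iw])
    show "(\<lambda>x. (cmod (k x))\<^sup>2) \<in> borel_measurable lebesgue"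
      by (intro borel_measurable_power measurable_compose[OF _ borel_measurable_norm] that)
    show "AE x in lebesgue. norm ((cmod (k x))\<^sup>2) \<le> norm ((cmod (w x))\<^sup>2)"
      by (rule AE_I2) (simp add: power_mono that)
  qed
  have bdl: "cmod (l x) \<le> cmod (w x)" for x
    by (rule LIMSEQ_le_const2[OF tendsto_norm[OF lim]]) (use bd in auto)
  note sqh = sq[OF m(1) bd] and sql = sq[OF m(2) bdl]
  show "square_integrable l" by (rule sql)
  have "(\<lambda>n. LINT x|lebesgue. (cmod (h n x - l x))\<^sup>2) \<longlonglongrightarrow> (LINT x|(lebesgue :: real measure). 0)"
  proof (rule integral_dominated_convergence)
    show "(\<lambda>x. (cmod (h n x - l x))\<^sup>2) \<in> borel_measurable lebesgue" for n
      by (intro borel_measurable_power measurable_compose[OF _ borel_measurable_norm]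
          borel_measurable_diff m)
    show "integrable lebesgue (\<lambda>x. 4 * (cmod (w x))\<^sup>2)" using iw by simp
    show "AE x in lebesgue. (\<lambda>n. (cmod (h n x - l x))\<^sup>2) \<longlonglongrightarrow> 0"
    proof (rule AE_I2)
      fix x
      have "(\<lambda>n. (cmod (h n x - l x))\<^sup>2) \<longlonglongrightarrow> (cmod (l x - l x))\<^sup>2"
        by (intro tendsto_intros lim)
      then show "(\<lambda>n. (cmod (h n x - l x))\<^sup>2) \<longlonglongrightarrow> 0" by simp
    qed
    show "AE x in lebesgue. norm ((cmod (h n x - l x))\<^sup>2) \<le> 4 * (cmod (w x))\<^sup>2" for n
    proof (rule AE_I2)
      fix x
      have "cmod (h n x - l x) \<le> 2 * cmod (w x)"
        using norm_triangle_ineq4[of "h n x" "l x"] bd[of n x] bdl[of x] by simp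
      then have "(cmod (h n x - l x))\<^sup>2 \<le> (2 * cmod (w x))\<^sup>2" by (rule power_mono) simp
      then show "norm ((cmod (h n x - l x))\<^sup>2) \<le> 4 * (cmod (w x))\<^sup>2"
        by (simp add: power_mult_distrib)
    qed
  qed simp
  moreover have "(LINT x|lebesgue. (cmod (h n x - l x))\<^sup>2) = (norm (abs_L2 (h n) - abs_L2 l))\<^sup>2" for n
  proof -
    have "abs_L2 (h n) - abs_L2 l = abs_L2 (\<lambda>x. h n x - l x)"
      by (rule minus_L2.abs_eq) (simp_all add: L2_rel_refl sqh sql)
    then have "(norm (abs_L2 (h n) - abs_L2 l))\<^sup>2 = (LINT x|lebesgue. (cmod (rep_L2 (abs_L2 (\<lambda>x. h n x - l x)) x))\<^sup>2)"
      by (simp add: norm_L2_alt)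
    also have "\<dots> = (LINT x|lebesgue. (cmod (h n x - l x))\<^sup>2)"
    proof (rule integral_cong_AE)
      show "AE x in lebesgue. (cmod (rep_L2 (abs_L2 (\<lambda>x. h n x - l x)) x))\<^sup>2 = (cmod (h n x - l x))\<^sup>2"
        using rep_abs_L2[OF square_integrable_diff[OF sqh sql], of n] by eventually_elim simp
    qed (intro borel_measurable_power measurable_compose[OF _ borel_measurable_norm]
          borel_measurable_diff m rep_L2_measurable)+
    finally show ?thesis by simp
  qed
  ultimately have "(\<lambda>n. (norm (abs_L2 (h n) - abs_L2 l))\<^sup>2) \<longlonglongrightarrow> 0" by simp
  then have "(\<lambda>n. norm (abs_L2 (h n) - abs_L2 l)) \<longlonglongrightarrow> 0" by (simp add: power_tendsto_0_iff)
  then show "(\<lambda>n. abs_L2 (h n)) \<longlonglongrightarrow> abs_L2 l"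
    by (rule LIM_zero_cancel[OF tendsto_norm_zero_cancel])
qed

section \<open>The square wave and its smooth approximations\<close>

definition square_wave :: "real \<Rightarrow> complex" where
  "square_wave x = indicator {0<..<1} x - indicator {-1<..<0} x"

text \<open>Two bumps on adjacent unit intervals replace a convolution. Being translates of each
  other, they give mean exactly zero for every \<open>n\<close>, so each wave has a compactly
  supported primitive.\<close>

definition smooth_wave :: "nat \<Rightarrow> real \<Rightarrow> complex" where
  "smooth_wave n x = bump 0 1 n x - bump (-1) 0 n x"

lemma square_wave_measurable: "square_wave \<in> borel_measurable lebesgue"
  unfolding square_wave_def[abs_def]
  by (intro borel_measurable_diff borel_measurable_indicator) auto

lemma test_function_smooth_wave: "test_function (smooth_wave n)"
  unfolding smooth_wave_def[abs_def] by (intro test_function_diff test_function_bump)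

lemma smooth_wave_outside: "x \<notin> {-1..1} \<Longrightarrow> smooth_wave n x = 0"
  using bump_outside[of x 0 1 n] bump_outside[of x "-1" 0 n] by (auto simp: smooth_wave_def)

lemma smooth_wave_bound: "cmod (smooth_wave n x) \<le> 2 * indicator {-1..1} x"
proof (cases "x \<in> {-1..1}")
  case True
  have "cmod (smooth_wave n x) \<le> cmod (bump 0 1 n x) + cmod (bump (-1) 0 n x)"
    unfolding smooth_wave_def by (rule norm_triangle_ineq4)
  also have "\<dots> \<le> indicator {0..1} x + indicator {-1..0} x" by (intro add_mono bump_bound)
  also have "\<dots> \<le> 2" by (simp add: indicator_def)
  finally show ?thesis using True by simp
qed (simp add: smooth_wave_outside)

lemma smooth_wave_tendsto: "(\<lambda>n. smooth_wave n x) \<longlonglongrightarrow> square_wave x"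
  unfolding smooth_wave_def square_wave_def by (intro tendsto_diff bump_tendsto)

lemma integral_smooth_wave: "(LINT x|lebesgue. smooth_wave n x) = 0"
proof -
  have "(LINT x|lebesgue. bump 0 1 n x) = (LINT x|lebesgue. bump 0 1 n (1 + 1 * x))"
    using lebesgue_integral_real_affine[of 1 "bump 0 1 n" 1] by simp
  also have "\<dots> = (LINT x|lebesgue. bump (-1) 0 n x)"
    by (intro Bochner_Integration.integral_cong) (auto simp: bump_def algebra_simps)
  finally show ?thesis
    using test_function_integrable[OF test_function_bump] by (simp add: smooth_wave_def)
qed

text \<open>The waves have a common support and a common bound, hence so have their primitives.
  Together with the pointwise limit this is what dominated convergence in \<open>L2\<close>
  requires.\<close>

lemma smooth_wave_antiderivatives:
  obtains \<psi> F where "\<And>n. test_function (\<psi> n)" "\<And>n. deriv1 (\<psi> n) = smooth_wave n"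
    "\<And>n x. cmod (\<psi> n x) \<le> 4 * indicator {-1..1} x" "\<And>x. (\<lambda>n. \<psi> n x) \<longlonglongrightarrow> F x"
proof -
  have "\<exists>\<psi>. test_function \<psi> \<and> deriv1 \<psi> = smooth_wave n \<and> (\<forall>x. x \<notin> {-1..1} \<longrightarrow> \<psi> x = 0)" for n
    by (rule test_function_antiderivative[OF test_function_smooth_wave[of n] integral_smooth_wave
          smooth_wave_outside]) blast+
  then obtain \<psi> where \<psi>: "\<And>n. test_function (\<psi> n)" "\<And>n. deriv1 (\<psi> n) = smooth_wave n"
      "\<And>n x. x \<notin> {-1..1} \<Longrightarrow> \<psi> n x = 0"
    by metis
  \<comment> \<open>Starting at -2 rather than -1 places the lower endpoint strictly outside the
    support, where \<psi> is known to vanish.\<close>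
  have \<psi>_eq: "\<psi> n x = (LINT y:{-2..x}|lebesgue. smooth_wave n y)" if "x \<in> {-1..1}" for n x
    using abs_cont_derivD(2)[OF abs_cont_deriv_test_function[OF \<psi>(1)], of "-2" x n] that \<psi>(3)[of "-2" n]
    by (simp add: \<psi>(2))
  have dom: "integrable lebesgue (\<lambda>x::real. 2 * indicat_real {-1..1} x)"
    by (intro integrable_mult_right integrable_real_indicator) (auto simp: emeasure_lborel_Icc_eq)
  have ptw: "norm (indicator {-2..x} y *\<^sub>R smooth_wave n y) \<le> 2 * indicat_real {-1..1} y" for n x y
    using smooth_wave_bound[of n y] by (cases "y \<in> {-2..x}") auto
  have bound: "cmod (\<psi> n x) \<le> 4 * indicator {-1..1} x" for n x
  proof (cases "x \<in> {-1..1}")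
    case True
    have "cmod (\<psi> n x) \<le> (LINT y|lebesgue. 2 * indicat_real {-1..1::real} y)"
      unfolding \<psi>_eq[OF True] set_lebesgue_integral_def
    proof (rule Bochner_Integration.integral_norm_bound_integral[OF _ dom ptw])
      show "integrable lebesgue (\<lambda>y. indicator {-2..x} y *\<^sub>R smooth_wave n y)"
        by (intro integrable_mult_indicator test_function_integrable test_function_smooth_wave) auto
    qed
    \<comment> \<open>The bound 2 on the wave times the length 2 of [-1, 1].\<close>
    also have "\<dots> = 4" by simp
    finally show ?thesis using True by simp
  qed (simp add: \<psi>(3))
  define F where "F x = (if x \<in> {-1..1} then LINT y:{-2..x}|lebesgue. square_wave y else 0)" for x
  have lim: "(\<lambda>n. \<psi> n x) \<longlonglongrightarrow> F x" for x
  proof (cases "x \<in> {-1..1}")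
    case True
    have "(\<lambda>n. LINT y:{-2..x}|lebesgue. smooth_wave n y) \<longlonglongrightarrow> (LINT y:{-2..x}|lebesgue. square_wave y)"
      unfolding set_lebesgue_integral_def
    proof (rule integral_dominated_convergence[where w = "\<lambda>x. 2 * indicat_real {-1..1} x"])
      show "(\<lambda>y. indicator {-2..x} y *\<^sub>R square_wave y) \<in> borel_measurable lebesgue"
        by (intro borel_measurable_scaleR borel_measurable_indicator square_wave_measurable) auto
      show "(\<lambda>y. indicator {-2..x} y *\<^sub>R smooth_wave n y) \<in> borel_measurable lebesgue" for n
        by (intro borel_measurable_scaleR borel_measurable_indicator test_function_measurable
            test_function_smooth_wave) auto
      show "AE y in lebesgue. (\<lambda>n. indicator {-2..x} y *\<^sub>R smooth_wave n y) \<longlonglongrightarrow> indicator {-2..x} y *\<^sub>R square_wave y"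
        by (rule AE_I2) (intro tendsto_scaleR tendsto_const smooth_wave_tendsto)
      show "AE y in lebesgue. norm (indicator {-2..x} y *\<^sub>R smooth_wave n y) \<le> 2 * indicat_real {-1..1} y" for n
        by (rule AE_I2) (rule ptw)
    qed (rule dom)
    then show ?thesis using True by (simp add: F_def \<psi>_eq)
  qed (simp add: F_def \<psi>(3) del: atLeastAtMost_iff)
  show thesis by (rule that[OF \<psi>(1,2) bound lim])
qed

lemma set_integral_Ioo_Icc:
  fixes p :: "real \<Rightarrow> complex"
  assumes "p \<in> borel_measurable lebesgue"
  shows "(LINT x:{a<..<b}|lebesgue. p x) = (LINT x:{a..b}|lebesgue. p x)"
proof (rule set_integral_cong_set)
  have "AE x in lebesgue. x \<notin> {a, b}" by (rule AE_not_in) simp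
  then show "AE x in lebesgue. (x \<in> {a..b}) = (x \<in> {a<..<b})" by eventually_elim auto
qed (use assms in \<open>auto simp: set_borel_measurable_def intro!: borel_measurable_scaleR borel_measurable_indicator\<close>)

text \<open>The jump of the square wave at the origin acts as a point mass.\<close>

lemma square_wave_pairing:
  assumes \<phi>: "test_function \<phi>" and out: "\<phi> 1 = 0" "\<phi> (-1) = 0"
  shows "(LINT x|lebesgue. square_wave x * deriv1 \<phi> x) = - 2 * \<phi> 0"
proof -
  note ac = abs_cont_deriv_test_function[OF \<phi>]
  note m = loc_integrable_measurable[OF abs_cont_derivD(1)[OF ac]]
  have int: "integrable lebesgue (\<lambda>x. indicator {a<..<b} x *\<^sub>R deriv1 \<phi> x)" for a b :: real
    by (intro integrable_mult_indicator test_function_integrable test_function_deriv1 \<phi>) auto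
  have val: "(LINT x:{a<..<b}|lebesgue. deriv1 \<phi> x) = \<phi> b - \<phi> a" if "a \<le> b" for a b
    using abs_cont_derivD(2)[OF ac that] by (simp add: set_integral_Ioo_Icc[OF m])
  have "(LINT x|lebesgue. square_wave x * deriv1 \<phi> x) =
      (LINT x|lebesgue. indicator {0<..<1} x *\<^sub>R deriv1 \<phi> x - indicator {-1<..<0} x *\<^sub>R deriv1 \<phi> x)"
    by (intro Bochner_Integration.integral_cong) (auto simp: square_wave_def indicator_def)
  also have "\<dots> = (LINT x:{0<..<1}|lebesgue. deriv1 \<phi> x) - (LINT x:{-1<..<0}|lebesgue. deriv1 \<phi> x)"
    unfolding set_lebesgue_integral_def by (rule Bochner_Integration.integral_diff[OF int int])
  also have "\<dots> = - 2 * \<phi> 0" using out by (simp add: val)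
  finally show ?thesis .
qed

text \<open>Bumps of fixed height that shrink to the origin would have constant nonzero pairing with
  the derivative, by the jump. Their pairings with a locally integrable function tend to
  zero.\<close>

lemma square_wave_not_weakly_differentiable:
  assumes sq: "square_integrable square_wave"
  shows "\<not> has_weak_derivative 1 (abs_L2 square_wave) h"
proof
  assume weak: "has_weak_derivative 1 (abs_L2 square_wave) h"
  \<comment> \<open>The half-width 1/(n+1) and the steepness n+1 cancel at the origin, so the value
    there is the same \<open>c\<close> for every \<open>n\<close>.\<close>
  define \<kappa> where "\<kappa> n = bump (- (1 / real (Suc n))) (1 / real (Suc n)) n" for n
  define c where "c = complex_of_real (bump_half 1 * bump_half 1)"
  have c: "c \<noteq> 0" by (simp add: c_def bump_half_def)
  have \<kappa>: "test_function (\<kappa> n)" for n by (simp add: \<kappa>_def test_function_bump)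
  have out: "\<kappa> n x = 0" if "\<bar>x\<bar> \<ge> 1 / real (Suc n)" for n x
    unfolding \<kappa>_def using that by (intro bump_outside) (auto simp: abs_if split: if_splits)
  have bd: "cmod (\<kappa> n x) \<le> 1 * indicator {-1..1} x" for n x
  proof (cases "x \<in> {-1..1}")
    case True
    have "cmod (\<kappa> n x) \<le> indicator {- (1 / real (Suc n))..1 / real (Suc n)} x"
      unfolding \<kappa>_def by (rule bump_bound)
    also have "\<dots> \<le> 1" by (simp add: indicator_def)
    finally show ?thesis using True by simp
  next
    case False
    then have "\<bar>x\<bar> > 1" by auto
    moreover have "1 / real (Suc n) \<le> 1" by simp
    ultimately have "\<bar>x\<bar> \<ge> 1 / real (Suc n)" by linarith
    then show ?thesis using False by (simp add: out)
  qed
  have "(LINT x|lebesgue. rep_L2 h x * \<kappa> n x) = 2 * c" for n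
  proof -
    have "\<kappa> n 1 = 0" "\<kappa> n (-1) = 0" by (intro out; simp)+
    then have "- (2 * \<kappa> n 0) = (LINT x|lebesgue. square_wave x * deriv1 (\<kappa> n) x)"
      using square_wave_pairing[OF \<kappa>] by simp
    also have "\<dots> = (LINT x|lebesgue. rep_L2 (abs_L2 square_wave) x * deriv1 (\<kappa> n) x)"
      by (intro integral_rep_L2_cong[symmetric] rep_abs_L2 sq square_wave_measurable
          test_function_measurable test_function_deriv1 \<kappa>)
    also have "\<dots> = - (LINT x|lebesgue. rep_L2 h x * \<kappa> n x)"
      using weak \<kappa> unfolding has_weak_derivative_1 by blast
    also have "\<kappa> n 0 = c" by (simp add: \<kappa>_def bump_def c_def del: of_nat_Suc)
    finally show ?thesis by simp
  qed
  moreover have "(\<lambda>n. LINT x|lebesgue. rep_L2 h x * \<kappa> n x) \<longlonglongrightarrow> (LINT x|(lebesgue :: real measure). 0)"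
  proof (rule integral_dominated_convergence)
    have "set_integrable lebesgue {-1..1} (rep_L2 h)"
      by (intro loc_integrableD square_integrable_loc_integrable square_integrable_rep)
    then show "integrable lebesgue (\<lambda>x. norm (indicator {-1..1} x *\<^sub>R rep_L2 h x))"
      unfolding set_integrable_def by (rule integrable_norm)
    show "(\<lambda>x. rep_L2 h x * \<kappa> n x) \<in> borel_measurable lebesgue" for n
      by (intro borel_measurable_times rep_L2_measurable test_function_measurable \<kappa>)
    have "AE x in lebesgue. x \<notin> {0::real}" by (rule AE_not_in) simp
    then show "AE x in lebesgue. (\<lambda>n. rep_L2 h x * \<kappa> n x) \<longlonglongrightarrow> 0"
    proof eventually_elim
      case (elim x)
      have "(\<lambda>n. 1 / real (Suc n)) \<longlonglongrightarrow> 0" by real_asymp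
      then have "\<forall>\<^sub>F n in sequentially. 1 / real (Suc n) < \<bar>x\<bar>"
        by (rule order_tendstoD(2)) (use elim in simp)
      then have "\<forall>\<^sub>F n in sequentially. rep_L2 h x * \<kappa> n x = 0"
        by eventually_elim (simp add: out del: of_nat_Suc)
      then show ?case by (rule tendsto_eventually)
    qed
    show "AE x in lebesgue. norm (rep_L2 h x * \<kappa> n x) \<le> norm (indicator {-1..1} x *\<^sub>R rep_L2 h x)" for n
    proof (rule AE_I2)
      fix x
      have "norm (rep_L2 h x * \<kappa> n x) \<le> cmod (rep_L2 h x) * (1 * indicator {-1..1} x)"
        unfolding norm_mult by (rule mult_left_mono[OF bd]) simp
      then show "norm (rep_L2 h x * \<kappa> n x) \<le> norm (indicator {-1..1} x *\<^sub>R rep_L2 h x)"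
        by (simp add: mult.commute)
    qed
  qed simp
  ultimately show False using c by (simp add: LIMSEQ_const_iff)
qed

lemma not_closed_operator_matrix:
  assumes U: "U \<in> L2_loc"
  shows "\<not> closed_operator (operator_matrix U \<gamma> \<delta>)"
proof
  assume closed: "closed_operator (operator_matrix U \<gamma> \<delta>)"
  obtain \<psi> F where \<psi>: "\<And>n. test_function (\<psi> n)" "\<And>n. deriv1 (\<psi> n) = smooth_wave n"
      "\<And>n x. cmod (\<psi> n x) \<le> 4 * indicator {-1..1} x" "\<And>x. (\<lambda>n. \<psi> n x) \<longlonglongrightarrow> F x"
    by (rule smooth_wave_antiderivatives) (rule that)
  \<comment> \<open>The factor \<gamma> makes the derivative of f n equal to \<gamma> g n. The first
    component - f'' + \<gamma> g' is then identically zero, whatever happens to the derivatives of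
    the waves.\<close>
  define f where "f n = \<gamma> *\<^sub>C abs_L2 (\<psi> n)" for n
  define g where "g n = abs_L2 (smooth_wave n)" for n
  define Ug where "Ug n = abs_L2 (\<lambda>x. U x * smooth_wave n x)" for n
  \<comment> \<open>Multiples of the indicator of [-1, 1] are the majorants for the limits below:
    height 4 for the primitives, height 2 for the waves, and height 2 times \<open>U\<close> for the
    products.\<close>
  have m_box: "(\<lambda>x::real. complex_of_real (c * indicator {-1..1} x)) \<in> borel_measurable lebesgue" for c
    by (intro measurable_compose[OF _ borel_measurable_of_real] borel_measurable_times
        borel_measurable_const borel_measurable_indicator) auto
  have box: "square_integrable (\<lambda>x::real. of_real (c * indicator {-1..1} x))" if "c \<ge> 0" for c
    by (rule square_integrable_bounded_support[OF m_box, where B = c and a = "-1" and b = 1])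
      (use that in \<open>simp add: norm_mult\<close>)
  have mw: "smooth_wave n \<in> borel_measurable lebesgue" for n
    by (rule test_function_measurable[OF test_function_smooth_wave])
  have sqUg: "square_integrable (\<lambda>x. U x * smooth_wave n x)" for n
    by (rule square_integrable_L2_loc_test_function[OF U test_function_smooth_wave])
  have UgAE: "AE x in lebesgue. U x * smooth_wave n x = U x * rep_L2 (g n) x" for n
    using rep_abs_L2[OF square_integrable_test_function[OF test_function_smooth_wave[of n]]]
    by eventually_elim (simp add: g_def)
  have mUg: "(\<lambda>x. U x * rep_L2 (g n) x) \<in> borel_measurable lebesgue" for n
    by (intro borel_measurable_times L2_locD(1)[OF U] rep_L2_measurable)
  \<comment> \<open>The domain condition refers to the chosen representative of g n, so it has to be
    transferred from the wave along almost everywhere equality.\<close>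
  have sqUg': "square_integrable (\<lambda>x. U x * rep_L2 (g n) x)" for n
  proof -
    have "integrable lebesgue (\<lambda>x. (cmod (U x * rep_L2 (g n) x))\<^sup>2)"
    proof (rule Bochner_Integration.integrable_bound)
      show "integrable lebesgue (\<lambda>x. (cmod (U x * smooth_wave n x))\<^sup>2)"
        using sqUg[of n] by (simp add: square_integrable_def)
      show "AE x in lebesgue. norm ((cmod (U x * rep_L2 (g n) x))\<^sup>2) \<le> norm ((cmod (U x * smooth_wave n x))\<^sup>2)"
        using UgAE[of n] by eventually_elim (simp only: order_refl)
    qed (intro borel_measurable_power measurable_compose[OF _ borel_measurable_norm] mUg)
    then show ?thesis using mUg by (simp add: square_integrable_def)
  qed
  have Ug_eq: "abs_L2 (\<lambda>x. U x * rep_L2 (g n) x) = Ug n" for n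
    unfolding Ug_def by (rule abs_L2_eqI[OF sqUg sqUg' UgAE, symmetric])
  have T: "((f n, g n), (0, \<delta> *\<^sub>C (\<gamma> *\<^sub>C g n) + Ug n)) \<in> operator_matrix U \<gamma> \<delta>" for n
  proof -
    let ?g1 = "abs_L2 (deriv1 (smooth_wave n))"
    have g1: "has_weak_derivative 1 (g n) ?g1"
      unfolding g_def by (rule has_weak_derivative_test_function[OF test_function_smooth_wave])
    have f1: "has_weak_derivative 1 (f n) (\<gamma> *\<^sub>C g n)"
      using has_weak_derivative_scaleC[OF has_weak_derivative_test_function[OF \<psi>(1)], of \<gamma> n]
      by (simp only: \<psi>(2) f_def g_def)
    have f2: "has_weak_derivative 2 (f n) (\<gamma> *\<^sub>C ?g1)"
      by (rule has_weak_derivative_2_compose[OF f1 has_weak_derivative_scaleC[OF g1]])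
    show ?thesis
      using operator_matrixI[OF f1 f2 g1 sqUg', of \<gamma> \<delta>] by (simp add: Ug_eq)
  qed
  have fl: "(\<lambda>n. abs_L2 (\<psi> n)) \<longlonglongrightarrow> abs_L2 F"
  proof (rule tendsto_abs_L2(2)[OF box[of 4]])
    show m: "\<psi> n \<in> borel_measurable lebesgue" for n by (rule test_function_measurable[OF \<psi>(1)])
    show "F \<in> borel_measurable lebesgue"
      by (rule borel_measurable_LIMSEQ_metric[OF m \<psi>(4)])
    show "cmod (\<psi> n x) \<le> cmod (of_real (4 * indicator {-1..1} x))" for n x
      using \<psi>(3)[of n x] unfolding norm_of_real by simp
  qed (use \<psi>(4) in auto)
  have w_le: "cmod (smooth_wave n x) \<le> cmod (of_real (2 * indicator {-1..1} x))" for n x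
    using smooth_wave_bound[of n x] unfolding norm_of_real by simp
  note gl = tendsto_abs_L2[OF box[of 2] mw square_wave_measurable w_le smooth_wave_tendsto, simplified]
  have Ul: "Ug \<longlonglongrightarrow> abs_L2 (\<lambda>x. U x * square_wave x)"
    unfolding Ug_def[abs_def]
  proof (rule tendsto_abs_L2(2))
    show "square_integrable (\<lambda>x. U x * of_real (2 * indicator {-1..1} x))"
      by (rule square_integrable_L2_loc_mult[OF U m_box, where B = 2 and a = "-1" and b = 1])
        (simp add: norm_mult)
    show "(\<lambda>x. U x * smooth_wave n x) \<in> borel_measurable lebesgue" for n
      by (intro borel_measurable_times L2_locD(1)[OF U] mw)
    show "(\<lambda>x. U x * square_wave x) \<in> borel_measurable lebesgue"
      by (intro borel_measurable_times L2_locD(1)[OF U] square_wave_measurable)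
    show "cmod (U x * smooth_wave n x) \<le> cmod (U x * of_real (2 * indicator {-1..1} x))" for n x
      unfolding norm_mult[of "U x"] by (rule mult_left_mono[OF w_le]) simp
  qed (intro tendsto_mult tendsto_const smooth_wave_tendsto)
  have lim: "(\<lambda>n. ((f n, g n), (0, \<delta> *\<^sub>C (\<gamma> *\<^sub>C g n) + Ug n))) \<longlonglongrightarrow>
      ((\<gamma> *\<^sub>C abs_L2 F, abs_L2 square_wave),
       (0, \<delta> *\<^sub>C (\<gamma> *\<^sub>C abs_L2 square_wave) + abs_L2 (\<lambda>x. U x * square_wave x)))"
    using fl gl(2) Ul unfolding f_def g_def
    by (intro tendsto_Pair tendsto_add tendsto_scaleC tendsto_const)
  have "((\<gamma> *\<^sub>C abs_L2 F, abs_L2 square_wave),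
       (0, \<delta> *\<^sub>C (\<gamma> *\<^sub>C abs_L2 square_wave) + abs_L2 (\<lambda>x. U x * square_wave x)))
     \<in> operator_matrix U \<gamma> \<delta>"
    by (rule closed_sequentially[OF closed[unfolded closed_operator_def] T lim])
  \<comment> \<open>Closedness would put the limit into the graph and thereby give the square wave a
    weak derivative.\<close>
  then obtain h where "has_weak_derivative 1 (abs_L2 square_wave) h"
    by (rule operator_matrixE) auto
  then show False using square_wave_not_weakly_differentiable[OF gl(1)] by blast
qed

theorem theorem4p15:
  fixes U :: "real \<Rightarrow> complex" and \<gamma> \<delta> :: complex
  assumes "U \<in> L2_loc" and "cmod \<gamma> = 1" and "cmod \<delta> = 1"
  shows "let T = operator_matrix U \<gamma> \<delta>;
             S = {z. Re z < 0 \<and> infdist z (essran U) \<le> 1}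
               \<union> complex_of_real ` {0..}
               \<union> {z. Re z \<ge> 0 \<and> Im z \<noteq> 0 \<and> infdist z (essran U) \<le> cmod z / \<bar>Im z\<bar>}
         in \<not> closed_operator T \<and> closable_operator T
            \<and> approx_point_spectrum (operator_closure T) \<subseteq> S
            \<and> {z. infdist z (essran U) \<le> 1} \<subseteq> S"
proof -
  let ?S = "{z. Re z < 0 \<and> infdist z (essran U) \<le> 1} \<union> complex_of_real ` {0..}
      \<union> {z. Re z \<ge> 0 \<and> Im z \<noteq> 0 \<and> infdist z (essran U) \<le> cmod z / \<bar>Im z\<bar>}"
  \<comment> \<open>Off the half-line the two distance conditions merge into one inequality with
    \<open>ray_factor\<close>, so both inclusions reduce to that inequality.\<close>
  have in_S: "z \<in> ?S" if "z \<notin> complex_of_real ` {0..} \<Longrightarrow> infdist z (essran U) \<le> ray_factor z" for z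
    using that Im_nonzero_off_ray[of z] by (cases "Re z < 0") (auto simp: ray_factor_def)
  have "approx_point_spectrum (operator_closure (operator_matrix U \<gamma> \<delta>)) \<subseteq> ?S"
    using approx_point_spectrum_closure[OF assms] by (intro subsetI in_S)
  moreover have "{z. infdist z (essran U) \<le> 1} \<subseteq> ?S"
  proof (intro subsetI in_S)
    fix z assume z: "z \<in> {z. infdist z (essran U) \<le> 1}" "z \<notin> complex_of_real ` {0..}"
    have "1 \<le> ray_factor z"
      using Im_nonzero_off_ray[OF _ z(2)] abs_Im_le_cmod[of z] by (auto simp: ray_factor_def le_divide_eq)
    then show "infdist z (essran U) \<le> ray_factor z" using z(1) by simp
  qed
  ultimately show ?thesis
    using not_closed_operator_matrix[OF assms(1)] closable_operator_matrix[OF assms(1)]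
    by (simp only: Let_def) blast
qed

end
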